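(* Let $d\ge 1$ and let $X$ be a random vector in $\mathbb{R}^d$ with density $f$ with respect to Lebesgue measure. Let $X_1,X_2,\ldots$ be i.i.d. random vectors with the same law as $X$. Assume that for some positive numbers $\varepsilon_0,\varepsilon_1,\varepsilon_2,R_1,R_2$ one has $K_{f,\alpha}(\varepsilon_0)<\infty$ for $\alpha=1,2$, $Q_f(\varepsilon_1,R_1)<\infty$ and $T_f(\varepsilon_2,R_2)<\infty$. Then the nearest-neighbor varentropy estimator $V_N$ built from $X_1,\ldots,X_N$ is asymptotically unbiased, i.e. $$\mathsf{E}(V_N)\to V\quad\text{as } N\to\infty .$$
   Context: Notation. $\rho(x,y)=\|x-y\|$ is the Euclidean distance on $\mathbb{R}^d$, $B(x,r)=\{y\in\mathbb{R}^d:\rho(x,y)<r\}$, $\log$ is the natural logarithm and $\log^{\alpha} t=(\log t)^{\alpha}$. $V_d=\pi^{d/2}/\Gamma(d/2+1)$ is the volume of the unit ball in $\mathbb{R}^d$, and $\gamma=-\int_0^\infty e^{-t}\log t\,dt$ is the Euler–Mascheroni constant. $\mathcal{S}(f)=\{x\in\mathbb{R}^d:f(x)>0\}$. Varentropy: $V=\int_{\mathcal{S}(f)} f(x)[\log f(x)]^2dx-\Big[\int_{\mathcal{S}(f)} f(x)\log f(x)\,dx\Big]^2$, that is, the variance of $-\log f(X)$. Estimator: for $N\ge2$ and $i=1,\ldots,N$ let $\rho_i=\min\{\rho(X_i,X_j): j\in\{1,\ldots,N\}\setminus\{i\}\}$ and $\zeta_i(N)=\log[\rho_i^{d}\,V_d\,e^{\gamma}(N-1)]$.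 Put $H_N=\frac1N\sum_{i=1}^N\zeta_i(N)$, $S_N^2=\frac1N\sum_{i=1}^N\big[\zeta_i^2(N)-\frac{\pi^2}{6}\big]$, and $V_N=S_N^2-H_N^2$. Functionals of $f$: let $G:[0,\infty)\to[0,\infty)$ be $G(t)=0$ for $0\le t<1$ and $G(t)=t\log t$ for $t\ge1$. Let $I_f(x,r)=\frac{1}{r^dV_d}\int_{B(x,r)}f(y)\,dy$, $M_f(x,R)=\sup_{r\in(0,R]}I_f(x,r)$, $m_f(x,R)=\inf_{r\in(0,R]}I_f(x,r)$. For positive $\varepsilon_0,\varepsilon_1,\varepsilon_2,R_1,R_2$ define, with values in $[0,\infty]$, $$K_{f,\alpha}(\varepsilon_0)=\int_{\mathbb{R}^d}\Big(\int_{\mathbb{R}^d\setminus\{x\}}G(|\log^{\alpha}\rho(x,y)|)f(y)\,dy\Big)^{1+\varepsilon_0}f(x)\,dx,$$ $$Q_f(\varepsilon_1,R_1)=\int_{\mathbb{R}^d}M_f(x,R_1)^{\varepsilon_1}f(x)\,dx,\qquad T_f(\varepsilon_2,R_2)=\int_{\mathbb{R}^d}m_f(x,R_2)^{-\varepsilon_2}f(x)\,dx .$$ *)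

theory Defs
  imports "HOL-Probability.Probability"
begin

definition positivity_set :: "('a \<Rightarrow> real) \<Rightarrow> 'a set" where
  "positivity_set f = {x. f x > 0}"

definition varentropy :: "('a::euclidean_space \<Rightarrow> real) \<Rightarrow> real" where
  "varentropy f =
     (LINT x:positivity_set f|lborel. f x * (ln (f x))\<^sup>2)
     - (LINT x:positivity_set f|lborel. f x * ln (f x))\<^sup>2"

(* Here x 1, ..., x N is the sample; the value x 0 is not used. *)

definition nn_dist :: "(nat \<Rightarrow> 'a::euclidean_space) \<Rightarrow> nat \<Rightarrow> nat \<Rightarrow> real" where
  "nn_dist x N i = Min ((\<lambda>j. dist (x i) (x j)) ` ({1..N} - {i}))"

definition zeta_nn :: "(nat \<Rightarrow> 'a::euclidean_space) \<Rightarrow> nat \<Rightarrow> nat \<Rightarrow> real" where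
  "zeta_nn x N i =
     ln (nn_dist x N i ^ DIM('a) * unit_ball_vol (real DIM('a)) * exp euler_mascheroni * (real N - 1))"

definition entropy_est :: "(nat \<Rightarrow> 'a::euclidean_space) \<Rightarrow> nat \<Rightarrow> real" where
  "entropy_est x N = (1 / real N) * (\<Sum>i=1..N. zeta_nn x N i)"

definition second_moment_est :: "(nat \<Rightarrow> 'a::euclidean_space) \<Rightarrow> nat \<Rightarrow> real" where
  "second_moment_est x N = (1 / real N) * (\<Sum>i=1..N. (zeta_nn x N i)\<^sup>2 - pi\<^sup>2 / 6)"

definition varentropy_est :: "(nat \<Rightarrow> 'a::euclidean_space) \<Rightarrow> nat \<Rightarrow> real" where
  "varentropy_est x N = second_moment_est x N - (entropy_est x N)\<^sup>2"

(* Powers with values in [0,\<infinity>]; in particular 0 to a negative power is \<infinity>,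
   whereas 0 powr p = 0 on the reals. *)
definition ennreal_powr :: "ennreal \<Rightarrow> real \<Rightarrow> ennreal" where
  "ennreal_powr a p =
     (if p = 0 then 1
      else if a = \<infinity> then (if p > 0 then \<infinity> else 0)
      else if a = 0 then (if p > 0 then 0 else \<infinity>)
      else ennreal (enn2real a powr p))"

definition G_fun :: "real \<Rightarrow> real" where
  "G_fun t = (if t < 1 then 0 else t * ln t)"

definition K_fun :: "('a::euclidean_space \<Rightarrow> real) \<Rightarrow> nat \<Rightarrow> real \<Rightarrow> ennreal" where
  "K_fun f \<alpha> e =
     (\<integral>\<^sup>+x. ennreal_powr
            (\<integral>\<^sup>+y\<in>UNIV - {x}. ennreal (G_fun \<bar>(ln (dist x y)) ^ \<alpha>\<bar>) * ennreal (f y) \<partial>lborel)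
            (1 + e)
          * ennreal (f x) \<partial>lborel)"

definition I_fun :: "('a::euclidean_space \<Rightarrow> real) \<Rightarrow> 'a \<Rightarrow> real \<Rightarrow> ennreal" where
  "I_fun f x r =
     (\<integral>\<^sup>+y\<in>ball x r. ennreal (f y) \<partial>lborel)
     / ennreal (r ^ DIM('a) * unit_ball_vol (real DIM('a)))"

definition M_fun :: "('a::euclidean_space \<Rightarrow> real) \<Rightarrow> 'a \<Rightarrow> real \<Rightarrow> ennreal" where
  "M_fun f x R = (SUP r\<in>{0<..R}. I_fun f x r)"

definition m_fun :: "('a::euclidean_space \<Rightarrow> real) \<Rightarrow> 'a \<Rightarrow> real \<Rightarrow> ennreal" where
  "m_fun f x R = (INF r\<in>{0<..R}. I_fun f x r)"

definition Q_fun :: "('a::euclidean_space \<Rightarrow> real) \<Rightarrow> real \<Rightarrow> real \<Rightarrow> ennreal" where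
  "Q_fun f e R = (\<integral>\<^sup>+x. ennreal_powr (M_fun f x R) e * ennreal (f x) \<partial>lborel)"

definition T_fun :: "('a::euclidean_space \<Rightarrow> real) \<Rightarrow> real \<Rightarrow> real \<Rightarrow> ennreal" where
  "T_fun f e R = (\<integral>\<^sup>+x. ennreal_powr (m_fun f x R) (- e) * ennreal (f x) \<partial>lborel)"

end

theory Submission
  imports Defs
begin

text \<open>
  Conditionally on \<open>X\<^sub>i = x\<close>, the event \<open>\<zeta>\<^sub>i(N) \<ge> s\<close> says that none of the other \<open>N - 1\<close> points lies in
  the ball around \<open>x\<close> of volume \<open>exp (s - \<gamma>) / (N - 1)\<close>. By Lebesgue differentiation its probability
  tends to \<open>exp (- f x exp (s - \<gamma>))\<close>, and for two indices the joint probability tends to the product, the two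
  balls being eventually disjoint. Hence \<open>(\<zeta>\<^sub>1, \<zeta>\<^sub>2)\<close> converges in law to two independent copies
  of \<open>Z = \<gamma> - ln (f X) + ln E\<close>, where \<open>E\<close> is standard exponential and independent of \<open>X\<close>.
  As \<open>ln E\<close> has mean \<open>-\<gamma>\<close> and variance \<open>\<pi>\<^sup>2/6\<close>, the variance of \<open>Z\<close> is the varentropy plus \<open>\<pi>\<^sup>2/6\<close>.

  Moments are passed to the limit through Hoeffding's formula, which writes \<open>E(UW)\<close> as a double integral
  of joint survival probabilities, by dominated convergence. Finiteness of \<open>Q_fun\<close> gives an exponential
  lower tail of \<open>\<zeta>\<^sub>i\<close> and finiteness of \<open>T_fun\<close> an exponential upper tail, the latter only as long as
  the balls have radius at most \<open>R2\<close>; so \<open>\<zeta>\<^sub>i\<close> is cut off where the nearest-neighbor distance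
  exceeds a fixed \<open>\<rho>\<close>. The error is negligible in mean square: it is dominated by the square-integrable
  \<open>ln (dist X\<^sub>i X\<^sub>j)\<close> on the event that all other points avoid the ball of radius \<open>\<rho>\<close> around \<open>X\<^sub>i\<close>.
\<close>

text \<open>Exchangeability turns \<open>E(V_N)\<close> into
  \<open>(1 - 1/N) * (E(zeta_1^2) - E(zeta_1 zeta_2)) - pi^2/6\<close>, so one second moment and one
  mixed moment decide the limit; they tend to \<open>E(Z^2)\<close> and \<open>(E Z)^2\<close>. The
  factor \<open>exp gamma\<close> in the estimator cancels the mean of \<open>ln E\<close>, and the
  subtracted \<open>pi^2/6\<close> its variance.

  Convergence in law alone does not carry second moments, hence the need for tails that are uniform
  in \<open>N\<close>. They rest on one identity: the mean number of other points in the ball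
  belonging to \<open>s\<close> is \<open>exp (s - gamma)\<close> times the average of
  \<open>f\<close> over that ball. The probability of hitting the ball is at most this mean, which
  \<open>M_fun\<close> bounds from above; the probability of missing it is at most
  \<open>exp\<close> of minus this mean, which \<open>m_fun\<close> bounds from below.

  Square-integrability of \<open>ln (dist X_i X_j)\<close> is extracted from \<open>K_fun\<close> at
  exponent 2, because \<open>G_fun\<close> grows faster than its argument.

  For given \<open>s\<close> and \<open>N\<close> the radius is the same at every center, so
  densities have to be differentiated only along a sequence of radii.\<close>

subsection \<open>Differentiation along a sequence of shrinking balls\<close>

text \<open>The balls that satisfy the inequality and lie in an open \<open>U\<close> around
  \<open>S\<close> form a Vitali cover of \<open>S\<close>; for this it is enough that the
  inequality holds infinitely often. A countable disjoint subfamily misses only a Lebesgue null set,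
  which \<open>\<mu>\<close> ignores by \<open>null\<close>, and summing over it gives
  \<open>c\<close> times the \<open>\<nu>\<close>-mass of \<open>U\<close>. The lemma is applied in
  both directions between Lebesgue measure and the law.\<close>

lemma vitali_compare:
  fixes \<mu> \<nu> :: "'a::euclidean_space measure" and c :: real
  assumes sets [measurable_cong]: "sets \<mu> = sets borel" "sets \<nu> = sets borel"
    and null: "\<And>N. N \<in> null_sets lborel \<Longrightarrow> N \<in> null_sets \<mu>"
    and S [measurable]: "S \<in> sets borel"
    and r: "r \<longlonglongrightarrow> 0" "\<And>n. 0 < r n"
    and freq: "\<And>x. x \<in> S \<Longrightarrow> \<exists>\<^sub>F n in sequentially. emeasure \<mu> (ball x (r n)) \<le> ennreal c * emeasure \<nu> (ball x (r n))"
    and outer: "\<And>\<delta>. \<delta> > 0 \<Longrightarrow> \<exists>U. open U \<and> S \<subseteq> U \<and> emeasure \<nu> U \<le> emeasure \<nu> S + ennreal \<delta>"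
    and c: "0 < c"
  shows "emeasure \<mu> S \<le> ennreal c * emeasure \<nu> S"
proof (rule ennreal_le_epsilon)
  fix e :: real assume e: "0 < e"
  \<comment> \<open>The tolerance for \<open>U\<close> is \<open>e / c\<close> because it is
    multiplied by \<open>c\<close> at the end.\<close>
  then have "e / c > 0" using c by simp
  from outer[OF this] obtain U where U: "open U" "S \<subseteq> U" "emeasure \<nu> U \<le> emeasure \<nu> S + ennreal (e / c)"
    by blast
  define K where "K = {(x, n). x \<in> S \<and> ball x (r n) \<subseteq> U \<and> emeasure \<mu> (ball x (r n)) \<le> ennreal c * emeasure \<nu> (ball x (r n))}"
  define B :: "'a \<times> nat \<Rightarrow> 'a set" where "B = (\<lambda>i. ball (fst i) (r (snd i)))"
  have cover: "\<exists>i. i \<in> K \<and> x \<in> ball (fst i) (r (snd i)) \<and> r (snd i) < d" if x: "x \<in> S" "0 < d" for x d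
  proof -
    obtain \<epsilon> where \<epsilon>: "\<epsilon> > 0" "ball x \<epsilon> \<subseteq> U" using U x by (meson openE subsetD)
    have "\<forall>\<^sub>F n in sequentially. r n < min d \<epsilon>"
      using r(1) \<epsilon> x by (intro order_tendstoD(2)[OF r(1)]) auto
    from frequently_eventually_conj[OF freq[OF x(1)] this]
    obtain n where n: "emeasure \<mu> (ball x (r n)) \<le> ennreal c * emeasure \<nu> (ball x (r n))" "r n < min d \<epsilon>"
      using frequently_ex by blast
    then have "ball x (r n) \<subseteq> U" using \<epsilon> by (meson ball_subset_ball_iff less_imp_le min.strict_boundedE order_trans subset_ball)
    then show ?thesis using n x r(2)[of n] by (intro exI[of _ "(x, n)"]) (auto simp: K_def)
  qed
  obtain C where C: "countable C" "C \<subseteq> K"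
     "pairwise (\<lambda>i j. disjnt (B i) (B j)) C" "negligible (S - (\<Union>i\<in>C. B i))"
    using Vitali_covering_theorem_balls[OF cover] unfolding B_def by blast
  have [measurable]: "B i \<in> sets borel" for i by (simp add: B_def)
  have disj: "disjoint_family_on B C"
    using C(3) by (auto simp: disjoint_family_on_def pairwise_def disjnt_def)
  have BU: "(\<Union>i\<in>C. B i) \<subseteq> U" using C(2) by (force simp: K_def B_def)
  have [measurable]: "(\<Union>i\<in>C. B i) \<in> sets borel" using C(1) by (intro sets.countable_UN'') auto
  have "S - (\<Union>i\<in>C. B i) \<in> null_sets lborel"
  proof -
    have "S - (\<Union>i\<in>C. B i) \<in> sets borel" by measurable
    then show ?thesis using C(4) unfolding negligible_iff_null_sets
      by (auto simp: null_sets_def emeasure_completion)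
  qed
  then have "emeasure \<mu> (S - (\<Union>i\<in>C. B i)) = 0" using null by auto
  then have "emeasure \<mu> S \<le> emeasure \<mu> (\<Union>i\<in>C. B i)"
    using emeasure_subadditive[of "\<Union>i\<in>C. B i" \<mu> "S - (\<Union>i\<in>C. B i)"] emeasure_mono[of S "(\<Union>i\<in>C. B i) \<union> (S - (\<Union>i\<in>C. B i))" \<mu>]
    by (auto simp: sets)
  also have "\<dots> = (\<integral>\<^sup>+i. emeasure \<mu> (B i) \<partial>count_space C)"
    using C(1) disj by (intro emeasure_UN_countable) (auto simp: sets)
  also have "\<dots> \<le> (\<integral>\<^sup>+i. ennreal c * emeasure \<nu> (B i) \<partial>count_space C)"
    using C(2) by (intro nn_integral_mono) (auto simp: K_def B_def)
  also have "\<dots> = ennreal c * (\<integral>\<^sup>+i. emeasure \<nu> (B i) \<partial>count_space C)"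
    by (intro nn_integral_cmult) auto
  also have "\<dots> \<le> ennreal c * (emeasure \<nu> S + ennreal (e / c))"
  proof (rule mult_left_mono)
    have "(\<integral>\<^sup>+i. emeasure \<nu> (B i) \<partial>count_space C) = emeasure \<nu> (\<Union>i\<in>C. B i)"
      using C(1) disj by (intro emeasure_UN_countable[symmetric]) (auto simp: sets)
    also have "\<dots> \<le> emeasure \<nu> U" using U BU by (intro emeasure_mono) (auto simp: sets)
    finally show "(\<integral>\<^sup>+i. emeasure \<nu> (B i) \<partial>count_space C) \<le> emeasure \<nu> S + ennreal (e / c)"
      using U(3) by simp
  qed simp
  also have "\<dots> = ennreal c * emeasure \<nu> S + ennreal e"
    using c e by (simp add: distrib_left ennreal_mult[symmetric])
  finally show "emeasure \<mu> S \<le> ennreal c * emeasure \<nu> S + ennreal e" .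
qed

text \<open>The ball is a section of the set of pairs \<open>(x, y)\<close> with
  \<open>dist (g x) y < h x\<close>, and measures of sections of a measurable set depend measurably
  on the parameter.\<close>

lemma borel_measurable_measure_ball:
  fixes P :: "'a::euclidean_space measure"
  assumes "prob_space P" "sets P = sets borel" "g \<in> borel_measurable N" "h \<in> borel_measurable N"
  shows "(\<lambda>x. measure P (ball (g x) (h x))) \<in> borel_measurable N"
proof -
  interpret prob_space P by fact
  note [measurable_cong] = assms(2) and [measurable] = assms(3,4)
  have "(\<lambda>x. measure P {y\<in>space P. dist (g x) y < h x}) \<in> borel_measurable N"
    by measurable
  moreover have "{y\<in>space P. dist (g x) y < h x} = ball (g x) (h x)" for x
    using sets_eq_imp_space_eq[OF assms(2)] by auto
  ultimately show ?thesis by simp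
qed

text \<open>Where convergence fails, two rationals \<open>p < q\<close> separate \<open>f x\<close>
  from values that the ratio takes infinitely often. On such a set \<open>S\<close> the comparison
  of measures gives \<open>q\<close> times volume at most mass, while \<open>f\<close> or the
  comparison gives mass at most \<open>p\<close> times volume, so \<open>S\<close> is null as soon
  as its volume is finite. Intersecting with \<open>ball 0 k\<close> provides the
  finiteness.\<close>

lemma lebesgue_differentiation_balls:
  fixes f :: "'a::euclidean_space \<Rightarrow> real"
  assumes [measurable]: "f \<in> borel_measurable borel" and nn: "\<And>x. 0 \<le> f x"
    and P: "prob_space (density lborel f)"
    and r: "r \<longlonglongrightarrow> 0" "\<And>n. 0 < r n"
  shows "AE x in lborel. (\<lambda>n. measure (density lborel f) (ball x (r n)) / measure lborel (ball x (r n))) \<longlonglongrightarrow> f x"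
proof -
  let ?P = "density lborel f"
  interpret prob_space ?P by fact
  have vol: "emeasure lborel (ball x (r n)) = ennreal (measure lborel (ball x (r n)))" for x :: 'a and n
    using emeasure_lborel_ball_finite[of x "r n"] by (intro emeasure_eq_ennreal_measure) auto
  have pos: "measure lborel (ball x (r n)) > 0" for x :: 'a and n
    using content_ball_pos[OF r(2)] by simp
  have em: "emeasure ?P A = ennreal (measure ?P A)" for A by (rule emeasure_eq_measure)
  define E where "E a b = {x. \<exists>\<^sub>F n in sequentially. a * measure lborel (ball x (r n)) \<le> b * measure ?P (ball x (r n))}" for a b :: real
  have ms [measurable]: "E a b \<in> sets borel" for a b
  proof -
    \<comment> \<open>Volumes do not depend on the center, so measurability of \<open>E a b\<close>
      reduces to that of the mass of the ball.\<close>
    have vol0: "measure lborel (ball x (r n)) = measure lborel (ball (0::'a) (r n))" for x :: 'a and n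
      using r(2) by (simp add: content_ball less_imp_le)
    have m [measurable]: "(\<lambda>x. measure ?P (ball x (r n))) \<in> borel_measurable borel" for n
      by (rule borel_measurable_measure_ball[OF P]) simp_all
    have lev: "{x. c \<le> b * w x} \<in> sets borel" if [measurable]: "w \<in> borel_measurable borel"
      for w :: "'a \<Rightarrow> real" and c by measurable
    have "E a b = (\<Inter>N. \<Union>n\<in>{N..}. {x. a * measure lborel (ball (0::'a) (r n)) \<le> b * measure ?P (ball x (r n))})"
      unfolding frequently_sequentially E_def by (subst vol0) auto
    also have "\<dots> \<in> sets borel"
      using lev[OF m] by (intro sets.countable_INT'' sets.countable_UN'') auto
    finally show ?thesis .
  qed
  have fin: "emeasure lborel (A \<inter> ball 0 (real k)) < \<infinity>" if "A \<in> sets borel" for A :: "'a set" and k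
    using emeasure_mono[of "A \<inter> ball 0 (real k)" "ball 0 (real k)" lborel] emeasure_lborel_ball_finite[of "0::'a" "real k"] 
    by (auto simp: less_top[symmetric] top_unique)
  have outP: "\<exists>U. open U \<and> S \<subseteq> U \<and> emeasure ?P U \<le> emeasure ?P S + ennreal \<delta>" if "\<delta> > 0" "S \<in> sets borel" for \<delta> S
  proof -
    have "emeasure ?P S + ennreal \<delta> > (INF U\<in>{U. S \<subseteq> U \<and> open U}. emeasure ?P U)"
      using outer_regular[of ?P S, symmetric] emeasure_finite that by (auto simp: em)
    then show ?thesis unfolding INF_less_iff by (auto intro: less_imp_le)
  qed
  have outL: "\<exists>U. open U \<and> S \<subseteq> U \<and> emeasure lborel U \<le> emeasure lborel S + ennreal \<delta>" if d: "\<delta> > 0" "S \<in> sets borel" for \<delta> and S :: "'a set"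
  proof -
    obtain U where U: "open U" "S \<subseteq> U" "emeasure lborel (U - S) < ennreal \<delta>"
      using outer_regular_lborel[OF d(2,1)] by metis
    have "emeasure lborel U \<le> emeasure lborel S + emeasure lborel (U - S)"
      using U d emeasure_subadditive[of S lborel "U - S"] by (simp add: Un_absorb1 Diff_partition)
    also have "\<dots> \<le> emeasure lborel S + ennreal \<delta>" using U by (intro add_left_mono less_imp_le)
    finally show ?thesis using U by blast
  qed
  have abs: "N \<in> null_sets ?P" if "N \<in> null_sets lborel" for N
    using that absolutely_continuousI_density[of f lborel] by (auto simp: absolutely_continuous_def)
  have up: "emeasure lborel (ball 0 (real k) \<inter> {x. f x \<le> p} \<inter> E q 1) = 0"
    (is "emeasure lborel ?S = 0") if "0 \<le> p" "p < q" for p q and k :: nat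
  proof -
    have [measurable]: "?S \<in> sets borel"
      by measurable
    have "emeasure lborel ?S \<le> ennreal (1 / q) * emeasure ?P ?S"
    proof (rule vitali_compare[OF _ _ _ _ r])
      fix x assume x: "x \<in> ?S"
      have "\<exists>\<^sub>F n in sequentially. q * measure lborel (ball x (r n)) \<le> 1 * measure ?P (ball x (r n))" using x unfolding E_def by blast
      then show "\<exists>\<^sub>F n in sequentially. emeasure lborel (ball x (r n)) \<le> ennreal (1 / q) * emeasure ?P (ball x (r n))"
        by (rule frequently_elim1) (use that in \<open>simp add: em vol ennreal_mult[symmetric] field_simps\<close>)
    qed (use that outP in auto)
    also have "\<dots> \<le> ennreal (1 / q) * (ennreal p * emeasure lborel ?S)"
    proof (rule mult_left_mono)
      have "emeasure ?P ?S = (\<integral>\<^sup>+x. ennreal (f x) * indicator ?S x \<partial>lborel)"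
        by (intro emeasure_density) auto
      also have "\<dots> \<le> (\<integral>\<^sup>+x. ennreal p * indicator ?S x \<partial>lborel)"
        using that by (intro nn_integral_mono) (auto simp: indicator_def intro!: ennreal_leI)
      also have "\<dots> = ennreal p * emeasure lborel ?S" by (simp add: nn_integral_cmult_indicator)
      finally show "emeasure ?P ?S \<le> ennreal p * emeasure lborel ?S" .
    qed simp
    finally have le: "emeasure lborel ?S \<le> ennreal (1 / q) * (ennreal p * emeasure lborel ?S)" .
    have "?S = ?S \<inter> ball 0 (real k)" by auto
    then have "emeasure lborel ?S < \<infinity>" using fin[of ?S k] by simp
    then obtain l where l: "emeasure lborel ?S = ennreal l" "l \<ge> 0" by (cases "emeasure lborel ?S") auto
    have "l \<le> 1 / q * (p * l)" using le that l by (simp add: ennreal_mult[symmetric])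
    then have "l * (q - p) \<le> 0" using that by (simp add: field_simps)
    then have "l = 0" using l that by (simp add: mult_le_0_iff)
    then show ?thesis using l by simp
  qed
  \<comment> \<open>Compared with \<open>up\<close>, the two measures exchange their roles in
    \<open>vitali_compare\<close>, and \<open>p\<close> becomes the constant there; hence it must be
    strictly positive.\<close>
  have lo: "emeasure lborel (ball 0 (real k) \<inter> {x. q \<le> f x} \<inter> E (-p) (-1)) = 0"
    (is "emeasure lborel ?S = 0") if "0 < p" "p < q" for p q and k :: nat
  proof -
    have [measurable]: "?S \<in> sets borel"
      by measurable
    have "ennreal q * emeasure lborel ?S = (\<integral>\<^sup>+x. ennreal q * indicator ?S x \<partial>lborel)" by (simp add: nn_integral_cmult_indicator)
    also have "\<dots> \<le> (\<integral>\<^sup>+x. ennreal (f x) * indicator ?S x \<partial>lborel)"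
      using that by (intro nn_integral_mono) (auto simp: indicator_def intro!: ennreal_leI)
    also have "\<dots> = emeasure ?P ?S"
      by (intro emeasure_density[symmetric]) auto
    also have "\<dots> \<le> ennreal p * emeasure lborel ?S"
    proof (rule vitali_compare[OF _ _ _ _ r])
      fix x assume x: "x \<in> ?S"
      have "\<exists>\<^sub>F n in sequentially. (-p) * measure lborel (ball x (r n)) \<le> (-1) * measure ?P (ball x (r n))" using x unfolding E_def by blast
      then show "\<exists>\<^sub>F n in sequentially. emeasure ?P (ball x (r n)) \<le> ennreal p * emeasure lborel (ball x (r n))"
        by (rule frequently_elim1) (use that in \<open>simp add: em vol ennreal_mult[symmetric] field_simps\<close>)
    qed (use that outL abs in auto)
    finally have le: "ennreal q * emeasure lborel ?S \<le> ennreal p * emeasure lborel ?S" .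
    have "?S = ?S \<inter> ball 0 (real k)" by auto
    then have "emeasure lborel ?S < \<infinity>" using fin[of ?S k] by simp
    then obtain l where l: "emeasure lborel ?S = ennreal l" "l \<ge> 0" by (cases "emeasure lborel ?S") auto
    have "q * l \<le> p * l" using le that l by (simp add: ennreal_mult[symmetric])
    then have "l * (q - p) \<le> 0" using that by (simp add: field_simps)
    then have "l = 0" using l that by (simp add: mult_le_0_iff)
    then show ?thesis using l by simp
  qed
  have "AE x in lborel. \<forall>k::nat. \<forall>p\<in>\<rat>. \<forall>q\<in>\<rat>. 0 \<le> p \<longrightarrow> p < q \<longrightarrow> x \<notin> ball 0 (real k) \<inter> {x. f x \<le> p} \<inter> E q 1"
    unfolding AE_all_countable AE_ball_countable[OF countable_rat]
    using up by (intro allI ballI AE_impI AE_not_in null_setsI) auto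
  moreover have "AE x in lborel. \<forall>k::nat. \<forall>p\<in>\<rat>. \<forall>q\<in>\<rat>. 0 < p \<longrightarrow> p < q \<longrightarrow> x \<notin> ball 0 (real k) \<inter> {x. q \<le> f x} \<inter> E (-p) (-1)"
    unfolding AE_all_countable AE_ball_countable[OF countable_rat]
    using lo by (intro allI ballI AE_impI AE_not_in null_setsI) auto
  ultimately show ?thesis
  proof eventually_elim
    case (elim x)
    obtain k :: nat where k: "x \<in> ball 0 (real k)" using reals_Archimedean2[of "norm x"] by auto
    show ?case
    proof (rule order_tendstoI)
      fix a assume a: "a < f x"
      show "\<forall>\<^sub>F n in sequentially. a < measure ?P (ball x (r n)) / measure lborel (ball x (r n))"
      \<comment> \<open>Ratios are nonnegative, which settles negative \<open>a\<close>. Otherwise a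
        rational \<open>p > a\<close> is positive, as \<open>lo\<close> demands.\<close>
      proof (cases "a < 0")
        case True
        then show ?thesis by (intro always_eventually) (auto intro: less_le_trans)
      next
        case False
        obtain p where p: "p \<in> \<rat>" "a < p" "p < f x" using Rats_dense_in_real[OF a] by blast
        obtain q where q: "q \<in> \<rat>" "p < q" "q < f x" using Rats_dense_in_real[OF p(3)] by blast
        have "\<not> (\<exists>\<^sub>F n in sequentially. (-p) * measure lborel (ball x (r n)) \<le> (-1) * measure ?P (ball x (r n)))"
          using elim(2) k p q False unfolding E_def by force
        then show ?thesis unfolding not_frequently
        proof eventually_elim
          case (elim n)
          then have "a * measure lborel (ball x (r n)) < measure ?P (ball x (r n))"
            using pos[of x n] p by (smt (verit) mult_right_mono mult_minus_left)
          then show ?case using pos[of x n] by (simp add: field_simps)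
        qed
      qed
    next
      fix a assume a: "f x < a"
      obtain q where q: "q \<in> \<rat>" "f x < q" "q < a" using Rats_dense_in_real[OF a] by blast
      obtain p where p: "p \<in> \<rat>" "f x < p" "p < q" using Rats_dense_in_real[OF q(2)] by blast
      have "0 \<le> p" using p nn[of x] by linarith
      then have "\<not> (\<exists>\<^sub>F n in sequentially. q * measure lborel (ball x (r n)) \<le> 1 * measure ?P (ball x (r n)))"
          using elim(1) k p q unfolding E_def by force
      then show "\<forall>\<^sub>F n in sequentially. measure ?P (ball x (r n)) / measure lborel (ball x (r n)) < a"
        unfolding not_frequently
      proof eventually_elim
        case (elim n)
        then have "measure ?P (ball x (r n)) < a * measure lborel (ball x (r n))"
          using pos[of x n] q by (smt (verit) mult_right_mono)
        then show ?case using pos[of x n] by (simp add: field_simps)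
      qed
    qed
  qed
qed

subsection \<open>Mixed moments from joint survival functions\<close>

text \<open>The kernel of Hoeffding's formula: as a function of \<open>s\<close> it is the indicator
  of \<open>{0<..u}\<close>, or minus the indicator of \<open>{u<..0}\<close>, so its integral over
  the line is \<open>u\<close>. Subtracting the step at 0 is what makes it integrable.\<close>

definition hstep :: "real \<Rightarrow> real \<Rightarrow> real" where
  "hstep u s = (if s \<le> u then 1 else 0) - (if s \<le> 0 then 1 else 0)"

lemma hstep_measurable [measurable (raw)]:
  assumes [measurable]: "f \<in> borel_measurable M" "g \<in> borel_measurable M"
  shows "(\<lambda>x. hstep (f x) (g x)) \<in> borel_measurable M"
  unfolding hstep_def by measurable

lemma has_bochner_integral_hstep: "has_bochner_integral lborel (hstep u) u"
proof (cases "u \<ge> 0")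
  case True
  have "has_bochner_integral lborel (indicator {0<..u}) (measure lborel {0<..u})"
    using True by (intro has_bochner_integral_real_indicator) auto
  moreover have "hstep u = indicator {0<..u}" using True by (auto simp: hstep_def fun_eq_iff indicator_def)
  ultimately show ?thesis using True by simp
next
  case False
  have "has_bochner_integral lborel (\<lambda>x. - indicator {u<..0} x) (- measure lborel {u<..0})"
    using False by (intro has_bochner_integral_minus has_bochner_integral_real_indicator) auto
  moreover have "hstep u = (\<lambda>x. - indicator {u<..0} x)" using False by (auto simp: hstep_def fun_eq_iff indicator_def)
  ultimately show ?thesis using False by simp
qed

lemma hstep_abs_le: "\<bar>hstep u s\<bar> \<le> 1"
  by (auto simp: hstep_def)

lemma integrable_exp_abs:
  fixes c :: real assumes "c > 0"
  shows "integrable lborel (\<lambda>s. exp (- c * \<bar>s\<bar>))"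
proof -
  have 1: "integrable lborel (\<lambda>s. indicator {0..} s * exp (- c * s))"
  proof (rule integrableI_nonneg)
    have "(\<integral>\<^sup>+ s. ennreal (indicator {0..} s * exp (- c * s)) \<partial>lborel)
      = (\<integral>\<^sup>+ s. ennreal (1/c) * ennreal (exponential_density c s) \<partial>lborel)"
      using assms by (intro nn_integral_cong) (auto simp: exponential_density_def ennreal_mult[symmetric] indicator_def ac_simps)
    also have "\<dots> = ennreal (1/c) * (\<integral>\<^sup>+ s. ennreal (exponential_density c s) \<partial>lborel)"
      by (intro nn_integral_cmult) simp
    also have "(\<integral>\<^sup>+ s. ennreal (exponential_density c s) \<partial>lborel) = 1"
      using prob_space.emeasure_space_1[OF prob_space_exponential_density[OF assms]] by (simp add: emeasure_density)
    finally show "(\<integral>\<^sup>+ s. ennreal (indicator {0..} s * exp (- c * s)) \<partial>lborel) < \<infinity>" by simp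
  qed auto
  from lborel_integrable_real_affine[OF this, of "-1" 0]
  have 2: "integrable lborel (\<lambda>s. indicator {0..} (- s) * exp (c * s))" by simp
  show ?thesis
    by (rule Bochner_Integration.integrable_bound[OF Bochner_Integration.integrable_add[OF 1 2]])
      (auto simp: indicator_def intro!: AE_I2)
qed

text \<open>As the kernel is bounded by 1, the product is dominated by each factor. The larger of
  \<open>\<bar>s\<bar>\<close> and \<open>\<bar>t\<bar>\<close> is at least their mean, so the
  better of the two bounds is a product of exponentials with half the rate. Thus marginal tails
  suffice, whatever the dependence of \<open>U\<close> and \<open>W\<close>.\<close>

lemma hstep_product_tail:
  assumes "prob_space M" and [measurable]: "U \<in> borel_measurable M" "W \<in> borel_measurable M"
    and tU: "\<And>s. (\<integral>x. \<bar>hstep (U x) s\<bar> \<partial>M) \<le> C * exp (- c * \<bar>s\<bar>)"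
    and tW: "\<And>s. (\<integral>x. \<bar>hstep (W x) s\<bar> \<partial>M) \<le> C * exp (- c * \<bar>s\<bar>)"
    and c: "c > 0"
  shows "(\<integral>x. \<bar>hstep (U x) s * hstep (W x) t\<bar> \<partial>M) \<le> C * (exp (- (c/2) * \<bar>s\<bar>) * exp (- (c/2) * \<bar>t\<bar>))"
    (is "?L \<le> ?R")
proof -
  interpret prob_space M by fact
  have int: "integrable M (\<lambda>x. hstep (f x) a)" if [measurable]: "f \<in> borel_measurable M" for f a
    by (rule integrable_const_bound[of _ 1]) (auto simp: hstep_abs_le)
  have int2: "integrable M (\<lambda>x. hstep (U x) s * hstep (W x) t)"
    by (rule integrable_const_bound[of _ 1]) (auto simp: abs_mult hstep_abs_le intro!: mult_le_one AE_I2)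
  have "0 \<le> (\<integral>x. \<bar>hstep (U x) 0\<bar> \<partial>M)" by (intro Bochner_Integration.integral_nonneg) simp
  also have "\<dots> \<le> C" using tU[of 0] by simp
  finally have C: "C \<ge> 0" .
  have "?L \<le> (\<integral>x. \<bar>hstep (U x) s\<bar> \<partial>M)"
    using int2 int by (intro integral_mono integrable_abs) (auto simp: abs_mult hstep_abs_le mult_left_le)
  also note tU
  finally have 1: "?L \<le> C * exp (- c * \<bar>s\<bar>)" .
  have "?L \<le> (\<integral>x. \<bar>hstep (W x) t\<bar> \<partial>M)"
    using int2 int by (intro integral_mono integrable_abs) (auto simp: abs_mult hstep_abs_le mult_left_le_one_le)
  also note tW
  finally have 2: "?L \<le> C * exp (- c * \<bar>t\<bar>)" .
  have R: "?R = C * exp (- c * ((\<bar>s\<bar> + \<bar>t\<bar>)/2))"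
    unfolding exp_add[symmetric] by (simp add: field_simps)
  show ?thesis
  proof (cases "\<bar>s\<bar> \<ge> \<bar>t\<bar>")
    case True
    then have "C * exp (- c * \<bar>s\<bar>) \<le> ?R" using C c unfolding R by (intro mult_left_mono) (auto simp: field_simps)
    then show ?thesis using 1 by simp
  next
    case False
    then have "C * exp (- c * \<bar>t\<bar>) \<le> ?R" using C c unfolding R by (intro mult_left_mono) (auto simp: field_simps)
    then show ?thesis using 2 by simp
  qed
qed

lemma (in pair_sigma_finite) product_of_integrable:
  fixes f g :: "_ \<Rightarrow> real"
  assumes f: "integrable M1 f" and g: "integrable M2 g"
  shows "integrable (M1 \<Otimes>\<^sub>M M2) (\<lambda>p. f (fst p) * g (snd p))"
    and "(\<integral>p. f (fst p) * g (snd p) \<partial>(M1 \<Otimes>\<^sub>M M2)) = (\<integral>x. f x \<partial>M1) * (\<integral>y. g y \<partial>M2)"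
proof -
  note [measurable] = borel_measurable_integrable[OF f] borel_measurable_integrable[OF g]
  show i: "integrable (M1 \<Otimes>\<^sub>M M2) (\<lambda>p. f (fst p) * g (snd p))"
    by (rule Fubini_integrable) (use f g in \<open>auto simp: abs_mult intro!: AE_I2\<close>)
  show "(\<integral>p. f (fst p) * g (snd p) \<partial>(M1 \<Otimes>\<^sub>M M2)) = (\<integral>x. f x \<partial>M1) * (\<integral>y. g y \<partial>M2)"
    using integral_fst'[OF i] by simp
qed

text \<open>Pointwise, \<open>U x * W x\<close> is the integral over \<open>(s, t)\<close> of the
  product of the two kernels. The exponential majorant of \<open>hstep_product_tail\<close> is
  integrable on the plane and justifies the exchange of integrals.\<close>

lemma expectation_product_hstep:
  assumes "prob_space M" and [measurable]: "U \<in> borel_measurable M" "W \<in> borel_measurable M"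
    and tU: "\<And>s. (\<integral>x. \<bar>hstep (U x) s\<bar> \<partial>M) \<le> C * exp (- c * \<bar>s\<bar>)"
    and tW: "\<And>s. (\<integral>x. \<bar>hstep (W x) s\<bar> \<partial>M) \<le> C * exp (- c * \<bar>s\<bar>)"
    and c: "c > 0"
  shows "integrable M (\<lambda>x. U x * W x)"
    and "(\<integral>x. U x * W x \<partial>M) = (\<integral>(s, t). (\<integral>x. hstep (U x) s * hstep (W x) t \<partial>M) \<partial>(lborel \<Otimes>\<^sub>M lborel))"
proof -
  interpret prob_space M by fact
  interpret LM: pair_sigma_finite "lborel \<Otimes>\<^sub>M lborel :: (real \<times> real) measure" M
    by standard
  let ?K = "\<lambda>x p. hstep (U x) (fst p) * hstep (W x) (snd p)"
  have int2: "integrable M (\<lambda>x. hstep (U x) s * hstep (W x) t)" for s t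
    by (rule integrable_const_bound[of _ 1]) (auto simp: abs_mult hstep_abs_le intro!: mult_le_one AE_I2)
  have int: "integrable ((lborel \<Otimes>\<^sub>M lborel) \<Otimes>\<^sub>M M) (\<lambda>(p, x). ?K x p)"
  proof (rule LM.Fubini_integrable)
    have e: "integrable lborel (\<lambda>s. exp (- (c/2) * \<bar>s\<bar>))" using c by (intro integrable_exp_abs) auto
    have "integrable (lborel \<Otimes>\<^sub>M lborel) (\<lambda>p. C * (exp (- (c/2) * \<bar>fst p\<bar>) * exp (- (c/2) * \<bar>snd p\<bar>)))"
      by (intro integrable_mult_right lborel_pair.product_of_integrable(1) e)
    then show "integrable (lborel \<Otimes>\<^sub>M lborel) (\<lambda>p. \<integral>x. norm (case (p, x) of (p, x) \<Rightarrow> ?K x p) \<partial>M)"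
      by (rule Bochner_Integration.integrable_bound)
        (auto intro!: AE_I2 order_trans[OF hstep_product_tail[OF assms]])
  qed (use int2 in auto)
  have h: "integrable lborel (hstep u)" "(\<integral>s. hstep u s \<partial>lborel) = u" for u
    using has_bochner_integral_hstep[of u] by (simp_all add: has_bochner_integral_iff)
  have inner: "(\<integral>p. ?K x p \<partial>(lborel \<Otimes>\<^sub>M lborel)) = U x * W x" for x
  proof -
    have "integrable (lborel \<Otimes>\<^sub>M lborel) (?K x)"
      using lborel_pair.product_of_integrable(1)[OF h(1)[of "U x"] h(1)[of "W x"]] .
    show ?thesis using lborel_pair.product_of_integrable(2)[OF h(1)[of "U x"] h(1)[of "W x"]] by (simp add: h)
  qed
  show "integrable M (\<lambda>x. U x * W x)"
    using LM.integrable_snd[OF int] by (simp add: inner)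
  show "(\<integral>x. U x * W x \<partial>M) = (\<integral>(s, t). (\<integral>x. hstep (U x) s * hstep (W x) t \<partial>M) \<partial>(lborel \<Otimes>\<^sub>M lborel))"
    using LM.Fubini_integral[OF int] by (simp add: inner case_prod_unfold)
qed

text \<open>Multiplying out the two kernels leaves survival probabilities only, and these are the
  quantities whose limits are known.\<close>

lemma (in prob_space) expectation_hstep_mult:
  assumes [measurable]: "U \<in> borel_measurable M" "W \<in> borel_measurable M"
  shows "(\<integral>x. hstep (U x) s * hstep (W x) t \<partial>M) = prob {x\<in>space M. s \<le> U x \<and> t \<le> W x}
      - (if s \<le> 0 then 1 else 0) * prob {x\<in>space M. t \<le> W x}
      - (if t \<le> 0 then 1 else 0) * prob {x\<in>space M. s \<le> U x} + (if s \<le> 0 then 1 else 0) * (if t \<le> 0 then 1 else 0)"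
proof -
  have "(\<integral>x. hstep (U x) s * hstep (W x) t \<partial>M) = (\<integral>x. indicator {x\<in>space M. s \<le> U x \<and> t \<le> W x} x
    - (if s \<le> 0 then 1 else 0) * indicator {x\<in>space M. t \<le> W x} x
    - (if t \<le> 0 then 1 else 0) * indicator {x\<in>space M. s \<le> U x} x + (if s \<le> 0 then 1 else 0) * (if t \<le> 0 then 1 else 0) \<partial>M)"
    by (intro Bochner_Integration.integral_cong) (auto simp: hstep_def indicator_def)
  then show ?thesis
    by (simp add: emeasure_eq_measure prob_space)
qed

lemma (in prob_space) expectation_abs_hstep:
  assumes [measurable]: "U \<in> borel_measurable M"
  shows "(\<integral>x. \<bar>hstep (U x) s\<bar> \<partial>M)
    = (if s \<le> 0 then 1 - prob {x\<in>space M. s \<le> U x} else prob {x\<in>space M. s \<le> U x})"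
proof -
  have "(\<integral>x. \<bar>hstep (U x) s\<bar> \<partial>M) = (\<integral>x. (if s \<le> 0 then 1 - indicator {x\<in>space M. s \<le> U x} x else indicator {x\<in>space M. s \<le> U x} x) \<partial>M)"
    by (intro Bochner_Integration.integral_cong) (auto simp: hstep_def indicator_def)
  then show ?thesis by (simp add: emeasure_eq_measure prob_space)
qed

text \<open>The probability spaces vary with \<open>n\<close>, so there is no pointwise convergence
  of the variables to work with. Hoeffding's formula moves the question to the fixed plane of pairs
  \<open>(s, t)\<close>, where the integrands converge through the survival probabilities and share
  one majorant.\<close>

lemma expectation_product_LIMSEQ:
  assumes P: "\<And>n. prob_space (M n)" and [measurable]: "\<And>n. U n \<in> borel_measurable (M n)" "\<And>n. W n \<in> borel_measurable (M n)"
    and P': "prob_space M'" and [measurable]: "U' \<in> borel_measurable M'" "W' \<in> borel_measurable M'"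
    and tU: "\<And>n s. (\<integral>x. \<bar>hstep (U n x) s\<bar> \<partial>M n) \<le> C * exp (- c * \<bar>s\<bar>)"
    and tW: "\<And>n s. (\<integral>x. \<bar>hstep (W n x) s\<bar> \<partial>M n) \<le> C * exp (- c * \<bar>s\<bar>)"
    and c: "c > 0"
    and joint: "\<And>s t. (\<lambda>n. measure (M n) {x\<in>space (M n). s \<le> U n x \<and> t \<le> W n x}) \<longlonglongrightarrow> measure M' {x\<in>space M'. s \<le> U' x \<and> t \<le> W' x}"
    and margU: "\<And>s. (\<lambda>n. measure (M n) {x\<in>space (M n). s \<le> U n x}) \<longlonglongrightarrow> measure M' {x\<in>space M'. s \<le> U' x}"
    and margW: "\<And>s. (\<lambda>n. measure (M n) {x\<in>space (M n). s \<le> W n x}) \<longlonglongrightarrow> measure M' {x\<in>space M'. s \<le> W' x}"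
  shows "integrable M' (\<lambda>x. U' x * W' x)"
    and "(\<lambda>n. \<integral>x. U n x * W n x \<partial>M n) \<longlonglongrightarrow> (\<integral>x. U' x * W' x \<partial>M')"
proof -
  \<comment> \<open>The limit inherits the tail bound, so its square-integrability is a conclusion
    and not an assumption.\<close>
  have tU': "(\<integral>x. \<bar>hstep (U' x) s\<bar> \<partial>M') \<le> C * exp (- c * \<bar>s\<bar>)" for s
  proof (rule LIMSEQ_le_const2)
    show "(\<lambda>n. \<integral>x. \<bar>hstep (U n x) s\<bar> \<partial>M n) \<longlonglongrightarrow> (\<integral>x. \<bar>hstep (U' x) s\<bar> \<partial>M')"
      by (simp add: prob_space.expectation_abs_hstep P P' margU tendsto_intros)
  qed (use tU in auto)
  have tW': "(\<integral>x. \<bar>hstep (W' x) s\<bar> \<partial>M') \<le> C * exp (- c * \<bar>s\<bar>)" for s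
  proof (rule LIMSEQ_le_const2)
    show "(\<lambda>n. \<integral>x. \<bar>hstep (W n x) s\<bar> \<partial>M n) \<longlonglongrightarrow> (\<integral>x. \<bar>hstep (W' x) s\<bar> \<partial>M')"
      by (simp add: prob_space.expectation_abs_hstep P P' margW tendsto_intros)
  qed (use tW in auto)
  note lim = expectation_product_hstep[OF P' _ _ tU' tW' c]
  show "integrable M' (\<lambda>x. U' x * W' x)" by (rule lim(1)) auto
  have "(\<lambda>n. \<integral>(s, t). (\<integral>x. hstep (U n x) s * hstep (W n x) t \<partial>M n) \<partial>(lborel \<Otimes>\<^sub>M lborel))
    \<longlonglongrightarrow> (\<integral>(s, t). (\<integral>x. hstep (U' x) s * hstep (W' x) t \<partial>M') \<partial>(lborel \<Otimes>\<^sub>M lborel))"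
  proof (rule integral_dominated_convergence)
    have e: "integrable lborel (\<lambda>s. exp (- (c/2) * \<bar>s\<bar>))" using c by (intro integrable_exp_abs) auto
    show "integrable (lborel \<Otimes>\<^sub>M lborel) (\<lambda>p. C * (exp (- (c/2) * \<bar>fst p\<bar>) * exp (- (c/2) * \<bar>snd p\<bar>)))"
      by (intro integrable_mult_right lborel_pair.product_of_integrable(1) e)
    show "AE p in lborel \<Otimes>\<^sub>M lborel. (\<lambda>n. case p of (s, t) \<Rightarrow> \<integral>x. hstep (U n x) s * hstep (W n x) t \<partial>M n)
       \<longlonglongrightarrow> (case p of (s, t) \<Rightarrow> \<integral>x. hstep (U' x) s * hstep (W' x) t \<partial>M')"
      by (intro AE_I2) (auto simp: prob_space.expectation_hstep_mult P P' intro!: tendsto_intros joint margU margW)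
    show "AE p in lborel \<Otimes>\<^sub>M lborel. norm (case p of (s, t) \<Rightarrow> \<integral>x. hstep (U n x) s * hstep (W n x) t \<partial>M n)
       \<le> C * (exp (- (c/2) * \<bar>fst p\<bar>) * exp (- (c/2) * \<bar>snd p\<bar>))" for n
    proof (intro AE_I2)
      fix p :: "real \<times> real"
      have "\<bar>\<integral>x. hstep (U n x) (fst p) * hstep (W n x) (snd p) \<partial>M n\<bar> \<le> (\<integral>x. \<bar>hstep (U n x) (fst p) * hstep (W n x) (snd p)\<bar> \<partial>M n)"
        by (rule integral_abs_bound)
      also note hstep_product_tail[OF P _ _ tU tW c]
      finally show "norm (case p of (s, t) \<Rightarrow> \<integral>x. hstep (U n x) s * hstep (W n x) t \<partial>M n)
       \<le> C * (exp (- (c/2) * \<bar>fst p\<bar>) * exp (- (c/2) * \<bar>snd p\<bar>))" by (simp add: case_prod_unfold)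
    qed
    show "(\<lambda>(s, t). \<integral>x. hstep (U n x) s * hstep (W n x) t \<partial>M n) \<in> borel_measurable (lborel \<Otimes>\<^sub>M lborel)" for n
    proof -
      interpret prob_space "M n" by (rule P)
      show ?thesis by measurable
    qed
    interpret prob_space M' by (rule P')
    show "(\<lambda>(s, t). \<integral>x. hstep (U' x) s * hstep (W' x) t \<partial>M') \<in> borel_measurable (lborel \<Otimes>\<^sub>M lborel)"
      by measurable
  qed
  then show "(\<lambda>n. \<integral>x. U n x * W n x \<partial>M n) \<longlonglongrightarrow> (\<integral>x. U' x * W' x \<partial>M')"
    using lim(2) expectation_product_hstep(2)[OF P _ _ tU tW c] by simp
qed

subsection \<open>Moments of the logarithm of an exponential variable\<close>

text \<open>From \<open>\<delta> * \<bar>y\<bar> \<le> exp (\<delta> * \<bar>y\<bar>)\<close>: a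
  power of \<open>y\<close> costs only a small change of the exponent, with one summand for each
  sign of \<open>y\<close>.\<close>

lemma power_mult_exp_le:
  fixes y \<theta> \<delta> :: real
  assumes "\<delta> > 0"
  shows "\<bar>y\<bar> ^ k * exp (\<theta> * y) \<le> (1 / \<delta>) ^ k * (exp ((\<theta> + k * \<delta>) * y) + exp ((\<theta> - k * \<delta>) * y))"
proof -
  have "(\<delta> * \<bar>y\<bar>) ^ k \<le> exp (\<delta> * \<bar>y\<bar>) ^ k"
    using exp_ge_add_one_self[of "\<delta> * \<bar>y\<bar>"] assms by (intro power_mono) (auto simp del: exp_ge_add_one_self)
  also have "\<dots> = exp (k * \<delta> * \<bar>y\<bar>)" by (simp add: exp_of_nat_mult[symmetric] mult.assoc)
  finally have "\<bar>y\<bar> ^ k \<le> (1 / \<delta>) ^ k * exp (k * \<delta> * \<bar>y\<bar>)"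
    using assms by (simp add: power_mult_distrib power_divide field_simps)
  then have "\<bar>y\<bar> ^ k * exp (\<theta> * y) \<le> (1 / \<delta>) ^ k * exp (k * \<delta> * \<bar>y\<bar>) * exp (\<theta> * y)"
    by (intro mult_right_mono) auto
  also have "\<dots> = (1 / \<delta>) ^ k * exp (k * \<delta> * \<bar>y\<bar> + \<theta> * y)" by (simp add: exp_add)
  also have "exp (k * \<delta> * \<bar>y\<bar> + \<theta> * y) \<le> exp ((\<theta> + k * \<delta>) * y) + exp ((\<theta> - k * \<delta>) * y)"
    by (cases "y \<ge> 0") (auto simp: algebra_simps)
  finally show ?thesis using assms by - (auto simp: mult_left_mono)
qed

text \<open>From \<open>\<bar>exp u - 1\<bar> \<le> \<bar>u\<bar> * exp \<bar>u\<bar>\<close>. After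
  division by \<open>\<bar>x - \<theta>\<bar>\<close> the right side no longer depends on
  \<open>x\<close>, and so dominates all difference quotients near \<open>\<theta>\<close>.\<close>

lemma abs_exp_diff_le:
  fixes x y \<theta> \<eta> :: real
  assumes "\<bar>x - \<theta>\<bar> \<le> \<eta>"
  shows "\<bar>exp (x * y) - exp (\<theta> * y)\<bar> \<le> \<bar>x - \<theta>\<bar> * (\<bar>y\<bar> * (exp ((\<theta> + \<eta>) * y) + exp ((\<theta> - \<eta>) * y)))"
proof -
  have *: "\<bar>exp u - 1\<bar> \<le> \<bar>u\<bar> * exp \<bar>u\<bar>" for u :: real
  proof (cases "u \<ge> 0")
    case True
    have "exp u * (1 - u) \<le> exp u * exp (- u)" using exp_ge_add_one_self[of "-u"] by (intro mult_left_mono) (auto simp del: exp_ge_add_one_self)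
    then show ?thesis using True by (simp add: exp_minus algebra_simps)
  next
    case False
    have "1 - exp u \<le> - u * 1" using exp_ge_add_one_self[of u] by linarith
    also have "\<dots> \<le> - u * exp (- u)" using False by (intro mult_left_mono) auto
    finally show ?thesis using False by simp
  qed
  have "exp (x * y) - exp (\<theta> * y) = exp (\<theta> * y) * (exp ((x - \<theta>) * y) - 1)"
    by (simp add: algebra_simps exp_diff exp_add)
  then have "\<bar>exp (x * y) - exp (\<theta> * y)\<bar> = exp (\<theta> * y) * \<bar>exp ((x - \<theta>) * y) - 1\<bar>"
    by (simp add: abs_mult)
  also have "\<dots> \<le> exp (\<theta> * y) * (\<bar>(x - \<theta>) * y\<bar> * exp (\<eta> * \<bar>y\<bar>))"
    using assms by (intro mult_left_mono order_trans[OF *]) (auto simp: abs_mult intro!: mult_left_mono mult_right_mono)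
  also have "\<dots> = \<bar>x - \<theta>\<bar> * (\<bar>y\<bar> * exp (\<theta> * y + \<eta> * \<bar>y\<bar>))" by (simp add: abs_mult exp_add)
  also have "\<dots> \<le> \<bar>x - \<theta>\<bar> * (\<bar>y\<bar> * (exp ((\<theta> + \<eta>) * y) + exp ((\<theta> - \<eta>) * y)))"
    by (intro mult_left_mono) (cases "y \<ge> 0"; auto simp: algebra_simps)+
  finally show ?thesis .
qed

lemma integrable_power_mult_exp:
  fixes Y :: "'a \<Rightarrow> real"
  assumes [measurable]: "Y \<in> borel_measurable M"
    and i: "\<And>\<theta>. \<bar>\<theta>\<bar> < a \<Longrightarrow> integrable M (\<lambda>x. exp (\<theta> * Y x))" and \<theta>: "\<bar>\<theta>\<bar> < a"
  shows "integrable M (\<lambda>x. \<bar>Y x\<bar> ^ k * exp (\<theta> * Y x))"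
proof -
  \<comment> \<open>Dividing by \<open>k + 1\<close> keeps \<open>k * \<delta>\<close> strictly
    below the distance from \<open>\<bar>\<theta>\<bar>\<close> to \<open>a\<close>.\<close>
  define \<delta> where "\<delta> = (a - \<bar>\<theta>\<bar>) / (real k + 1)"
  have \<delta>: "\<delta> > 0" using \<theta> by (simp add: \<delta>_def)
  have "k * \<delta> < a - \<bar>\<theta>\<bar>" using \<theta> by (simp add: \<delta>_def field_simps)
  moreover have "0 \<le> k * \<delta>" using \<delta> by simp
  ultimately have "\<bar>\<theta> + k * \<delta>\<bar> < a" "\<bar>\<theta> - k * \<delta>\<bar> < a" by linarith+
  then have "integrable M (\<lambda>x. (1 / \<delta>) ^ k * (exp ((\<theta> + k * \<delta>) * Y x) + exp ((\<theta> - k * \<delta>) * Y x)))"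
    by (intro integrable_mult_right Bochner_Integration.integrable_add i)
  then show ?thesis
    by (rule Bochner_Integration.integrable_bound) (use power_mult_exp_le[OF \<delta>, of _ k \<theta>] in \<open>auto intro!: AE_I2 intro: order_trans[OF _ abs_ge_self]\<close>)
qed

lemma integrable_power_mult_exp':
  fixes Y :: "'a \<Rightarrow> real"
  assumes [measurable]: "Y \<in> borel_measurable M"
    and i: "\<And>\<theta>. \<bar>\<theta>\<bar> < a \<Longrightarrow> integrable M (\<lambda>x. exp (\<theta> * Y x))" and \<theta>: "\<bar>\<theta>\<bar> < a"
  shows "integrable M (\<lambda>x. Y x ^ k * exp (\<theta> * Y x))"
  by (rule Bochner_Integration.integrable_bound[OF integrable_power_mult_exp[OF assms, of k]])
    (auto intro!: AE_I2 simp: abs_mult power_abs)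

text \<open>Differentiation under the integral sign, carried out along sequences tending to
  \<open>\<theta>\<close> so that dominated convergence applies to the difference quotients.\<close>

lemma DERIV_moment_generating:
  fixes Y :: "'a \<Rightarrow> real"
  assumes [measurable]: "Y \<in> borel_measurable M"
    and i: "\<And>\<theta>. \<bar>\<theta>\<bar> < a \<Longrightarrow> integrable M (\<lambda>x. exp (\<theta> * Y x))" and \<theta>: "\<bar>\<theta>\<bar> < a"
  shows "((\<lambda>\<theta>. \<integral>x. Y x ^ k * exp (\<theta> * Y x) \<partial>M) has_real_derivative (\<integral>x. Y x ^ Suc k * exp (\<theta> * Y x) \<partial>M)) (at \<theta>)"
  unfolding has_field_derivative_iff tendsto_at_iff_sequentially
proof (intro allI impI)
  fix X :: "nat \<Rightarrow> real" assume X: "\<forall>i. X i \<in> UNIV - {\<theta>}" "X \<longlonglongrightarrow> \<theta>"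
  \<comment> \<open>Half the distance to the boundary: the majorant uses the exponents
    \<open>\<theta> + \<eta>\<close> and \<open>\<theta> - \<eta>\<close>, both still inside the
    interval of integrability.\<close>
  define \<eta> where "\<eta> = (a - \<bar>\<theta>\<bar>) / 2"
  have "0 < \<eta>" "\<eta> < a - \<bar>\<theta>\<bar>" using \<theta> by (simp_all add: \<eta>_def)
  then have \<eta>: "\<eta> > 0" "\<bar>\<theta> + \<eta>\<bar> < a" "\<bar>\<theta> - \<eta>\<bar> < a" by linarith+
  obtain N where N: "\<And>n. n \<ge> N \<Longrightarrow> \<bar>X n - \<theta>\<bar> < \<eta>"
    using LIMSEQ_D[OF X(2) \<eta>(1)] by auto
  have ne: "X n - \<theta> \<noteq> 0" for n using X(1) by auto
  have Xa: "\<bar>X n\<bar> < a" if "n \<ge> N" for n using N[OF that] \<open>\<eta> < a - \<bar>\<theta>\<bar>\<close> by linarith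
  let ?q = "\<lambda>n x. Y x ^ k * ((exp (X n * Y x) - exp (\<theta> * Y x)) / (X n - \<theta>))"
  have "(\<lambda>n. \<integral>x. ?q (n + N) x \<partial>M) \<longlonglongrightarrow> (\<integral>x. Y x ^ Suc k * exp (\<theta> * Y x) \<partial>M)"
  proof (rule integral_dominated_convergence)
    show "integrable M (\<lambda>x. \<bar>Y x\<bar> ^ Suc k * exp ((\<theta> + \<eta>) * Y x) + \<bar>Y x\<bar> ^ Suc k * exp ((\<theta> - \<eta>) * Y x))"
      by (intro Bochner_Integration.integrable_add integrable_power_mult_exp i) (use \<eta> in auto)
    show "AE x in M. (\<lambda>n. ?q (n + N) x) \<longlonglongrightarrow> Y x ^ Suc k * exp (\<theta> * Y x)"
    proof (intro AE_I2)
      fix x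
      have "((\<lambda>\<theta>. exp (\<theta> * Y x)) has_real_derivative Y x * exp (\<theta> * Y x)) (at \<theta>)"
        by (auto intro!: derivative_eq_intros)
      then have "(\<lambda>n. (exp (X n * Y x) - exp (\<theta> * Y x)) / (X n - \<theta>)) \<longlonglongrightarrow> Y x * exp (\<theta> * Y x)"
        using X unfolding has_field_derivative_iff tendsto_at_iff_sequentially by (auto simp: o_def)
      from tendsto_mult_left[OF this, of "Y x ^ k"]
      have "(\<lambda>n. ?q n x) \<longlonglongrightarrow> Y x ^ Suc k * exp (\<theta> * Y x)" by (simp add: ac_simps)
      then show "(\<lambda>n. ?q (n + N) x) \<longlonglongrightarrow> Y x ^ Suc k * exp (\<theta> * Y x)" by (rule LIMSEQ_ignore_initial_segment)
    qed
    show "AE x in M. norm (?q (n + N) x) \<le> \<bar>Y x\<bar> ^ Suc k * exp ((\<theta> + \<eta>) * Y x) + \<bar>Y x\<bar> ^ Suc k * exp ((\<theta> - \<eta>) * Y x)" for n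
    proof (intro AE_I2)
      fix x
      have "\<bar>exp (X (n + N) * Y x) - exp (\<theta> * Y x)\<bar> / \<bar>X (n + N) - \<theta>\<bar> \<le> \<bar>Y x\<bar> * (exp ((\<theta> + \<eta>) * Y x) + exp ((\<theta> - \<eta>) * Y x))"
        using abs_exp_diff_le[OF less_imp_le[OF N[of "n + N"]], of "Y x"] ne[of "n + N"]
        by (simp add: divide_le_eq mult.commute)
      then have "\<bar>Y x\<bar> ^ k * (\<bar>exp (X (n + N) * Y x) - exp (\<theta> * Y x)\<bar> / \<bar>X (n + N) - \<theta>\<bar>) \<le> \<bar>Y x\<bar> ^ k * (\<bar>Y x\<bar> * (exp ((\<theta> + \<eta>) * Y x) + exp ((\<theta> - \<eta>) * Y x)))"
        by (intro mult_left_mono) auto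
      then show "norm (?q (n + N) x) \<le> \<bar>Y x\<bar> ^ Suc k * exp ((\<theta> + \<eta>) * Y x) + \<bar>Y x\<bar> ^ Suc k * exp ((\<theta> - \<eta>) * Y x)"
        by (simp only: real_norm_def abs_mult abs_divide power_abs distrib_left power_Suc2 mult.assoc)
    qed
  qed auto
  then have 1: "(\<lambda>n. \<integral>x. ?q n x \<partial>M) \<longlonglongrightarrow> (\<integral>x. Y x ^ Suc k * exp (\<theta> * Y x) \<partial>M)"
    by (rule LIMSEQ_offset)
  have 2: "eventually (\<lambda>n. (\<integral>x. ?q n x \<partial>M) = ((\<integral>x. Y x ^ k * exp (X n * Y x) \<partial>M) - (\<integral>x. Y x ^ k * exp (\<theta> * Y x) \<partial>M)) / (X n - \<theta>)) sequentially"
    using eventually_ge_at_top[of N]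
  proof eventually_elim
    case (elim n)
    have "(\<integral>x. ?q n x \<partial>M) = (\<integral>x. (Y x ^ k * exp (X n * Y x) - Y x ^ k * exp (\<theta> * Y x)) / (X n - \<theta>) \<partial>M)"
      by (intro Bochner_Integration.integral_cong) (auto simp: algebra_simps)
    also have "\<dots> = ((\<integral>x. Y x ^ k * exp (X n * Y x) \<partial>M) - (\<integral>x. Y x ^ k * exp (\<theta> * Y x) \<partial>M)) / (X n - \<theta>)"
      using integrable_power_mult_exp'[OF assms(1) i Xa[OF elim]] integrable_power_mult_exp'[OF assms(1) i \<theta>]
      by (simp add: integral_diff)
    finally show ?case .
  qed
  show "((\<lambda>y. ((\<integral>x. Y x ^ k * exp (y * Y x) \<partial>M) - (\<integral>x. Y x ^ k * exp (\<theta> * Y x) \<partial>M)) / (y - \<theta>)) \<circ> X) \<longlonglongrightarrow> (\<integral>x. Y x ^ Suc k * exp (\<theta> * Y x) \<partial>M)"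
    using Lim_transform_eventually[OF 1 2] by (simp add: o_def)
qed

abbreviation "exp1 \<equiv> density lborel (exponential_density 1)"

text \<open>Since \<open>exp (\<theta> * ln t)\<close> is \<open>t powr \<theta>\<close>, this is
  Euler's integral for the Gamma function.\<close>

lemma mgf_ln_exponential:
  assumes "\<bar>\<theta>\<bar> < 1"
  shows "has_bochner_integral exp1 (\<lambda>t. exp (\<theta> * ln t)) (Gamma (1 + \<theta>))"
proof (rule has_bochner_integral_nn_integral)
  have "(\<integral>\<^sup>+ t. ennreal (exp (\<theta> * ln t)) \<partial>exp1) = (\<integral>\<^sup>+ t. ennreal (exponential_density 1 t) * ennreal (exp (\<theta> * ln t)) \<partial>lborel)"
    by (intro nn_integral_density) auto
  also have "\<dots> = (\<integral>\<^sup>+ t. ennreal (indicator {0..} t * t powr ((1 + \<theta>) - 1) / exp t) \<partial>lborel)"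
  proof (rule nn_integral_cong_AE)
    show "AE t in lborel. ennreal (exponential_density 1 t) * ennreal (exp (\<theta> * ln t)) = ennreal (indicator {0..} t * t powr ((1 + \<theta>) - 1) / exp t)"
      using AE_lborel_singleton[of 0]
      by eventually_elim (auto simp: exponential_density_def indicator_def powr_def ennreal_mult[symmetric] exp_minus divide_inverse mult.commute)
  qed
  also have "\<dots> = Gamma (1 + \<theta>)"
    using assms by (intro Gamma_conv_nn_integral_real[symmetric]) auto
  finally show "(\<integral>\<^sup>+ t. ennreal (exp (\<theta> * ln t)) \<partial>exp1) = ennreal (Gamma (1 + \<theta>))" .
  show "0 \<le> Gamma (1 + \<theta>)" using assms by (intro less_imp_le Gamma_real_pos) auto
qed auto

lemma Polygamma_1_1: "Polygamma 1 (1::real) = pi\<^sup>2 / 6"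
  using inverse_squares_sums by (simp add: Polygamma_def sums_iff field_simps power2_eq_square)

text \<open>The moments are the first two derivatives of \<open>Gamma (1 + \<theta>)\<close> at 0.
  They are \<open>Digamma 1\<close>, and \<open>(Digamma 1)^2 + Polygamma 1 1\<close> for the
  second; uniqueness of derivatives identifies them with the derivatives taken under the
  integral.\<close>

lemma ln_exponential_moments:
  shows "integrable exp1 ln" "integrable exp1 (\<lambda>t. (ln t)\<^sup>2)"
    and "(\<integral>t. ln t \<partial>exp1) = - euler_mascheroni"
    and "(\<integral>t. (ln t)\<^sup>2 \<partial>exp1) = euler_mascheroni\<^sup>2 + pi\<^sup>2 / 6"
proof -
  have i: "integrable exp1 (\<lambda>t. exp (\<theta> * ln t))" if "\<bar>\<theta>\<bar> < 1" for \<theta>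
    using mgf_ln_exponential[OF that] by (simp add: has_bochner_integral_iff)
  have g: "(\<integral>t. exp (\<theta> * ln t) \<partial>exp1) = Gamma (1 + \<theta>)" if "\<bar>\<theta>\<bar> < 1" for \<theta>
    using mgf_ln_exponential[OF that] by (simp add: has_bochner_integral_iff)
  have m: "ln \<in> borel_measurable exp1" by simp
  show "integrable exp1 ln" using integrable_power_mult_exp'[OF m i, of 1 0 1] by simp
  show "integrable exp1 (\<lambda>t. (ln t)\<^sup>2)" using integrable_power_mult_exp'[OF m i, of 1 0 2] by simp
  have d1: "(\<integral>t. ln t * exp (\<theta> * ln t) \<partial>exp1) = Gamma (1 + \<theta>) * Digamma (1 + \<theta>)" if t: "\<bar>\<theta>\<bar> < 1" for \<theta>
  proof (rule DERIV_unique)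
    have "((\<lambda>\<theta>. \<integral>t. exp (\<theta> * ln t) \<partial>exp1) has_real_derivative (\<integral>t. ln t * exp (\<theta> * ln t) \<partial>exp1)) (at \<theta>)"
      using DERIV_moment_generating[OF m i t, of 0] by simp
    then show "((\<lambda>\<theta>. Gamma (1 + \<theta>)) has_real_derivative (\<integral>t. ln t * exp (\<theta> * ln t) \<partial>exp1)) (at \<theta>)"
      by (rule has_field_derivative_transform_within_open[of _ _ _ "{-1<..<1}"]) (use t g in auto)
    show "((\<lambda>\<theta>. Gamma (1 + \<theta>)) has_real_derivative Gamma (1 + \<theta>) * Digamma (1 + \<theta>)) (at \<theta>)"
    proof -
      have "1 + \<theta> \<notin> \<int>\<^sub>\<le>\<^sub>0" using t by (auto elim!: nonpos_Ints_cases)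
      then show ?thesis by (auto intro!: derivative_eq_intros)
    qed
  qed
  from d1[of 0] show "(\<integral>t. ln t \<partial>exp1) = - euler_mascheroni" by simp
  have "(\<integral>t. (ln t)\<^sup>2 * exp (0 * ln t) \<partial>exp1) = Gamma 1 * Digamma 1 * Digamma 1 + Gamma 1 * Polygamma 1 (1::real)"
  proof (rule DERIV_unique)
    have "((\<lambda>\<theta>. \<integral>t. ln t * exp (\<theta> * ln t) \<partial>exp1) has_real_derivative (\<integral>t. (ln t)\<^sup>2 * exp (0 * ln t) \<partial>exp1)) (at 0)"
      using DERIV_moment_generating[OF m i, of 1 0 1] by (simp add: power2_eq_square)
    then show "((\<lambda>\<theta>. Gamma (1 + \<theta>) * Digamma (1 + \<theta>)) has_real_derivative (\<integral>t. (ln t)\<^sup>2 * exp (0 * ln t) \<partial>exp1)) (at 0)"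
      by (rule has_field_derivative_transform_within_open[of _ _ _ "{-1<..<1}"]) (use d1 in auto)
    have "(1::real) \<notin> \<int>\<^sub>\<le>\<^sub>0" by (auto elim!: nonpos_Ints_cases)
    then show "((\<lambda>\<theta>. Gamma (1 + \<theta>) * Digamma (1 + \<theta>)) has_real_derivative Gamma 1 * Digamma 1 * Digamma 1 + Gamma 1 * Polygamma 1 (1::real)) (at 0)"
      by (auto intro!: derivative_eq_intros)
  qed
  then show "(\<integral>t. (ln t)\<^sup>2 \<partial>exp1) = euler_mascheroni\<^sup>2 + pi\<^sup>2 / 6"
    using Polygamma_1_1 by (simp add: power2_eq_square)
qed

subsection \<open>Integration over two coordinates of a product\<close>

text \<open>Given the coordinates \<open>i\<close> and \<open>j\<close>, the other
  \<open>card I - 2\<close> points are independent and each has to avoid both balls, whence the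
  power. The weight \<open>g\<close> stays free, so that one formula serves joint survival
  probabilities, the absence of ties and the truncation error.\<close>

lemma nn_integral_PiM_two_coordinates:
  fixes P :: "'a::euclidean_space measure" and I :: "'i set" and g :: "'a \<times> 'a \<Rightarrow> ennreal"
  assumes "prob_space P" and sets_P [measurable_cong]: "sets P = sets borel"
    and I: "finite I" "i \<in> I" "j \<in> I" "i \<noteq> j"
    and [measurable]: "g \<in> borel_measurable (borel \<Otimes>\<^sub>M borel)"
  shows "(\<integral>\<^sup>+\<omega>. g (\<omega> i, \<omega> j) * indicator {\<omega>. \<forall>k\<in>I - {i, j}. r \<le> dist (\<omega> i) (\<omega> k) \<and> s \<le> dist (\<omega> j) (\<omega> k)} \<omega> \<partial>PiM I (\<lambda>_. P))
    = (\<integral>\<^sup>+x. \<integral>\<^sup>+y. g (x, y) * ennreal ((1 - measure P (ball x r \<union> ball y s)) ^ (card I - 2)) \<partial>P \<partial>P)"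
proof -
  interpret prob_space P by fact
  interpret PP: product_prob_space "\<lambda>_. P" UNIV by unfold_locales
  define J where "J = I - {i, j}"
  have J: "finite J" "i \<notin> J" "j \<notin> J" "I = insert i (insert j J)" "card I - 2 = card J"
    using I by (auto simp: J_def card_Diff_subset)
  \<comment> \<open>The contribution of a single remaining point; in this form the indicator of the
    common event becomes a product over \<open>J\<close>.\<close>
  define h :: "'a \<Rightarrow> 'a \<Rightarrow> 'a \<Rightarrow> ennreal" where "h x y z = (if r \<le> dist x z \<and> s \<le> dist y z then 1 else 0)" for x y z
  define F where "F \<omega> = g (\<omega> i, \<omega> j) * (\<Prod>k\<in>J. h (\<omega> i) (\<omega> j) (\<omega> k))" for \<omega>
  have h_meas [measurable]: "(\<lambda>\<omega>. h (u \<omega>) (v \<omega>) (w \<omega>)) \<in> borel_measurable N"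
    if [measurable]: "u \<in> measurable N borel" "v \<in> measurable N borel" "w \<in> measurable N borel" for u v w and N :: "('i \<Rightarrow> 'a) measure"
    unfolding h_def by measurable
  have [measurable]: "h x y \<in> borel_measurable P" for x y
    unfolding h_def by measurable
  have comp [measurable]: "(\<lambda>\<omega>. \<omega> k) \<in> measurable (PiM K (\<lambda>_. P)) borel" if "k \<in> K" for k K
    using measurable_component_singleton[OF that, of "\<lambda>_. P"] sets_P by (simp cong: measurable_cong_sets)
  have F_meas: "F \<in> borel_measurable (PiM (insert i (insert j J)) (\<lambda>_. P))"
    unfolding F_def by (intro borel_measurable_times_ennreal borel_measurable_prod_ennreal h_meas comp
        measurable_compose[OF _ \<open>g \<in> _\<close>] measurable_Pair) auto
  have eqF: "g (\<omega> i, \<omega> j) * indicator {\<omega>. \<forall>k\<in>J. r \<le> dist (\<omega> i) (\<omega> k) \<and> s \<le> dist (\<omega> j) (\<omega> k)} \<omega> = F \<omega>" for \<omega>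
  proof (cases "\<forall>k\<in>J. r \<le> dist (\<omega> i) (\<omega> k) \<and> s \<le> dist (\<omega> j) (\<omega> k)")
    case True
    then have "(\<Prod>k\<in>J. h (\<omega> i) (\<omega> j) (\<omega> k)) = 1" by (intro prod.neutral) (auto simp: h_def)
    then show ?thesis using True by (simp add: F_def)
  next
    case False
    then have "(\<Prod>k\<in>J. h (\<omega> i) (\<omega> j) (\<omega> k)) = 0" using J(1) by (intro prod_zero) (auto simp: h_def)
    then show ?thesis using False by (simp add: F_def)
  qed
  have "(\<integral>\<^sup>+\<omega>. F \<omega> \<partial>PiM (insert i (insert j J)) (\<lambda>_. P)) = (\<integral>\<^sup>+x. \<integral>\<^sup>+\<omega>. F (fun_upd \<omega> i x) \<partial>PiM (insert j J) (\<lambda>_. P) \<partial>P)"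
    using J I(4) F_meas by (intro PP.product_nn_integral_insert_rev) auto
  also have "\<dots> = (\<integral>\<^sup>+x. \<integral>\<^sup>+y. \<integral>\<^sup>+\<omega>. F (fun_upd (fun_upd \<omega> j y) i x) \<partial>PiM J (\<lambda>_. P) \<partial>P \<partial>P)"
  proof (intro nn_integral_cong)
    fix x assume x: "x \<in> space P"
    have "(\<lambda>\<omega>. F (fun_upd \<omega> i x)) \<in> borel_measurable (PiM (insert j J) (\<lambda>_. P))"
      by (rule measurable_compose[OF _ F_meas], rule measurable_fun_upd[where J="insert j J"]) (use x in auto)
    then show "(\<integral>\<^sup>+\<omega>. F (fun_upd \<omega> i x) \<partial>PiM (insert j J) (\<lambda>_. P)) = (\<integral>\<^sup>+y. \<integral>\<^sup>+\<omega>. F (fun_upd (fun_upd \<omega> j y) i x) \<partial>PiM J (\<lambda>_. P) \<partial>P)"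
      using J by (intro PP.product_nn_integral_insert_rev) auto
  qed
  also have "\<dots> = (\<integral>\<^sup>+x. \<integral>\<^sup>+y. g (x, y) * ennreal ((1 - measure P (ball x r \<union> ball y s)) ^ (card I - 2)) \<partial>P \<partial>P)"
  proof (intro nn_integral_cong)
    fix x y
    have [simp]: "space P - (ball x r \<union> ball y s) \<in> sets P" "ball x r \<union> ball y s \<in> sets P"
      using sets_eq_imp_space_eq[OF sets_P] by (auto simp: sets_P)
    have "F (fun_upd (fun_upd \<omega> j y) i x) = g (x, y) * (\<Prod>k\<in>J. h x y (\<omega> k))" for \<omega>
      using I(4) J by (auto simp: F_def intro!: arg_cong2[of _ _ _ _ "(*)"] prod.cong)
    then have "(\<integral>\<^sup>+\<omega>. F (fun_upd (fun_upd \<omega> j y) i x) \<partial>PiM J (\<lambda>_. P)) = g (x, y) * (\<integral>\<^sup>+\<omega>. (\<Prod>k\<in>J. h x y (\<omega> k)) \<partial>PiM J (\<lambda>_. P))"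
      by (simp, intro nn_integral_cmult borel_measurable_prod_ennreal h_meas comp) auto
    also have "(\<integral>\<^sup>+\<omega>. (\<Prod>k\<in>J. h x y (\<omega> k)) \<partial>PiM J (\<lambda>_. P)) = (\<integral>\<^sup>+z. h x y z \<partial>P) ^ card J"
      using J by (subst PP.product_nn_integral_prod) auto
    also have "(\<integral>\<^sup>+z. h x y z \<partial>P) = (\<integral>\<^sup>+z. indicator (space P - (ball x r \<union> ball y s)) z \<partial>P)"
      by (intro nn_integral_cong) (auto simp: h_def indicator_def)
    also have "\<dots> = ennreal (1 - measure P (ball x r \<union> ball y s))"
      by (simp add: emeasure_eq_measure prob_compl del: sets.Diff)
    also have "ennreal (1 - measure P (ball x r \<union> ball y s)) ^ card J = ennreal ((1 - measure P (ball x r \<union> ball y s)) ^ (card I - 2))"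
      by (simp add: ennreal_power J(5))
    finally show "(\<integral>\<^sup>+\<omega>. F (fun_upd (fun_upd \<omega> j y) i x) \<partial>PiM J (\<lambda>_. P)) = g (x, y) * ennreal ((1 - measure P (ball x r \<union> ball y s)) ^ (card I - 2))"
      .
  qed
  finally show ?thesis unfolding eqF[symmetric] J_def[symmetric] using J(4) by simp
qed

section \<open>The exponential survival function and the Poisson limit of powers\<close>

lemma measure_exp1_atLeast:
  assumes "0 \<le> a"
  shows "measure (density lborel (exponential_density 1)) {a..} = exp (- a)"
proof -
  let ?E = "density lborel (exponential_density 1)"
  interpret E: prob_space ?E by (rule prob_space_exponential_density) simp
  have "distributed ?E lborel (\<lambda>x. x) (exponential_density 1)"
    by (auto simp: distributed_def distr_id2 intro!: measurable_ident_sets)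
  then have "measure ?E {x\<in>space ?E. a < x} = exp (- a * 1)"
    using assms by (intro E.exponential_distributedD_gt) auto
  moreover have "{x\<in>space ?E. a < x} = {a<..}" by auto
  moreover have "measure ?E {a..} = measure ?E {a<..}"
  proof (rule E.finite_measure_eq_AE)
    have "AE x in lborel. x \<noteq> a" by (rule AE_lborel_singleton)
    then show "AE x in ?E. (x \<in> {a..}) = (x \<in> {a<..})" by (subst AE_density) auto
  qed auto
  ultimately show ?thesis by simp
qed

text \<open>For \<open>a < 1\<close>, the number \<open>1 - a\<close> lies between
  \<open>exp (- a / (1 - a))\<close> and \<open>exp (- a)\<close>, and the \<open>n\<close>-th
  powers of both bounds have the same limit.\<close>

lemma LIMSEQ_one_minus_power:
  fixes a :: "nat \<Rightarrow> real"
  assumes a: "\<And>n. 0 \<le> a n" "\<And>n. a n \<le> 1" and lim: "(\<lambda>n. real n * a n) \<longlonglongrightarrow> c"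
  shows "(\<lambda>n. (1 - a n) ^ n) \<longlonglongrightarrow> exp (- c)"
proof -
  have n1: "(\<lambda>n. inverse (real n)) \<longlonglongrightarrow> 0" by (rule lim_inverse_n)
  have "(\<lambda>n. real n * a n * inverse (real n)) \<longlonglongrightarrow> c * 0"
    by (intro tendsto_mult lim n1)
  then have a0: "a \<longlonglongrightarrow> 0"
    by (subst (asm) tendsto_cong[where g=a]) (auto intro!: eventually_mono[OF eventually_gt_at_top[of 0]])
  have "(\<lambda>n. real n * a n * (1 / (1 - a n))) \<longlonglongrightarrow> c * (1 / (1 - 0))"
    by (intro tendsto_intros lim a0) simp
  then have up: "(\<lambda>n. exp (- (real n * a n * (1 / (1 - a n))))) \<longlonglongrightarrow> exp (- c)"
    by (intro tendsto_intros) simp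
  have lo: "(\<lambda>n. exp (- (real n * a n))) \<longlonglongrightarrow> exp (- c)"
    by (intro tendsto_intros lim)
  have ev: "\<forall>\<^sub>F n in sequentially. a n < 1" using a0 by (rule order_tendstoD) simp
  show ?thesis
  proof (rule tendsto_sandwich[OF _ _ up lo])
    show "\<forall>\<^sub>F n in sequentially. (1 - a n) ^ n \<le> exp (- (real n * a n))"
    proof (intro always_eventually allI)
      fix n
      have "(1 - a n) ^ n \<le> exp (- a n) ^ n"
        using a[of n] exp_ge_add_one_self[of "- a n"] by (intro power_mono) (auto simp del: exp_ge_add_one_self)
      then show "(1 - a n) ^ n \<le> exp (- (real n * a n))" by (simp add: exp_of_nat_mult[symmetric])
    qed
    show "\<forall>\<^sub>F n in sequentially. exp (- (real n * a n * (1 / (1 - a n)))) \<le> (1 - a n) ^ n"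
      using ev
    proof eventually_elim
      case (elim n)
      have "1 + a n / (1 - a n) \<le> exp (a n / (1 - a n))" by (rule exp_ge_add_one_self)
      moreover have "1 + a n / (1 - a n) = 1 / (1 - a n)" using elim by (simp add: field_simps)
      ultimately have "1 / exp (a n / (1 - a n)) \<le> 1 - a n"
        using elim by (simp add: divide_le_eq mult.commute field_simps)
      then have "exp (- (a n / (1 - a n))) \<le> 1 - a n" by (simp add: exp_minus inverse_eq_divide)
      then have "exp (- (a n / (1 - a n))) ^ n \<le> (1 - a n) ^ n" by (intro power_mono) auto
      then show ?case by (simp add: exp_of_nat_mult[symmetric])
    qed
  qed
qed

subsection \<open>Survival functions of the nearest-neighbor statistics\<close>

text \<open>The volumes are scaled by \<open>N - 1\<close> throughout, whereas the number of
  remaining points is \<open>N - 1\<close> around one center and \<open>N - 2\<close> around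
  two.\<close>

lemma LIMSEQ_one_minus_power':
  fixes a :: "nat \<Rightarrow> real"
  assumes a: "\<And>n. 0 \<le> a n" "\<And>n. a n \<le> 1" and lim: "(\<lambda>n. (real n - 1) * a n) \<longlonglongrightarrow> c"
  shows "(\<lambda>n. (1 - a n) ^ (n - 2)) \<longlonglongrightarrow> exp (- c)" and "(\<lambda>n. (1 - a n) ^ (n - 1)) \<longlonglongrightarrow> exp (- c)"
proof -
  have 1: "(\<lambda>n. real n * a (n + 1)) \<longlonglongrightarrow> c"
    using LIMSEQ_ignore_initial_segment[OF lim, of 1] by simp
  have "(\<lambda>n. (1 - a (n + 1)) ^ n) \<longlonglongrightarrow> exp (- c)"
    by (rule LIMSEQ_one_minus_power[OF _ _ 1]) (use a in auto)
  then show "(\<lambda>n. (1 - a n) ^ (n - 1)) \<longlonglongrightarrow> exp (- c)"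
    using LIMSEQ_offset[of "\<lambda>n. (1 - a n) ^ (n - 1)" 1] by simp
  \<comment> \<open>The shift leaves the factor \<open>n + 1\<close> where \<open>n\<close> is
    wanted; the difference, written as the convergent sequence times \<open>1 / (n + 1)\<close>,
    vanishes in the limit.\<close>
  have *: "(\<lambda>n. (real n + 1) * a (n + 2) - (real n + 1) * a (n + 2) * (1 / (real n + 1))) \<longlonglongrightarrow> c - c * 0"
    using LIMSEQ_ignore_initial_segment[OF lim, of 2] LIMSEQ_ignore_initial_segment[OF lim_1_over_n[where 'a=real], of 1]
    by (intro tendsto_diff tendsto_mult) (auto simp: add.commute algebra_simps)
  have 2: "(\<lambda>n. real n * a (n + 2)) \<longlonglongrightarrow> c"
  proof -
    have "(real n + 1) * a (n + 2) - (real n + 1) * a (n + 2) * (1 / (real n + 1)) = real n * a (n + 2)" for n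
    proof -
      have "1 + real n \<noteq> 0" by linarith
      then show ?thesis by (simp add: field_simps)
    qed
    then show ?thesis using * by simp
  qed
  have "(\<lambda>n. (1 - a (n + 2)) ^ n) \<longlonglongrightarrow> exp (- c)"
    by (rule LIMSEQ_one_minus_power[OF _ _ 2]) (use a in auto)
  then show "(\<lambda>n. (1 - a n) ^ (n - 2)) \<longlonglongrightarrow> exp (- c)"
    using LIMSEQ_offset[of "\<lambda>n. (1 - a n) ^ (n - 2)" 2] by simp
qed

text \<open>The nearest-neighbor distance at which the statistic equals \<open>s\<close>, so that
  thresholds for the statistic become radii. The first argument only carries the type, and with it
  the dimension.\<close>

definition nn_radius :: "'a::euclidean_space itself \<Rightarrow> nat \<Rightarrow> real \<Rightarrow> real" where
  "nn_radius _ N s = root DIM('a) (exp (s - euler_mascheroni) / (unit_ball_vol (real DIM('a)) * (real N - 1)))"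

lemma nn_radius_pos: "2 \<le> N \<Longrightarrow> 0 < nn_radius TYPE('a::euclidean_space) N s"
  by (simp add: nn_radius_def unit_ball_vol_pos)

lemma nn_radius_power:
  "2 \<le> N \<Longrightarrow> nn_radius TYPE('a::euclidean_space) N s ^ DIM('a) * unit_ball_vol (real DIM('a)) * (real N - 1) = exp (s - euler_mascheroni)"
proof -
  have "0 < unit_ball_vol (real DIM('a))" by (simp add: unit_ball_vol_pos)
  then have "unit_ball_vol (real DIM('a)) \<noteq> 0" by linarith
  then show "2 \<le> N \<Longrightarrow> ?thesis" by (simp add: nn_radius_def)
qed

lemma nn_radius_tendsto_0: "(\<lambda>N. nn_radius TYPE('a::euclidean_space) N s) \<longlonglongrightarrow> 0"
proof -
  let ?c = "exp (s - euler_mascheroni) / unit_ball_vol (real DIM('a))"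
  have "(\<lambda>n. ?c * (1 / real n)) \<longlonglongrightarrow> ?c * 0"
    by (intro tendsto_mult tendsto_const lim_1_over_n)
  then have "(\<lambda>n. root DIM('a) (?c * (1 / real n))) \<longlonglongrightarrow> root DIM('a) 0"
    by (intro tendsto_real_root) auto
  then have "(\<lambda>n. nn_radius TYPE('a) (n + 1) s) \<longlonglongrightarrow> 0" by (simp add: nn_radius_def)
  then show ?thesis by (rule LIMSEQ_offset)
qed

text \<open>The statistic increases with the distance and equals \<open>s\<close> at the radius.
  Positivity matters: since \<open>ln 0 = 0\<close>, a tie would give the statistic the value 0 and
  break the equivalence for \<open>s \<le> 0\<close>.\<close>

lemma zeta_nn_ge_iff:
  fixes x :: "nat \<Rightarrow> 'a::euclidean_space"
  assumes N: "2 \<le> N" and pos: "0 < nn_dist x N i"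
  shows "s \<le> zeta_nn x N i \<longleftrightarrow> nn_radius TYPE('a) N s \<le> nn_dist x N i"
proof -
  let ?v = "unit_ball_vol (real DIM('a))" let ?r = "nn_radius TYPE('a) N s"
  have v: "?v > 0" by (simp add: unit_ball_vol_pos)
  have "s \<le> zeta_nn x N i \<longleftrightarrow> exp s \<le> nn_dist x N i ^ DIM('a) * ?v * exp euler_mascheroni * (real N - 1)"
    unfolding zeta_nn_def using pos v N by (subst ln_ge_iff) auto
  also have "exp s = ?r ^ DIM('a) * ?v * exp euler_mascheroni * (real N - 1)"
    using nn_radius_power[OF N, of s, where 'a='a] by (simp add: exp_diff field_simps)
  also have "\<dots> \<le> nn_dist x N i ^ DIM('a) * ?v * exp euler_mascheroni * (real N - 1) \<longleftrightarrow> ?r ^ DIM('a) \<le> nn_dist x N i ^ DIM('a)"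
  proof -
    have "0 < ?v * exp euler_mascheroni * (real N - 1)" using v N by simp
    from mult_le_cancel_right_pos[OF this] show ?thesis by (simp only: mult.assoc)
  qed
  also have "\<dots> \<longleftrightarrow> ?r \<le> nn_dist x N i"
    using nn_radius_pos[OF N, of s, where 'a='a] pos by (intro power_mono_iff) auto
  finally show ?thesis .
qed

lemma nn_dist_ge_iff:
  assumes "2 \<le> N" "i \<in> {1..N}"
  shows "a \<le> nn_dist x N i \<longleftrightarrow> (\<forall>k\<in>{1..N} - {i}. a \<le> dist (x i) (x k))"
proof -
  have "card ({1..N} - {i}) \<noteq> 0" using assms by simp
  then have "{1..N} - {i} \<noteq> {}" by (metis card.empty)
  then show ?thesis unfolding nn_dist_def by (subst Min_ge_iff) auto
qed

lemma nn_dist_in: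
  assumes "2 \<le> N" "i \<in> {1..N}"
  shows "\<exists>k\<in>{1..N} - {i}. nn_dist x N i = dist (x i) (x k)"
proof -
  have "card ({1..N} - {i}) \<noteq> 0" using assms by simp
  then have "{1..N} - {i} \<noteq> {}" by (metis card.empty)
  then have "nn_dist x N i \<in> (\<lambda>j. dist (x i) (x j)) ` ({1..N} - {i})"
    unfolding nn_dist_def by (intro Min_in) auto
  then show ?thesis by auto
qed

section \<open>The law with density \<open>f\<close> and the limits of avoidance
  probabilities\<close>

locale nn_density =
  fixes f :: "'a::euclidean_space \<Rightarrow> real"
  assumes f_meas [measurable]: "f \<in> borel_measurable borel"
    and f_nn: "\<And>x. 0 \<le> f x"
    and f_prob: "prob_space (density lborel (\<lambda>x. ennreal (f x)))"
begin

definition P where "P = density lborel (\<lambda>x. ennreal (f x))"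

lemma sets_P [measurable_cong, simp]: "sets P = sets borel" by (simp add: P_def)
lemma space_P [simp]: "space P = UNIV" by (simp add: P_def)

sublocale P: prob_space P unfolding P_def by (rule f_prob)

lemma prob_UNIV [simp]: "measure P UNIV = 1" using P.prob_space by simp

lemma AE_P: "AE x in lborel. Q x \<Longrightarrow> AE x in P. Q x"
  unfolding P_def by (subst AE_density) auto

lemma AE_P_pos: "AE x in P. 0 < f x"
  unfolding P_def by (subst AE_density) (auto simp: order_less_le f_nn)

lemma emeasure_P_singleton: "emeasure P {x} = 0"
proof -
  have "AE y in P. y \<noteq> x" by (rule AE_P[OF AE_lborel_singleton])
  then show ?thesis by (subst (asm) AE_iff_measurable[of "{x}"]) auto
qed

lemma measurable_ball [measurable (raw)]:
  assumes "g \<in> borel_measurable N" "h \<in> borel_measurable N"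
  shows "(\<lambda>x. measure P (ball (g x) (h x))) \<in> borel_measurable N"
  by (rule borel_measurable_measure_ball[OF P.prob_space_axioms sets_P assms])

lemma measurable_two_balls [measurable]:
  "(\<lambda>p. measure P (ball (fst p) a \<union> ball (snd p) b)) \<in> borel_measurable (borel \<Otimes>\<^sub>M borel)"
proof -
  have "(\<lambda>p. measure P {z\<in>space P. dist (fst p) z < a \<or> dist (snd p) z < b}) \<in> borel_measurable (borel \<Otimes>\<^sub>M borel)"
    by measurable
  moreover have "{z\<in>space P. dist (fst p) z < a \<or> dist (snd p) z < b} = ball (fst p) a \<union> ball (snd p) b" for p
    by auto
  ultimately show ?thesis by (simp only:)
qed

lemma measurable_pair_surv:
  "(\<lambda>(x, y). (if a \<le> dist x y \<and> b \<le> dist x y then (1 - measure P (ball x a \<union> ball y b)) ^ n else 0 :: real)) \<in> borel_measurable (P \<Otimes>\<^sub>M P)"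
proof -
  have m1: "Measurable.pred (P \<Otimes>\<^sub>M P) (\<lambda>p. a \<le> dist (fst p) (snd p) \<and> b \<le> dist (fst p) (snd p))"
    by measurable
  have m2: "(\<lambda>p. measure P (ball (fst p) a \<union> ball (snd p) b)) \<in> borel_measurable (P \<Otimes>\<^sub>M P)"
    using measurable_two_balls[of a b] by (simp cong: measurable_cong_sets sets_pair_measure_cong)
  show ?thesis unfolding case_prod_unfold
    by (intro measurable_If borel_measurable_power borel_measurable_diff borel_measurable_const m2 m1[unfolded pred_def])
qed

abbreviation "\<gamma> \<equiv> euler_mascheroni :: real"

text \<open>The volume of the ball times \<open>N - 1\<close> is \<open>exp (s - \<gamma>)\<close>,
  so the expression is this constant times the ratio of mass to volume.\<close>

lemma AE_ball_limit: "AE x in P. (\<lambda>N. (real N - 1) * measure P (ball x (nn_radius TYPE('a) N s))) \<longlonglongrightarrow> f x * exp (s - \<gamma>)"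
proof (rule AE_P)
  \<comment> \<open>The radius is known to be positive only from \<open>N = 2\<close> on, hence the
    shift.\<close>
  let ?r = "\<lambda>n. nn_radius TYPE('a) (n + 2) s"
  have "AE x in lborel. (\<lambda>n. measure P (ball x (?r n)) / measure lborel (ball x (?r n))) \<longlonglongrightarrow> f x"
    unfolding P_def
    using LIMSEQ_ignore_initial_segment[OF nn_radius_tendsto_0[of s, where 'a='a], of 2]
    by (intro lebesgue_differentiation_balls f_nn f_prob nn_radius_pos f_meas) auto
  then show "AE x in lborel. (\<lambda>N. (real N - 1) * measure P (ball x (nn_radius TYPE('a) N s))) \<longlonglongrightarrow> f x * exp (s - \<gamma>)"
  proof eventually_elim
    case (elim x)
    have "measure P (ball x (?r n)) / measure lborel (ball x (?r n)) * exp (s - \<gamma>) = (real (n + 2) - 1) * measure P (ball x (?r n))" for n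
    proof -
      have "measure lborel (ball x (?r n)) > 0" using content_ball_pos[OF nn_radius_pos[of "n + 2" s, where 'a='a], of x] by simp
      moreover have "exp (s - \<gamma>) = measure lborel (ball x (?r n)) * (real (n + 2) - 1)"
        using nn_radius_power[of "n + 2" s, where 'a='a] nn_radius_pos[of "n + 2" s, where 'a='a] by (simp add: content_ball algebra_simps)
      ultimately show ?thesis by (simp add: field_simps)
    qed
    then have "(\<lambda>n. (real (n + 2) - 1) * measure P (ball x (?r n))) \<longlonglongrightarrow> f x * exp (s - \<gamma>)"
      using tendsto_mult_right[OF elim, of "exp (s - \<gamma>)"] by simp
    then show ?case by (rule LIMSEQ_offset)
  qed
qed

text \<open>The survival function of the limit \<open>Z\<close>: given \<open>X = x\<close>, the
  event \<open>s \<le> Z\<close> says that the exponential variable is at least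
  \<open>f x * exp (s - \<gamma>)\<close>.\<close>

definition surv :: "real \<Rightarrow> real" where
  "surv s = (\<integral>x. exp (- (f x * exp (s - \<gamma>))) \<partial>P)"

lemma integrable_P_bounded:
  "g \<in> borel_measurable borel \<Longrightarrow> (\<And>x. \<bar>g x\<bar> \<le> 1) \<Longrightarrow> integrable P (g :: 'a \<Rightarrow> real)"
  by (rule P.integrable_const_bound[of _ 1]) auto

lemma marginal_limit:
  "(\<lambda>N. \<integral>x. (1 - measure P (ball x (nn_radius TYPE('a) N s))) ^ (N - 1) \<partial>P) \<longlonglongrightarrow> surv s"
  unfolding surv_def
proof (rule integral_dominated_convergence[where w="\<lambda>_. 1"])
  show "AE x in P. (\<lambda>N. (1 - measure P (ball x (nn_radius TYPE('a) N s))) ^ (N - 1)) \<longlonglongrightarrow> exp (- (f x * exp (s - \<gamma>)))"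
    using AE_ball_limit[of s] by eventually_elim (rule LIMSEQ_one_minus_power'(2), auto)
qed (auto intro!: AE_I2 power_le_one simp: power_abs)

text \<open>The distance conditions say that the two centers avoid each other's balls, and the power
  accounts for the other \<open>N - 2\<close> points. Dominated convergence is used first in
  \<open>y\<close> for fixed \<open>x\<close>, then in \<open>x\<close>, each time with the majorant
  1.\<close>

lemma joint_limit:
  "(\<lambda>N. \<integral>x. \<integral>y. (if nn_radius TYPE('a) N s \<le> dist x y \<and> nn_radius TYPE('a) N t \<le> dist x y then (1 - measure P (ball x (nn_radius TYPE('a) N s) \<union> ball y (nn_radius TYPE('a) N t))) ^ (N - 2) else 0) \<partial>P \<partial>P)
    \<longlonglongrightarrow> surv s * surv t"
proof -
  let ?g = "\<lambda>N x y. (if nn_radius TYPE('a) N s \<le> dist x y \<and> nn_radius TYPE('a) N t \<le> dist x y then (1 - measure P (ball x (nn_radius TYPE('a) N s) \<union> ball y (nn_radius TYPE('a) N t))) ^ (N - 2) else 0 :: real)"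
  have gm: "(\<lambda>(x, y). ?g N x y) \<in> borel_measurable (P \<Otimes>\<^sub>M P)" for N
    by (rule measurable_pair_surv)
  have gm1 [measurable]: "?g N x \<in> borel_measurable borel" for N x
    using measurable_compose[OF measurable_Pair1' gm, of x N] by simp
  have g01: "0 \<le> ?g N x y" "?g N x y \<le> 1" for N x y by (simp_all add: power_le_one)
  have gint: "integrable P (?g N x)" for N x
    by (rule integrable_P_bounded[OF gm1]) (simp only: abs_of_nonneg g01)
  have inner: "AE x in P. (\<lambda>N. \<integral>y. ?g N x y \<partial>P) \<longlonglongrightarrow> exp (- (f x * exp (s - \<gamma>))) * surv t"
    using AE_ball_limit[of s]
  proof eventually_elim
    case (elim x)
    have ne: "AE y in P. y \<noteq> x" by (rule AE_P[OF AE_lborel_singleton])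
    have "(\<lambda>N. \<integral>y. ?g N x y \<partial>P) \<longlonglongrightarrow> (\<integral>y. exp (- (f x * exp (s - \<gamma>))) * exp (- (f y * exp (t - \<gamma>))) \<partial>P)"
    proof (rule integral_dominated_convergence[where w="\<lambda>_. 1"])
      show "AE y in P. (\<lambda>N. ?g N x y) \<longlonglongrightarrow> exp (- (f x * exp (s - \<gamma>))) * exp (- (f y * exp (t - \<gamma>)))"
        using AE_ball_limit[of t] ne
      proof eventually_elim
        case y: (elim y)
        let ?a = "\<lambda>N. measure P (ball x (nn_radius TYPE('a) N s) \<union> ball y (nn_radius TYPE('a) N t))"
        \<comment> \<open>Radii below half the distance make the balls disjoint, so that their
          masses add up, and they also satisfy both distance conditions in
          \<open>?g\<close>.\<close>
        have d: "dist x y / 2 > 0" using y by auto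
        have "\<forall>\<^sub>F N in sequentially. nn_radius TYPE('a) N s < dist x y / 2 \<and> nn_radius TYPE('a) N t < dist x y / 2 \<and> 2 \<le> N"
          using order_tendstoD(2)[OF nn_radius_tendsto_0[of s, where 'a='a] d] order_tendstoD(2)[OF nn_radius_tendsto_0[of t, where 'a='a] d]
            eventually_ge_at_top[of 2] by eventually_elim auto
        note ev = this
        have e1: "\<forall>\<^sub>F N in sequentially. (real N - 1) * measure P (ball x (nn_radius TYPE('a) N s)) + (real N - 1) * measure P (ball y (nn_radius TYPE('a) N t)) = (real N - 1) * ?a N"
          using ev
        proof eventually_elim
          case (elim N)
          have "ball x (nn_radius TYPE('a) N s) \<inter> ball y (nn_radius TYPE('a) N t) = {}"
          proof (intro equals0I)
            fix z assume "z \<in> ball x (nn_radius TYPE('a) N s) \<inter> ball y (nn_radius TYPE('a) N t)"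
            then show False using elim dist_triangle[of x y z] by (auto simp: dist_commute)
          qed
          then have "?a N = measure P (ball x (nn_radius TYPE('a) N s)) + measure P (ball y (nn_radius TYPE('a) N t))"
            by (intro P.finite_measure_Union) auto
          then show ?case by (simp add: distrib_left)
        qed
        have "(\<lambda>N. (1 - ?a N) ^ (N - 2)) \<longlonglongrightarrow> exp (- (f x * exp (s - \<gamma>) + f y * exp (t - \<gamma>)))"
          by (rule LIMSEQ_one_minus_power'(1)[OF _ _ Lim_transform_eventually[OF tendsto_add[OF elim y(1)] e1]]) auto
        moreover have "\<forall>\<^sub>F N in sequentially. (1 - ?a N) ^ (N - 2) = ?g N x y"
          using ev
        proof eventually_elim
          case (elim N)
          then have "nn_radius TYPE('a) N s \<le> dist x y" "nn_radius TYPE('a) N t \<le> dist x y" using d by linarith+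
          then show ?case by simp
        qed
        ultimately show ?case by (auto simp: exp_add[symmetric] intro: Lim_transform_eventually)
      qed
      show "AE y in P. norm (?g N x y) \<le> 1" for N
        using g01[of N x] by (intro AE_I2) (simp only: real_norm_def abs_of_nonneg)
      show "?g N x \<in> borel_measurable P" for N
        using gm1[of N x] by (simp cong: measurable_cong_sets)
      show "(\<lambda>y. exp (- (f x * exp (s - \<gamma>))) * exp (- (f y * exp (t - \<gamma>)))) \<in> borel_measurable P"
        by measurable
    qed simp
    then show ?case by (simp add: surv_def)
  qed
  have "(\<lambda>N. \<integral>x. \<integral>y. ?g N x y \<partial>P \<partial>P) \<longlonglongrightarrow> (\<integral>x. exp (- (f x * exp (s - \<gamma>))) * surv t \<partial>P)"
  proof (rule integral_dominated_convergence[where w="\<lambda>_. 1", OF _ _ _ inner])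
    show "(\<lambda>x. \<integral>y. ?g N x y \<partial>P) \<in> borel_measurable P" for N
      by (rule P.borel_measurable_lebesgue_integral[OF gm])
    show "AE x in P. norm (\<integral>y. ?g N x y \<partial>P) \<le> 1" for N
    proof (intro AE_I2)
      fix x
      have "(\<integral>y. ?g N x y \<partial>P) \<le> (\<integral>y. 1 \<partial>P)" by (intro integral_mono gint g01) simp
      moreover have "0 \<le> (\<integral>y. ?g N x y \<partial>P)" by (intro Bochner_Integration.integral_nonneg g01)
      ultimately show "norm (\<integral>y. ?g N x y \<partial>P) \<le> 1" by (simp add: P.prob_space)
    qed
  qed auto
  then show ?thesis by (simp add: surv_def)
qed

section \<open>The sample as a product measure and its survival probabilities\<close>

definition Q where "Q N = PiM {1..N} (\<lambda>_::nat. P)"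

sublocale Q: prob_space "Q N" for N
  unfolding Q_def by (intro prob_space_PiM P.prob_space_axioms)

lemma measurable_coord [measurable (raw)]: "k \<in> {1..N} \<Longrightarrow> (\<lambda>\<omega>. \<omega> k) \<in> measurable (Q N) borel"
  using measurable_component_singleton[of k "{1..N}" "\<lambda>_. P"] unfolding Q_def by (simp cong: measurable_cong_sets)

lemma measurable_coord_dist [measurable (raw)]:
  "i \<in> {1..N} \<Longrightarrow> j \<in> {1..N} \<Longrightarrow> (\<lambda>\<omega>. dist (\<omega> i) (\<omega> j)) \<in> borel_measurable (Q N)"
  by (intro borel_measurable_dist measurable_coord)

lemma measurable_nn_dist [measurable]: 
  assumes "i \<in> {1..N}" shows "(\<lambda>\<omega>. nn_dist \<omega> N i) \<in> borel_measurable (Q N)"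
  unfolding nn_dist_def using assms by (intro borel_measurable_Min measurable_coord_dist) auto

lemma measurable_zeta [measurable]: "i \<in> {1..N} \<Longrightarrow> (\<lambda>\<omega>. zeta_nn \<omega> N i) \<in> borel_measurable (Q N)"
  unfolding zeta_nn_def by measurable

lemma nn_integral_Q_pair:
  assumes "i \<in> {1..N}" "j \<in> {1..N}" "i \<noteq> j" "g \<in> borel_measurable (borel \<Otimes>\<^sub>M borel)"
  shows "(\<integral>\<^sup>+\<omega>. g (\<omega> i, \<omega> j) * indicator {\<omega>. \<forall>k\<in>{1..N} - {i, j}. a \<le> dist (\<omega> i) (\<omega> k) \<and> b \<le> dist (\<omega> j) (\<omega> k)} \<omega> \<partial>Q N)
    = (\<integral>\<^sup>+x. \<integral>\<^sup>+y. g (x, y) * ennreal ((1 - measure P (ball x a \<union> ball y b)) ^ (N - 2)) \<partial>P \<partial>P)"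
  unfolding Q_def using nn_integral_PiM_two_coordinates[OF P.prob_space_axioms sets_P finite_atLeastAtMost assms] by simp

text \<open>With both radii 0 the balls are empty and the avoidance event is everything.\<close>

lemma nn_integral_Q_pair':
  assumes "i \<in> {1..N}" "j \<in> {1..N}" "i \<noteq> j" "g \<in> borel_measurable (borel \<Otimes>\<^sub>M borel)"
  shows "(\<integral>\<^sup>+\<omega>. g (\<omega> i, \<omega> j) \<partial>Q N) = (\<integral>\<^sup>+x. \<integral>\<^sup>+y. g (x, y) \<partial>P \<partial>P)"
  using nn_integral_Q_pair[OF assms, of 0 0] by simp

lemma prob_pair:
  assumes ij: "i \<in> {1..N}" "j \<in> {1..N}" "i \<noteq> j"
  shows "measure (Q N) {\<omega>\<in>space (Q N). (a \<le> dist (\<omega> i) (\<omega> j) \<and> b \<le> dist (\<omega> i) (\<omega> j)) \<and> (\<forall>k\<in>{1..N} - {i, j}. a \<le> dist (\<omega> i) (\<omega> k) \<and> b \<le> dist (\<omega> j) (\<omega> k))}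
   = (\<integral>x. \<integral>y. (if a \<le> dist x y \<and> b \<le> dist x y then (1 - measure P (ball x a \<union> ball y b)) ^ (N - 2) else 0) \<partial>P \<partial>P)"
  (is "measure _ ?A = (\<integral>x. \<integral>y. ?h x y \<partial>P \<partial>P)")
proof -
  define g :: "'a \<times> 'a \<Rightarrow> ennreal" where "g p = (if a \<le> dist (fst p) (snd p) \<and> b \<le> dist (fst p) (snd p) then 1 else 0)" for p
  have gm: "g \<in> borel_measurable (borel \<Otimes>\<^sub>M borel)" unfolding g_def by measurable
  have hm: "(\<lambda>(x, y). ?h x y) \<in> borel_measurable (P \<Otimes>\<^sub>M P)" by (rule measurable_pair_surv)
  have h01: "0 \<le> ?h x y" "?h x y \<le> 1" for x y by (simp_all add: power_le_one)
  have hm1: "?h x \<in> borel_measurable P" for x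
    using measurable_compose[OF measurable_Pair1' hm, of x] by simp
  have hint: "integrable P (?h x)" for x
    by (rule P.integrable_const_bound[of _ 1, OF _ hm1]) (simp only: real_norm_def abs_of_nonneg h01 AE_I2 simp_thms)
  have A [measurable]: "?A \<in> sets (Q N)"
  proof -
    have "k \<in> {1..N} \<Longrightarrow> Measurable.pred (Q N) (\<lambda>\<omega>. c \<le> dist (\<omega> l) (\<omega> k))" if "l \<in> {1..N}" for l k c
      using measurable_coord_dist[OF that] by measurable
    then show ?thesis using ij unfolding pred_def by (intro sets.sets_Collect) auto
  qed
  have inner0: "0 \<le> (\<integral>y. ?h x y \<partial>P)" for x by (intro Bochner_Integration.integral_nonneg h01)
  have inner1: "(\<integral>y. ?h x y \<partial>P) \<le> 1" for x
  proof -
    have "(\<integral>y. ?h x y \<partial>P) \<le> (\<integral>y. 1 \<partial>P)" by (intro integral_mono hint h01) simp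
    then show ?thesis by simp
  qed
  have "ennreal (measure (Q N) ?A) = (\<integral>\<^sup>+\<omega>. indicator ?A \<omega> \<partial>Q N)"
    using A by (simp add: Q.emeasure_eq_measure)
  also have "\<dots> = (\<integral>\<^sup>+\<omega>. g (\<omega> i, \<omega> j) * indicator {\<omega>. \<forall>k\<in>{1..N} - {i, j}. a \<le> dist (\<omega> i) (\<omega> k) \<and> b \<le> dist (\<omega> j) (\<omega> k)} \<omega> \<partial>Q N)"
    by (intro nn_integral_cong) (auto simp: g_def indicator_def)
  also have "\<dots> = (\<integral>\<^sup>+x. \<integral>\<^sup>+y. g (x, y) * ennreal ((1 - measure P (ball x a \<union> ball y b)) ^ (N - 2)) \<partial>P \<partial>P)"
    by (rule nn_integral_Q_pair[OF ij gm])
  also have "\<dots> = (\<integral>\<^sup>+x. \<integral>\<^sup>+y. ennreal (?h x y) \<partial>P \<partial>P)"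
    by (intro nn_integral_cong) (auto simp: g_def)
  also have "\<dots> = (\<integral>\<^sup>+x. ennreal (\<integral>y. ?h x y \<partial>P) \<partial>P)"
    by (intro nn_integral_cong nn_integral_eq_integral hint AE_I2 h01)
  also have "\<dots> = ennreal (\<integral>x. \<integral>y. ?h x y \<partial>P \<partial>P)"
    by (intro nn_integral_eq_integral P.integrable_const_bound[of _ 1] P.borel_measurable_lebesgue_integral[OF hm])
      (simp_all only: real_norm_def abs_of_nonneg inner0 inner1 AE_I2 simp_thms)
  finally show ?thesis
    by (subst (asm) ennreal_inj) (auto intro!: Bochner_Integration.integral_nonneg inner0)
qed

text \<open>The law has no atoms, so Fubini gives each tie probability 0. This keeps the argument of
  the logarithm positive almost surely.\<close>

lemma AE_distinct:
  "AE \<omega> in Q N. \<forall>i\<in>{1..N}. \<forall>j\<in>{1..N} - {i}. \<omega> i \<noteq> \<omega> j"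
proof -
  have "AE \<omega> in Q N. \<omega> i \<noteq> \<omega> j" if ij: "i \<in> {1..N}" "j \<in> {1..N} - {i}" for i j
  proof -
    define g :: "'a \<times> 'a \<Rightarrow> ennreal" where "g p = (if fst p = snd p then 1 else 0)" for p
    have gm: "g \<in> borel_measurable (borel \<Otimes>\<^sub>M borel)" unfolding g_def by measurable
    have "(\<integral>\<^sup>+\<omega>. g (\<omega> i, \<omega> j) \<partial>Q N) = (\<integral>\<^sup>+x. \<integral>\<^sup>+y. g (x, y) \<partial>P \<partial>P)"
      using ij by (intro nn_integral_Q_pair' gm) auto
    also have "(\<integral>\<^sup>+y. g (x, y) \<partial>P) = (\<integral>\<^sup>+y. indicator {x} y \<partial>P)" for x
      by (intro nn_integral_cong) (auto simp: g_def)
    then have "(\<integral>\<^sup>+x. \<integral>\<^sup>+y. g (x, y) \<partial>P \<partial>P) = 0" by (simp add: emeasure_P_singleton)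
    finally have 0: "(\<integral>\<^sup>+\<omega>. g (\<omega> i, \<omega> j) \<partial>Q N) = 0" .
    have "(\<lambda>\<omega>. g (\<omega> i, \<omega> j)) \<in> borel_measurable (Q N)"
      using ij by (intro measurable_compose[OF _ gm] measurable_Pair measurable_coord) auto
    from 0[unfolded nn_integral_0_iff_AE[OF this]] show ?thesis
      by eventually_elim (auto simp: g_def split: if_splits)
  qed
  then show ?thesis by (simp add: AE_ball_countable)
qed

lemma nn_dist_pos:
  assumes "2 \<le> N" "i \<in> {1..N}" "\<forall>i\<in>{1..N}. \<forall>j\<in>{1..N} - {i}. \<omega> i \<noteq> \<omega> j"
  shows "0 < nn_dist \<omega> N i"
proof -
  obtain k where "k \<in> {1..N} - {i}" "nn_dist \<omega> N i = dist (\<omega> i) (\<omega> k)"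
    using nn_dist_in[OF assms(1,2)] by blast
  moreover from this have "\<omega> i \<noteq> \<omega> k" using assms(2,3) by blast
  ultimately show ?thesis by simp
qed

lemma prob_joint:
  assumes N: "2 \<le> N" and ij: "i \<in> {1..N}" "j \<in> {1..N}" "i \<noteq> j"
  shows "measure (Q N) {\<omega>\<in>space (Q N). s \<le> zeta_nn \<omega> N i \<and> t \<le> zeta_nn \<omega> N j}
    = (\<integral>x. \<integral>y. (if nn_radius TYPE('a) N s \<le> dist x y \<and> nn_radius TYPE('a) N t \<le> dist x y then (1 - measure P (ball x (nn_radius TYPE('a) N s) \<union> ball y (nn_radius TYPE('a) N t))) ^ (N - 2) else 0) \<partial>P \<partial>P)"
  unfolding prob_pair[OF ij, symmetric]
proof (rule measure_eq_AE)
  have m: "Measurable.pred (Q N) (\<lambda>\<omega>. c \<le> dist (\<omega> l) (\<omega> k))" if "l \<in> {1..N}" "k \<in> {1..N}" for l k c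
    using measurable_coord_dist[OF that] by measurable
  then show "{\<omega>\<in>space (Q N). (nn_radius TYPE('a) N s \<le> dist (\<omega> i) (\<omega> j) \<and> nn_radius TYPE('a) N t \<le> dist (\<omega> i) (\<omega> j)) \<and> (\<forall>k\<in>{1..N} - {i, j}. nn_radius TYPE('a) N s \<le> dist (\<omega> i) (\<omega> k) \<and> nn_radius TYPE('a) N t \<le> dist (\<omega> j) (\<omega> k))} \<in> sets (Q N)"
    using ij unfolding pred_def by (intro sets.sets_Collect) auto
  show "{\<omega>\<in>space (Q N). s \<le> zeta_nn \<omega> N i \<and> t \<le> zeta_nn \<omega> N j} \<in> sets (Q N)"
    using ij by measurable
  show "AE \<omega> in Q N. (\<omega> \<in> {\<omega>\<in>space (Q N). s \<le> zeta_nn \<omega> N i \<and> t \<le> zeta_nn \<omega> N j}) \<longleftrightarrow>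
    (\<omega> \<in> {\<omega>\<in>space (Q N). (nn_radius TYPE('a) N s \<le> dist (\<omega> i) (\<omega> j) \<and> nn_radius TYPE('a) N t \<le> dist (\<omega> i) (\<omega> j)) \<and> (\<forall>k\<in>{1..N} - {i, j}. nn_radius TYPE('a) N s \<le> dist (\<omega> i) (\<omega> k) \<and> nn_radius TYPE('a) N t \<le> dist (\<omega> j) (\<omega> k))})"
    using AE_distinct
  proof eventually_elim
    case (elim \<omega>)
    have "{1..N} - {i} = insert j ({1..N} - {i, j})" "{1..N} - {j} = insert i ({1..N} - {i, j})" using ij by auto
    then show ?case
      using zeta_nn_ge_iff[OF N nn_dist_pos[OF N ij(1) elim], of s] zeta_nn_ge_iff[OF N nn_dist_pos[OF N ij(2) elim], of t]
      by (auto simp: nn_dist_ge_iff[OF N ij(1)] nn_dist_ge_iff[OF N ij(2)] dist_commute)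
  qed
qed

lemma prob_marginal:
  assumes N: "2 \<le> N" and i: "i \<in> {1..N}"
  shows "measure (Q N) {\<omega>\<in>space (Q N). s \<le> zeta_nn \<omega> N i} = (\<integral>x. (1 - measure P (ball x (nn_radius TYPE('a) N s))) ^ (N - 1) \<partial>P)"
proof -
  let ?r = "nn_radius TYPE('a) N s"
  \<comment> \<open>Any second index will do. With radius 0 around the \<open>j\<close>-th point
    only the condition on the distance to it remains, and integrating that condition supplies the
    factor that raises the power from \<open>N - 2\<close> to \<open>N - 1\<close>.\<close>
  define j where "j = (if i = 1 then 2 else 1 :: nat)"
  have j: "j \<in> {1..N}" "i \<noteq> j" using N by (auto simp: j_def)
  have "measure (Q N) {\<omega>\<in>space (Q N). s \<le> zeta_nn \<omega> N i} = measure (Q N) {\<omega>\<in>space (Q N). (?r \<le> dist (\<omega> i) (\<omega> j) \<and> 0 \<le> dist (\<omega> i) (\<omega> j)) \<and> (\<forall>k\<in>{1..N} - {i, j}. ?r \<le> dist (\<omega> i) (\<omega> k) \<and> 0 \<le> dist (\<omega> j) (\<omega> k))}"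
  proof (rule measure_eq_AE)
    have m: "Measurable.pred (Q N) (\<lambda>\<omega>. c \<le> dist (\<omega> l) (\<omega> k))" if "l \<in> {1..N}" "k \<in> {1..N}" for l k c
      using measurable_coord_dist[OF that] by measurable
    then show "{\<omega>\<in>space (Q N). (?r \<le> dist (\<omega> i) (\<omega> j) \<and> 0 \<le> dist (\<omega> i) (\<omega> j)) \<and> (\<forall>k\<in>{1..N} - {i, j}. ?r \<le> dist (\<omega> i) (\<omega> k) \<and> 0 \<le> dist (\<omega> j) (\<omega> k))} \<in> sets (Q N)"
      using i j unfolding pred_def by (intro sets.sets_Collect) auto
    show "{\<omega>\<in>space (Q N). s \<le> zeta_nn \<omega> N i} \<in> sets (Q N)"
      using i by measurable
    show "AE \<omega> in Q N. (\<omega> \<in> {\<omega>\<in>space (Q N). s \<le> zeta_nn \<omega> N i}) \<longleftrightarrow>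
      (\<omega> \<in> {\<omega>\<in>space (Q N). (?r \<le> dist (\<omega> i) (\<omega> j) \<and> 0 \<le> dist (\<omega> i) (\<omega> j)) \<and> (\<forall>k\<in>{1..N} - {i, j}. ?r \<le> dist (\<omega> i) (\<omega> k) \<and> 0 \<le> dist (\<omega> j) (\<omega> k))})"
      using AE_distinct
    proof eventually_elim
      case (elim \<omega>)
      have "{1..N} - {i} = insert j ({1..N} - {i, j})" using j by auto
      then show ?case
        using zeta_nn_ge_iff[OF N nn_dist_pos[OF N i elim], of s]
        by (auto simp: nn_dist_ge_iff[OF N i])
    qed
  qed
  also have "\<dots> = (\<integral>x. \<integral>y. (if ?r \<le> dist x y \<and> 0 \<le> dist x y then (1 - measure P (ball x ?r \<union> ball y 0)) ^ (N - 2) else 0) \<partial>P \<partial>P)"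
    by (rule prob_pair[OF i j])
  also have "\<dots> = (\<integral>x. (1 - measure P (ball x ?r)) ^ (N - 1) \<partial>P)"
  proof (intro Bochner_Integration.integral_cong refl)
    fix x
    have "(\<integral>y. (if ?r \<le> dist x y \<and> 0 \<le> dist x y then (1 - measure P (ball x ?r \<union> ball y 0)) ^ (N - 2) else 0) \<partial>P)
      = (\<integral>y. (1 - measure P (ball x ?r)) ^ (N - 2) * indicator (space P - ball x ?r) y \<partial>P)"
      by (intro Bochner_Integration.integral_cong refl) (auto simp: indicator_def)
    also have "\<dots> = (1 - measure P (ball x ?r)) ^ (N - 2) * measure P (space P - ball x ?r)"
      by simp
    also have "measure P (space P - ball x ?r) = 1 - measure P (ball x ?r)"
      by (subst P.prob_compl) auto
    also have "(1 - measure P (ball x ?r)) ^ (N - 2) * (1 - measure P (ball x ?r)) = (1 - measure P (ball x ?r)) ^ (N - 1)"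
      using N by (simp flip: power_Suc2 add: Suc_diff_le[symmetric] numeral_2_eq_2)
    finally show "(\<integral>y. (if ?r \<le> dist x y \<and> 0 \<le> dist x y then (1 - measure P (ball x ?r \<union> ball y 0)) ^ (N - 2) else 0) \<partial>P) = (1 - measure P (ball x ?r)) ^ (N - 1)" .
  qed
  finally show ?thesis .
qed

section \<open>The limit variable and its survival function\<close>

definition Z :: "'a \<times> real \<Rightarrow> real" where
  "Z p = euler_mascheroni - ln (f (fst p)) + ln (snd p)"

definition Zspace where "Zspace = P \<Otimes>\<^sub>M exp1"

sublocale E: prob_space exp1
  by (rule prob_space_exponential_density) simp
sublocale PE: pair_prob_space P exp1 ..
sublocale Zsp: prob_space Zspace unfolding Zspace_def by (rule PE.prob_space_axioms)
sublocale Z2: pair_prob_space Zspace Zspace ..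

lemma Z_measurable [measurable]: "Z \<in> borel_measurable Zspace"
  unfolding Z_def Zspace_def by measurable

lemma surv_nonneg: "0 \<le> surv s"
  unfolding surv_def by (intro Bochner_Integration.integral_nonneg) simp

text \<open>For \<open>f x > 0\<close> and \<open>e > 0\<close>, taking logarithms turns
  \<open>s \<le> Z (x, e)\<close> into \<open>f x * exp (s - \<gamma>) \<le> e\<close>; both
  conditions hold almost surely, so the default values of \<open>ln\<close> do no harm.\<close>

lemma prob_Z: "measure Zspace {p\<in>space Zspace. s \<le> Z p} = surv s"
proof -
  have A: "{p\<in>space Zspace. s \<le> Z p} \<in> sets Zspace" by measurable
  have "emeasure Zspace {p\<in>space Zspace. s \<le> Z p} = (\<integral>\<^sup>+x. emeasure exp1 (Pair x -` {p\<in>space Zspace. s \<le> Z p}) \<partial>P)"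
    unfolding Zspace_def by (rule E.emeasure_pair_measure_alt[OF A[unfolded Zspace_def]])
  also have "\<dots> = (\<integral>\<^sup>+x. ennreal (exp (- (f x * exp (s - \<gamma>)))) \<partial>P)"
  proof (rule nn_integral_cong_AE)
    show "AE x in P. emeasure exp1 (Pair x -` {p\<in>space Zspace. s \<le> Z p}) = ennreal (exp (- (f x * exp (s - \<gamma>))))"
      using AE_P_pos
    proof eventually_elim
      case (elim x)
      let ?c = "f x * exp (s - \<gamma>)"
      have c: "0 < ?c" using elim by simp
      have Ze: "s \<le> Z (x, e) \<longleftrightarrow> ?c \<le> e" if "0 < e" for e
      proof -
        have "s \<le> Z (x, e) \<longleftrightarrow> ln ?c \<le> ln e" using elim by (auto simp: Z_def ln_mult)
        also have "\<dots> \<longleftrightarrow> ?c \<le> e" using c that by (rule ln_le_cancel_iff)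
        finally show ?thesis .
      qed
      have "emeasure exp1 (Pair x -` {p\<in>space Zspace. s \<le> Z p}) = emeasure exp1 {?c..}"
      proof (rule emeasure_eq_AE)
        show "AE e in exp1. (e \<in> Pair x -` {p\<in>space Zspace. s \<le> Z p}) = (e \<in> {?c..})"
        proof (subst AE_density)
          show "AE e in lborel. 0 < ennreal (exponential_density 1 e) \<longrightarrow> (e \<in> Pair x -` {p\<in>space Zspace. s \<le> Z p}) = (e \<in> {?c..})"
            using AE_lborel_singleton[of 0]
            by eventually_elim (auto simp: exponential_density_def Zspace_def space_pair_measure Ze split: if_splits)
        qed simp
        show "Pair x -` {p \<in> space Zspace. s \<le> Z p} \<in> sets exp1"
          by (rule sets_Pair1[OF A[unfolded Zspace_def], folded Zspace_def])
      qed simp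
      also have "\<dots> = ennreal (exp (- ?c))"
        using measure_exp1_atLeast[of ?c] c by (simp add: E.emeasure_eq_measure)
      finally show ?case .
    qed
  qed
  also have "\<dots> = ennreal (surv s)"
    unfolding surv_def using f_nn by (intro nn_integral_eq_integral integrable_P_bounded) auto
  finally have "ennreal (measure Zspace {p\<in>space Zspace. s \<le> Z p}) = ennreal (surv s)"
    by (simp add: Zsp.emeasure_eq_measure)
  then show ?thesis by (simp add: surv_nonneg)
qed

lemma prob_Z_pair:
  "measure (Zspace \<Otimes>\<^sub>M Zspace) {p\<in>space (Zspace \<Otimes>\<^sub>M Zspace). s \<le> Z (fst p) \<and> t \<le> Z (snd p)} = surv s * surv t"
proof -
  have [measurable]: "{p\<in>space Zspace. s \<le> Z p} \<in> sets Zspace" for s by measurable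
  have "{p\<in>space (Zspace \<Otimes>\<^sub>M Zspace). s \<le> Z (fst p) \<and> t \<le> Z (snd p)} = {p\<in>space Zspace. s \<le> Z p} \<times> {p\<in>space Zspace. t \<le> Z p}"
    by (auto simp: space_pair_measure)
  then have "emeasure (Zspace \<Otimes>\<^sub>M Zspace) {p\<in>space (Zspace \<Otimes>\<^sub>M Zspace). s \<le> Z (fst p) \<and> t \<le> Z (snd p)} = emeasure Zspace {p\<in>space Zspace. s \<le> Z p} * emeasure Zspace {p\<in>space Zspace. t \<le> Z p}"
    by (simp add: Zsp.emeasure_pair_measure_Times)
  then show ?thesis
    by (simp add: Zsp.emeasure_eq_measure Z2.emeasure_eq_measure prob_Z surv_nonneg ennreal_mult[symmetric])
qed

end

subsection \<open>Convergence of mixed moments\<close>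

text \<open>A weighted form of the Cauchy-Schwarz inequality, obtained from the square of
  \<open>\<kappa> * \<bar>u\<bar> - \<bar>v\<bar>\<close>; the weight can later be adapted to the
  size of the two second moments.\<close>

lemma (in prob_space) abs_expectation_mult_le:
  fixes U V :: "'a \<Rightarrow> real" and \<kappa> :: real
  assumes [measurable]: "U \<in> borel_measurable M" "V \<in> borel_measurable M"
    and i: "integrable M (\<lambda>x. (U x)\<^sup>2)" "integrable M (\<lambda>x. (V x)\<^sup>2)" and \<kappa>: "0 < \<kappa>"
  shows "\<bar>\<integral>x. U x * V x \<partial>M\<bar> \<le> \<kappa> * (\<integral>x. (U x)\<^sup>2 \<partial>M) + (\<integral>x. (V x)\<^sup>2 \<partial>M) / \<kappa>"
    and "integrable M (\<lambda>x. U x * V x)"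
proof -
  have le: "\<bar>u * v\<bar> \<le> \<kappa> * u\<^sup>2 + v\<^sup>2 / \<kappa>" for u v :: real
  proof -
    have "0 \<le> (\<bar>u\<bar> * \<kappa> - \<bar>v\<bar>)\<^sup>2" by simp
    then have "2 * (\<kappa> * (\<bar>u\<bar> * \<bar>v\<bar>)) \<le> \<kappa>\<^sup>2 * u\<^sup>2 + v\<^sup>2" by (simp add: power2_diff power_mult_distrib algebra_simps)
    moreover have "0 \<le> \<kappa> * (\<bar>u\<bar> * \<bar>v\<bar>)" using \<kappa> by simp
    ultimately have "\<kappa> * (\<bar>u\<bar> * \<bar>v\<bar>) \<le> \<kappa>\<^sup>2 * u\<^sup>2 + v\<^sup>2" by linarith
    then show ?thesis using \<kappa> by (simp add: abs_mult field_simps power2_eq_square)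
  qed
  have i2: "integrable M (\<lambda>x. \<kappa> * (U x)\<^sup>2 + (V x)\<^sup>2 / \<kappa>)" using i by auto
  show i3: "integrable M (\<lambda>x. U x * V x)"
    by (rule Bochner_Integration.integrable_bound[OF i2])
      (auto intro!: AE_I2 intro: order_trans[OF le] abs_ge_self)
  have "\<bar>\<integral>x. U x * V x \<partial>M\<bar> \<le> (\<integral>x. \<bar>U x * V x\<bar> \<partial>M)" by (rule integral_abs_bound)
  also have "\<dots> \<le> (\<integral>x. \<kappa> * (U x)\<^sup>2 + (V x)\<^sup>2 / \<kappa> \<partial>M)"
    by (intro integral_mono integrable_abs i2 i3 le)
  also have "\<dots> = \<kappa> * (\<integral>x. (U x)\<^sup>2 \<partial>M) + (\<integral>x. (V x)\<^sup>2 \<partial>M) / \<kappa>" using i by simp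
  finally show "\<bar>\<integral>x. U x * V x \<partial>M\<bar> \<le> \<kappa> * (\<integral>x. (U x)\<^sup>2 \<partial>M) + (\<integral>x. (V x)\<^sup>2 \<partial>M) / \<kappa>" .
qed

lemma expectation_mult_tendsto_0:
  fixes U V :: "nat \<Rightarrow> 'a \<Rightarrow> real"
  assumes P: "\<And>n. prob_space (M n)"
    and m: "\<And>n. U n \<in> borel_measurable (M n)" "\<And>n. V n \<in> borel_measurable (M n)"
    and i: "\<And>n. integrable (M n) (\<lambda>x. (U n x)\<^sup>2)" "\<And>n. integrable (M n) (\<lambda>x. (V n x)\<^sup>2)"
    and U0: "(\<lambda>n. \<integral>x. (U n x)\<^sup>2 \<partial>M n) \<longlonglongrightarrow> 0" and V: "(\<lambda>n. \<integral>x. (V n x)\<^sup>2 \<partial>M n) \<longlonglongrightarrow> B"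
  shows "(\<lambda>n. \<integral>x. U n x * V n x \<partial>M n) \<longlonglongrightarrow> 0"
proof -
  let ?a = "\<lambda>n. \<integral>x. (U n x)\<^sup>2 \<partial>M n" and ?b = "\<lambda>n. \<integral>x. (V n x)\<^sup>2 \<partial>M n"
  \<comment> \<open>The weight will be \<open>1 / q n\<close>, which turns the bound into
    \<open>q n\<close> plus the second moment of \<open>V n\<close> times \<open>q n\<close>. The
    summand \<open>1 / Suc n\<close> keeps \<open>q n\<close> positive when the second moment of
    \<open>U n\<close> is 0.\<close>
  define q where "q n = sqrt (?a n + 1 / real (Suc n))" for n
  have a0: "0 \<le> ?a n" for n by simp
  have q0: "0 < q n" for n unfolding q_def using a0[of n] by (simp add: add_nonneg_pos del: of_nat_Suc)
  have qlim: "q \<longlonglongrightarrow> 0"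
  proof -
    have "(\<lambda>n. sqrt (?a n + 1 / real (Suc n))) \<longlonglongrightarrow> sqrt (0 + 0)"
      by (intro tendsto_real_sqrt tendsto_add U0 LIMSEQ_Suc[OF lim_1_over_n])
    then show ?thesis unfolding q_def by simp
  qed
  have bd: "\<bar>\<integral>x. U n x * V n x \<partial>M n\<bar> \<le> q n + ?b n * q n" for n
  proof -
    interpret prob_space "M n" by (rule P)
    have "\<bar>\<integral>x. U n x * V n x \<partial>M n\<bar> \<le> (1 / q n) * ?a n + ?b n / (1 / q n)"
      using q0 by (intro abs_expectation_mult_le m i) simp
    also have "(1 / q n) * ?a n \<le> (1 / q n) * (q n)\<^sup>2"
      using q0[of n] a0[of n] by (intro mult_left_mono) (auto simp: q_def)
    also have "(1 / q n) * (q n)\<^sup>2 = q n" using q0[of n] by (simp add: power2_eq_square)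
    finally show ?thesis by simp
  qed
  have "(\<lambda>n. q n + ?b n * q n) \<longlonglongrightarrow> 0 + B * 0" by (intro tendsto_intros qlim V)
  then have "(\<lambda>n. q n + ?b n * q n) \<longlonglongrightarrow> 0" by simp
  then show ?thesis by (rule Lim_null_comparison[rotated]) (use bd in auto)
qed

text \<open>Expanding \<open>U = U' + (U - U')\<close> and \<open>V = V' + (V - V')\<close>, every
  term other than \<open>U' * V'\<close> contains a factor that is small in mean square, while the
  second moments of \<open>U'\<close> and \<open>V'\<close> converge.\<close>

lemma expectation_mult_perturb:
  fixes U V U' V' :: "nat \<Rightarrow> 'a \<Rightarrow> real"
  assumes P: "\<And>n. prob_space (M n)"
    and m: "\<And>n. U n \<in> borel_measurable (M n)" "\<And>n. V n \<in> borel_measurable (M n)"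
       "\<And>n. U' n \<in> borel_measurable (M n)" "\<And>n. V' n \<in> borel_measurable (M n)"
    and i: "\<And>n. integrable (M n) (\<lambda>x. (U' n x)\<^sup>2)" "\<And>n. integrable (M n) (\<lambda>x. (V' n x)\<^sup>2)"
       "\<And>n. integrable (M n) (\<lambda>x. (U n x - U' n x)\<^sup>2)" "\<And>n. integrable (M n) (\<lambda>x. (V n x - V' n x)\<^sup>2)"
    and U0: "(\<lambda>n. \<integral>x. (U n x - U' n x)\<^sup>2 \<partial>M n) \<longlonglongrightarrow> 0" and V0: "(\<lambda>n. \<integral>x. (V n x - V' n x)\<^sup>2 \<partial>M n) \<longlonglongrightarrow> 0"
    and UB: "(\<lambda>n. \<integral>x. (U' n x)\<^sup>2 \<partial>M n) \<longlonglongrightarrow> A" and VB: "(\<lambda>n. \<integral>x. (V' n x)\<^sup>2 \<partial>M n) \<longlonglongrightarrow> B"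
    and UV: "(\<lambda>n. \<integral>x. U' n x * V' n x \<partial>M n) \<longlonglongrightarrow> l"
  shows "(\<lambda>n. \<integral>x. U n x * V n x \<partial>M n) \<longlonglongrightarrow> l"
proof -
  note m' = m borel_measurable_diff[OF m(1,3)] borel_measurable_diff[OF m(2,4)]
  have "(\<lambda>n. (\<integral>x. U' n x * V' n x \<partial>M n) + (\<integral>x. (U n x - U' n x) * V' n x \<partial>M n)
      + (\<integral>x. (V n x - V' n x) * U' n x \<partial>M n) + (\<integral>x. (U n x - U' n x) * (V n x - V' n x) \<partial>M n)) \<longlonglongrightarrow> l + 0 + 0 + 0"
    by (intro tendsto_add UV expectation_mult_tendsto_0[OF P _ _ _ _ U0 VB] expectation_mult_tendsto_0[OF P _ _ _ _ V0 UB] expectation_mult_tendsto_0[OF P _ _ _ _ U0 V0] m' i)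
  moreover have "(\<integral>x. U' n x * V' n x \<partial>M n) + (\<integral>x. (U n x - U' n x) * V' n x \<partial>M n)
      + (\<integral>x. (V n x - V' n x) * U' n x \<partial>M n) + (\<integral>x. (U n x - U' n x) * (V n x - V' n x) \<partial>M n) = (\<integral>x. U n x * V n x \<partial>M n)" for n
  proof -
    interpret prob_space "M n" by (rule P)
    note j = abs_expectation_mult_le(2)[OF _ _ _ _ zero_less_one]
    have "(\<integral>x. U' n x * V' n x \<partial>M n) + (\<integral>x. (U n x - U' n x) * V' n x \<partial>M n)
      + (\<integral>x. (V n x - V' n x) * U' n x \<partial>M n) + (\<integral>x. (U n x - U' n x) * (V n x - V' n x) \<partial>M n)
      = (\<integral>x. U' n x * V' n x + (U n x - U' n x) * V' n x + (V n x - V' n x) * U' n x + (U n x - U' n x) * (V n x - V' n x) \<partial>M n)"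
    proof -
      have k: "integrable (M n) (\<lambda>x. U' n x * V' n x)" "integrable (M n) (\<lambda>x. (U n x - U' n x) * V' n x)"
        "integrable (M n) (\<lambda>x. (V n x - V' n x) * U' n x)" "integrable (M n) (\<lambda>x. (U n x - U' n x) * (V n x - V' n x))"
        by (rule j; (rule m' i))+
      show ?thesis by (simp only: Bochner_Integration.integral_add Bochner_Integration.integrable_add k)
    qed
    also have "\<dots> = (\<integral>x. U n x * V n x \<partial>M n)" by (intro Bochner_Integration.integral_cong) (auto simp: algebra_simps)
    finally show ?thesis .
  qed
  ultimately show ?thesis by simp
qed

context nn_density begin

lemma prob_Z_fst: "measure (Zspace \<Otimes>\<^sub>M Zspace) {p\<in>space (Zspace \<Otimes>\<^sub>M Zspace). s \<le> Z (fst p)} = surv s"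
proof -
  have "{p\<in>space (Zspace \<Otimes>\<^sub>M Zspace). s \<le> Z (fst p)} = {p\<in>space Zspace. s \<le> Z p} \<times> space Zspace"
    by (auto simp: space_pair_measure)
  then have "emeasure (Zspace \<Otimes>\<^sub>M Zspace) {p\<in>space (Zspace \<Otimes>\<^sub>M Zspace). s \<le> Z (fst p)} = emeasure Zspace {p\<in>space Zspace. s \<le> Z p} * emeasure Zspace (space Zspace)"
    by (simp add: Zsp.emeasure_pair_measure_Times)
  then show ?thesis
    by (simp add: Zsp.emeasure_eq_measure Z2.emeasure_eq_measure prob_Z surv_nonneg Zsp.prob_space)
qed

lemma prob_Z_snd: "measure (Zspace \<Otimes>\<^sub>M Zspace) {p\<in>space (Zspace \<Otimes>\<^sub>M Zspace). s \<le> Z (snd p)} = surv s"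
proof -
  have "{p\<in>space (Zspace \<Otimes>\<^sub>M Zspace). s \<le> Z (snd p)} = space Zspace \<times> {p\<in>space Zspace. s \<le> Z p}"
    by (auto simp: space_pair_measure)
  then have "emeasure (Zspace \<Otimes>\<^sub>M Zspace) {p\<in>space (Zspace \<Otimes>\<^sub>M Zspace). s \<le> Z (snd p)} = emeasure Zspace (space Zspace) * emeasure Zspace {p\<in>space Zspace. s \<le> Z p}"
    by (simp add: Zsp.emeasure_pair_measure_Times)
  then show ?thesis
    by (simp add: Zsp.emeasure_eq_measure Z2.emeasure_eq_measure prob_Z surv_nonneg Zsp.prob_space)
qed

end

text \<open>Only this much about the functionals enters the limit argument. By
  \<open>prob_marginal\<close>, \<open>low\<close> bounds the probability that the statistic is
  below \<open>s\<close>, and \<open>up\<close> the probability that it is at least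
  \<open>s\<close>. Both are confined to radii up to \<open>\<rho>\<close>, because the functionals
  control averages of \<open>f\<close> over small balls only.\<close>

locale nn_density_tails = nn_density +
  fixes \<rho> C c :: real
  assumes log_dist: "(\<integral>\<^sup>+x. \<integral>\<^sup>+y. ennreal ((ln (dist x y))\<^sup>2) \<partial>P \<partial>P) < \<infinity>"
    and \<rho>: "0 < \<rho>" and C: "0 \<le> C" and c: "0 < c"
    and low: "\<And>N s. 2 \<le> N \<Longrightarrow> nn_radius TYPE('a) N s \<le> \<rho> \<Longrightarrow>
       (\<integral>x. 1 - (1 - measure P (ball x (nn_radius TYPE('a) N s))) ^ (N - 1) \<partial>P) \<le> C * exp (c * s)"
    and up: "\<And>N s. 2 \<le> N \<Longrightarrow> nn_radius TYPE('a) N s \<le> \<rho> \<Longrightarrow>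
       (\<integral>x. (1 - measure P (ball x (nn_radius TYPE('a) N s))) ^ (N - 1) \<partial>P) \<le> C * exp (- c * s)"
begin

section \<open>Truncation of the statistic at a fixed radius\<close>

definition thr :: "nat \<Rightarrow> real" where
  "thr N = ln (\<rho> ^ DIM('a) * unit_ball_vol (real DIM('a)) * exp euler_mascheroni * (real N - 1))"

lemma vol_pos: "0 < unit_ball_vol (real DIM('a))" by (simp add: unit_ball_vol_pos)

lemma zeta_eq:
  fixes x :: "nat \<Rightarrow> 'a"
  assumes "2 \<le> N" "0 < nn_dist x N i"
  shows "zeta_nn x N i = thr N + real DIM('a) * (ln (nn_dist x N i) - ln \<rho>)"
proof -
  let ?K = "unit_ball_vol (real DIM('a)) * exp euler_mascheroni * (real N - 1)"
  have K: "0 < ?K" using vol_pos assms(1) by simp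
  have gen: "ln (a ^ n * K) = real n * ln a + ln K" if "0 < a" "0 < K" for a K :: real and n
    using that by (simp add: ln_mult ln_realpow)
  have *: "ln (a ^ DIM('a) * ?K) = real DIM('a) * ln a + ln ?K" if "0 < a" for a
    by (rule gen[OF that K])
  show ?thesis
    unfolding zeta_nn_def thr_def using *[OF assms(2)] *[OF \<rho>] by (simp only: mult.assoc right_diff_distrib)
qed

text \<open>\<open>thr N\<close> is the value of the statistic at distance \<open>\<rho>\<close>, so
  the assumed tail bounds are available exactly for \<open>s \<le> thr N\<close>.\<close>

lemma nn_radius_le_iff:
  assumes N: "2 \<le> N"
  shows "nn_radius TYPE('a) N s \<le> \<rho> \<longleftrightarrow> s \<le> thr N"
proof -
  let ?r = "nn_radius TYPE('a) N s" let ?v = "unit_ball_vol (real DIM('a))"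
  have "s \<le> thr N \<longleftrightarrow> exp s \<le> \<rho> ^ DIM('a) * ?v * exp euler_mascheroni * (real N - 1)"
    unfolding thr_def using \<rho> vol_pos N by (subst ln_ge_iff) auto
  also have "exp s = ?r ^ DIM('a) * ?v * exp euler_mascheroni * (real N - 1)"
    using nn_radius_power[OF N, of s, where 'a='a] by (simp add: exp_diff field_simps)
  also have "\<dots> \<le> \<rho> ^ DIM('a) * ?v * exp euler_mascheroni * (real N - 1) \<longleftrightarrow> ?r ^ DIM('a) \<le> \<rho> ^ DIM('a)"
  proof -
    have "0 < ?v * exp euler_mascheroni * (real N - 1)" using vol_pos N by simp
    from mult_le_cancel_right_pos[OF this] show ?thesis by (simp only: mult.assoc)
  qed
  also have "\<dots> \<longleftrightarrow> ?r \<le> \<rho>"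
    using nn_radius_pos[OF N, of s, where 'a='a] \<rho> by (intro power_mono_iff) auto
  finally show ?thesis by simp
qed

lemma eventually_thr: "\<forall>\<^sub>F N in sequentially. s \<le> thr N \<and> 2 \<le> N"
  using order_tendstoD(2)[OF nn_radius_tendsto_0[of s, where 'a='a] \<rho>] eventually_ge_at_top[of 2]
  by eventually_elim (simp add: nn_radius_le_iff[symmetric])

definition eta :: "(nat \<Rightarrow> 'a) \<Rightarrow> nat \<Rightarrow> nat \<Rightarrow> real" where
  "eta x N i = min (zeta_nn x N i) (thr N)"

lemma measurable_eta [measurable]: "i \<in> {1..N} \<Longrightarrow> (\<lambda>\<omega>. eta \<omega> N i) \<in> borel_measurable (Q N)"
  unfolding eta_def by measurable

text \<open>Truncation makes the bounds global: beyond \<open>thr N\<close> the upper tail is 0, and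
  up to there \<open>up\<close> applies. Nonnegativity of \<open>thr N\<close> places every
  \<open>s \<le> 0\<close> in the range of \<open>low\<close>.\<close>

lemma eta_tail:
  assumes N: "2 \<le> N" "0 \<le> thr N" and i: "i \<in> {1..N}"
  shows "(\<integral>\<omega>. \<bar>hstep (eta \<omega> N i) s\<bar> \<partial>Q N) \<le> C * exp (- c * \<bar>s\<bar>)"
proof -
  let ?p = "\<integral>x. (1 - measure P (ball x (nn_radius TYPE('a) N s))) ^ (N - 1) \<partial>P"
  have eq: "measure (Q N) {\<omega>\<in>space (Q N). s \<le> eta \<omega> N i} = (if s \<le> thr N then ?p else 0)"
    using prob_marginal[OF N(1) i, of s] by (simp add: eta_def)
  have "integrable P (\<lambda>x. (1 - measure P (ball x (nn_radius TYPE('a) N s))) ^ (N - 1))"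
    by (rule integrable_P_bounded) (auto simp: power_abs intro!: power_le_one)
  then have p: "1 - ?p = (\<integral>x. 1 - (1 - measure P (ball x (nn_radius TYPE('a) N s))) ^ (N - 1) \<partial>P)"
    by simp
  show ?thesis
  proof (cases "s \<le> 0")
    case True
    then have "nn_radius TYPE('a) N s \<le> \<rho>" using N by (simp add: nn_radius_le_iff)
    from low[OF N(1) this] have "1 - ?p \<le> C * exp (c * s)" unfolding p .
    then show ?thesis using True N i by (simp add: Q.expectation_abs_hstep eq)
  next
    case False
    show ?thesis
    proof (cases "s \<le> thr N")
      case True
      then have "nn_radius TYPE('a) N s \<le> \<rho>" using N by (simp add: nn_radius_le_iff)
      from up[OF N(1) this] show ?thesis using True False i by (simp add: Q.expectation_abs_hstep eq)
    next
      case f: False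
      then show ?thesis using False i C by (simp add: Q.expectation_abs_hstep eq)
    qed
  qed
qed

lemma integrable_log_dist_sq:
  assumes "i \<in> {1..N}" "j \<in> {1..N}" "i \<noteq> j"
  shows "integrable (Q N) (\<lambda>\<omega>. (ln (dist (\<omega> i) (\<omega> j)))\<^sup>2)"
proof (rule integrableI_nonneg)
  show "(\<lambda>\<omega>. (ln (dist (\<omega> i) (\<omega> j)))\<^sup>2) \<in> borel_measurable (Q N)"
    using measurable_coord_dist[OF assms(1,2)] by measurable
  have "(\<lambda>p. ennreal ((ln (dist (fst p) (snd p :: 'a)))\<^sup>2)) \<in> borel_measurable (borel \<Otimes>\<^sub>M borel)" by measurable
  from nn_integral_Q_pair'[OF assms this]
  show "(\<integral>\<^sup>+\<omega>. ennreal ((ln (dist (\<omega> i) (\<omega> j)))\<^sup>2) \<partial>Q N) < \<infinity>" using log_dist by simp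
qed simp

text \<open>Which index attains the minimum depends on the sample, but its squared logarithm is one
  of the summands in the sum over all other indices.\<close>

lemma integrable_zeta_sq:
  assumes N: "2 \<le> N" and i: "i \<in> {1..N}"
  shows "integrable (Q N) (\<lambda>\<omega>. (zeta_nn \<omega> N i)\<^sup>2)"
proof (rule Bochner_Integration.integrable_bound)
  let ?d = "real DIM('a)" and ?k = "thr N - real DIM('a) * ln \<rho>"
  show "integrable (Q N) (\<lambda>\<omega>. 2 * ?k\<^sup>2 + 2 * ?d\<^sup>2 * (\<Sum>j\<in>{1..N} - {i}. (ln (dist (\<omega> i) (\<omega> j)))\<^sup>2))"
    using i by (intro Bochner_Integration.integrable_add integrable_mult_right Bochner_Integration.integrable_sum integrable_log_dist_sq) auto
  show "AE \<omega> in Q N. norm ((zeta_nn \<omega> N i)\<^sup>2) \<le> norm (2 * ?k\<^sup>2 + 2 * ?d\<^sup>2 * (\<Sum>j\<in>{1..N} - {i}. (ln (dist (\<omega> i) (\<omega> j)))\<^sup>2))"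
    using AE_distinct
  proof eventually_elim
    case (elim \<omega>)
    obtain j where j: "j \<in> {1..N} - {i}" "nn_dist \<omega> N i = dist (\<omega> i) (\<omega> j)" using nn_dist_in[OF N i] by blast
    have "(ln (nn_dist \<omega> N i))\<^sup>2 \<le> (\<Sum>j\<in>{1..N} - {i}. (ln (dist (\<omega> i) (\<omega> j)))\<^sup>2)"
      unfolding j(2) by (rule member_le_sum[OF j(1)]) auto
    moreover have "zeta_nn \<omega> N i = ?k + ?d * ln (nn_dist \<omega> N i)"
      using zeta_eq[OF N nn_dist_pos[OF N i elim]] by (simp add: algebra_simps)
    moreover have "(a + b)\<^sup>2 \<le> 2 * a\<^sup>2 + 2 * b\<^sup>2" for a b :: real
      using sum_squares_ge_zero[of "a - b" 0] by (simp add: power2_eq_square algebra_simps)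
    ultimately have "(zeta_nn \<omega> N i)\<^sup>2 \<le> 2 * ?k\<^sup>2 + 2 * (?d * ln (nn_dist \<omega> N i))\<^sup>2" by simp
    also have "\<dots> \<le> 2 * ?k\<^sup>2 + 2 * ?d\<^sup>2 * (\<Sum>j\<in>{1..N} - {i}. (ln (dist (\<omega> i) (\<omega> j)))\<^sup>2)"
      using \<open>(ln (nn_dist \<omega> N i))\<^sup>2 \<le> _\<close> by (simp add: power_mult_distrib mult_left_mono)
    finally show ?case by simp
  qed
  show "(\<lambda>\<omega>. (zeta_nn \<omega> N i)\<^sup>2) \<in> borel_measurable (Q N)" using measurable_zeta[OF i] by measurable
qed

text \<open>The square of the amount by which the statistic at \<open>x\<close> would exceed
  \<open>thr N\<close> if \<open>y\<close> were the nearest neighbor; it does not depend on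
  \<open>N\<close>.\<close>

definition log_excess :: "'a \<Rightarrow> 'a \<Rightarrow> real" where
  "log_excess x y = (real DIM('a) * max 0 (ln (dist x y) - ln \<rho>))\<^sup>2"

lemma log_excess_measurable [measurable]: "(\<lambda>p. log_excess (fst p) (snd p)) \<in> borel_measurable (borel \<Otimes>\<^sub>M borel)"
  unfolding log_excess_def by measurable

lemma log_excess_finite: "(\<integral>\<^sup>+x. \<integral>\<^sup>+y. ennreal (log_excess x y) \<partial>P \<partial>P) < \<infinity>"
proof -
  let ?d = "real DIM('a)"
  have m: "(\<lambda>p. ennreal ((ln (dist (fst p) (snd p :: 'a)))\<^sup>2)) \<in> borel_measurable (P \<Otimes>\<^sub>M P)" by measurable
  have m1: "(\<lambda>y. ennreal ((ln (dist x y))\<^sup>2)) \<in> borel_measurable P" for x by measurable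
  have m2: "(\<lambda>x. \<integral>\<^sup>+y. ennreal ((ln (dist x y))\<^sup>2) \<partial>P) \<in> borel_measurable P"
    using P.borel_measurable_nn_integral_fst[OF m] by simp
  have "log_excess x y \<le> 2 * ?d\<^sup>2 * (ln \<rho>)\<^sup>2 + 2 * ?d\<^sup>2 * (ln (dist x y))\<^sup>2" for x y
  proof -
    have "(max 0 (a - b))\<^sup>2 \<le> (a - b)\<^sup>2" for a b :: real by (auto simp: max_def)
    moreover have "(a - b)\<^sup>2 \<le> 2 * b\<^sup>2 + 2 * a\<^sup>2" for a b :: real
      using sum_squares_ge_zero[of "a + b" 0] by (simp add: power2_eq_square algebra_simps)
    ultimately have "(max 0 (ln (dist x y) - ln \<rho>))\<^sup>2 \<le> 2 * (ln \<rho>)\<^sup>2 + 2 * (ln (dist x y))\<^sup>2" by (meson order_trans)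
    then have "?d\<^sup>2 * (max 0 (ln (dist x y) - ln \<rho>))\<^sup>2 \<le> ?d\<^sup>2 * (2 * (ln \<rho>)\<^sup>2 + 2 * (ln (dist x y))\<^sup>2)"
      by (intro mult_left_mono) auto
    then show ?thesis by (simp add: log_excess_def power_mult_distrib algebra_simps)
  qed
  then have "(\<integral>\<^sup>+x. \<integral>\<^sup>+y. ennreal (log_excess x y) \<partial>P \<partial>P) \<le> (\<integral>\<^sup>+x. \<integral>\<^sup>+y. ennreal (2 * ?d\<^sup>2 * (ln \<rho>)\<^sup>2) + ennreal (2 * ?d\<^sup>2) * ennreal ((ln (dist x y))\<^sup>2) \<partial>P \<partial>P)"
    by (intro nn_integral_mono) (simp add: ennreal_leI flip: ennreal_plus ennreal_mult)
  also have "\<dots> = ennreal (2 * ?d\<^sup>2 * (ln \<rho>)\<^sup>2) + ennreal (2 * ?d\<^sup>2) * (\<integral>\<^sup>+x. \<integral>\<^sup>+y. ennreal ((ln (dist x y))\<^sup>2) \<partial>P \<partial>P)"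
    by (simp add: nn_integral_add nn_integral_cmult m1 m2 P.emeasure_eq_measure)
  also have "\<dots> < \<infinity>" using log_dist by (simp add: ennreal_mult_less_top)
  finally show ?thesis .
qed

text \<open>Almost surely \<open>f x > 0\<close>, and then the rescaled masses of shrinking balls
  have a positive limit; so some ball inside \<open>ball x \<rho>\<close> already has positive
  mass.\<close>

lemma AE_ball_pos: "AE x in P. 0 < measure P (ball x \<rho>)"
  using AE_ball_limit[of 0] AE_P_pos
proof eventually_elim
  case (elim x)
  have "0 < f x * exp (0 - \<gamma>)" using elim by simp
  from order_tendstoD(1)[OF elim(1) this] have "\<forall>\<^sub>F N in sequentially. 0 < (real N - 1) * measure P (ball x (nn_radius TYPE('a) N 0)) \<and> 0 \<le> thr N \<and> 2 \<le> N"
    using eventually_thr[of 0] by eventually_elim auto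
  then obtain N where N: "0 < (real N - 1) * measure P (ball x (nn_radius TYPE('a) N 0))" "0 \<le> thr N" "2 \<le> N"
    using eventually_happens[of _ sequentially] by auto
  then have "0 < measure P (ball x (nn_radius TYPE('a) N 0))"
    by (simp add: zero_less_mult_iff)
  also have "\<dots> \<le> measure P (ball x \<rho>)"
    using N nn_radius_le_iff[of N 0] by (intro P.finite_measure_mono subset_ball) auto
  finally show ?case .
qed

lemma log_excess_tail:
  "(\<lambda>N. \<integral>\<^sup>+x. (\<integral>\<^sup>+y. ennreal (log_excess x y) \<partial>P) * ennreal ((1 - measure P (ball x \<rho>)) ^ (N - 2)) \<partial>P) \<longlonglongrightarrow> 0"
proof -
  let ?L = "\<lambda>x. \<integral>\<^sup>+y. ennreal (log_excess x y) \<partial>P"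
  have "(\<lambda>p. ennreal (log_excess (fst p) (snd p))) \<in> borel_measurable (P \<Otimes>\<^sub>M P)" by measurable
  from P.borel_measurable_nn_integral_fst[OF this] have L [measurable]: "?L \<in> borel_measurable P" by simp
  have "(\<lambda>N. \<integral>\<^sup>+x. ?L x * ennreal ((1 - measure P (ball x \<rho>)) ^ (N - 2)) \<partial>P) \<longlonglongrightarrow> (\<integral>\<^sup>+x. 0 \<partial>P)"
  proof (rule nn_integral_dominated_convergence[where w = ?L])
    \<comment> \<open>Finiteness is needed because a factor tending to 0 does not make a product
      with infinity small.\<close>
    have "AE x in P. ?L x \<noteq> \<infinity>" using log_excess_finite by (intro nn_integral_PInf_AE L) auto
    then show "AE x in P. (\<lambda>N. ?L x * ennreal ((1 - measure P (ball x \<rho>)) ^ (N - 2))) \<longlonglongrightarrow> 0"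
      using AE_ball_pos
    proof eventually_elim
      case (elim x)
      have "(\<lambda>n. (1 - measure P (ball x \<rho>)) ^ n) \<longlonglongrightarrow> 0"
        using elim(2) by (intro LIMSEQ_realpow_zero) auto
      then have "(\<lambda>N. (1 - measure P (ball x \<rho>)) ^ (N - 2)) \<longlonglongrightarrow> 0"
        using LIMSEQ_offset[of "\<lambda>N. (1 - measure P (ball x \<rho>)) ^ (N - 2)" 2] by simp
      from tendsto_ennrealI[OF this]
      have "(\<lambda>N. ?L x * ennreal ((1 - measure P (ball x \<rho>)) ^ (N - 2))) \<longlonglongrightarrow> ?L x * ennreal 0"
        using elim(1) by (intro ennreal_tendsto_cmult) (auto simp: less_top)
      then show ?case by simp
    qed
    show "AE x in P. ?L x * ennreal ((1 - measure P (ball x \<rho>)) ^ (N - 2)) \<le> ?L x" for N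
    proof (intro AE_I2)
      fix x
      have "ennreal ((1 - measure P (ball x \<rho>)) ^ (N - 2)) \<le> 1" by (simp add: power_le_one ennreal_le_1)
      from mult_left_mono[OF this, of "?L x"] show "?L x * ennreal ((1 - measure P (ball x \<rho>)) ^ (N - 2)) \<le> ?L x" by simp
    qed
  qed (use log_excess_finite in auto)
  then show ?thesis by simp
qed

text \<open>If the statistic exceeds \<open>thr N\<close>, all other points are at distance at least
  \<open>\<rho>\<close>, and the nearest one is no farther than a fixed \<open>j\<close>-th point.
  Passing to this \<open>j\<close> avoids a sum over \<open>N\<close> candidates and leaves
  \<open>N - 2\<close> independent points that must avoid the ball.\<close>

lemma zeta_minus_eta_le:
  assumes N: "2 \<le> N" and i: "i \<in> {1..N}"
  shows "(\<integral>\<^sup>+\<omega>. ennreal ((zeta_nn \<omega> N i - eta \<omega> N i)\<^sup>2) \<partial>Q N)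
    \<le> (\<integral>\<^sup>+x. (\<integral>\<^sup>+y. ennreal (log_excess x y) \<partial>P) * ennreal ((1 - measure P (ball x \<rho>)) ^ (N - 2)) \<partial>P)"
proof -
  define j where "j = (if i = 1 then 2 else 1 :: nat)"
  have j: "j \<in> {1..N}" "i \<noteq> j" using N by (auto simp: j_def)
  have gm: "(\<lambda>p. ennreal (log_excess (fst p) (snd p))) \<in> borel_measurable (borel \<Otimes>\<^sub>M borel)" by measurable
  have "(\<integral>\<^sup>+\<omega>. ennreal ((zeta_nn \<omega> N i - eta \<omega> N i)\<^sup>2) \<partial>Q N)
    \<le> (\<integral>\<^sup>+\<omega>. ennreal (log_excess (\<omega> i) (\<omega> j)) * indicator {\<omega>. \<forall>k\<in>{1..N} - {i, j}. \<rho> \<le> dist (\<omega> i) (\<omega> k) \<and> 0 \<le> dist (\<omega> j) (\<omega> k)} \<omega> \<partial>Q N)"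
  proof (rule nn_integral_mono_AE)
    show "AE \<omega> in Q N. ennreal ((zeta_nn \<omega> N i - eta \<omega> N i)\<^sup>2) \<le> ennreal (log_excess (\<omega> i) (\<omega> j)) * indicator {\<omega>. \<forall>k\<in>{1..N} - {i, j}. \<rho> \<le> dist (\<omega> i) (\<omega> k) \<and> 0 \<le> dist (\<omega> j) (\<omega> k)} \<omega>"
      using AE_distinct
    proof eventually_elim
      case (elim \<omega>)
      let ?D = "nn_dist \<omega> N i"
      have D: "0 < ?D" by (rule nn_dist_pos[OF N i elim])
      have all: "\<forall>k\<in>{1..N} - {i}. ?D \<le> dist (\<omega> i) (\<omega> k)" using nn_dist_ge_iff[OF N i, of ?D \<omega>] by simp
      show ?case
      proof (cases "zeta_nn \<omega> N i \<le> thr N")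
        case True
        then show ?thesis by (simp add: eta_def)
      next
        case False
        then have pos: "0 < real DIM('a) * (ln ?D - ln \<rho>)" using zeta_eq[OF N D] by simp
        then have "ln \<rho> < ln ?D" by (simp add: zero_less_mult_iff)
        then have "\<rho> < ?D" using D \<rho> by simp
        have "?D \<le> dist (\<omega> i) (\<omega> j)" using all j by blast
        then have le: "ln ?D \<le> ln (dist (\<omega> i) (\<omega> j))" using D by (intro ln_mono) auto
        have "zeta_nn \<omega> N i - eta \<omega> N i = real DIM('a) * (ln ?D - ln \<rho>)"
          using False zeta_eq[OF N D] by (simp add: eta_def)
        also have "\<dots> \<le> real DIM('a) * max 0 (ln (dist (\<omega> i) (\<omega> j)) - ln \<rho>)"
          using le by (intro mult_left_mono) auto
        finally have "(zeta_nn \<omega> N i - eta \<omega> N i)\<^sup>2 \<le> log_excess (\<omega> i) (\<omega> j)"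
          unfolding log_excess_def by (intro power_mono) (auto simp: eta_def)
        moreover have "\<forall>k\<in>{1..N} - {i, j}. \<rho> \<le> dist (\<omega> i) (\<omega> k) \<and> 0 \<le> dist (\<omega> j) (\<omega> k)"
          using all \<open>\<rho> < ?D\<close> by force
        ultimately show ?thesis by (simp add: ennreal_leI)
      qed
    qed
  qed
  also have "\<dots> = (\<integral>\<^sup>+x. \<integral>\<^sup>+y. ennreal (log_excess x y) * ennreal ((1 - measure P (ball x \<rho> \<union> ball y 0)) ^ (N - 2)) \<partial>P \<partial>P)"
    using nn_integral_Q_pair[OF i j gm, of \<rho> 0] by simp
  also have "\<dots> = (\<integral>\<^sup>+x. (\<integral>\<^sup>+y. ennreal (log_excess x y) \<partial>P) * ennreal ((1 - measure P (ball x \<rho>)) ^ (N - 2)) \<partial>P)"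
  proof (intro nn_integral_cong)
    fix x
    have "(\<lambda>y. ennreal (log_excess x y)) \<in> borel_measurable P" unfolding log_excess_def by measurable
    then show "(\<integral>\<^sup>+y. ennreal (log_excess x y) * ennreal ((1 - measure P (ball x \<rho> \<union> ball y 0)) ^ (N - 2)) \<partial>P) = (\<integral>\<^sup>+y. ennreal (log_excess x y) \<partial>P) * ennreal ((1 - measure P (ball x \<rho>)) ^ (N - 2))"
      by (simp add: nn_integral_multc)
  qed
  finally show ?thesis .
qed

lemma zeta_minus_eta_tendsto_0:
  assumes N: "filterlim N at_top sequentially" "\<And>n. 2 \<le> N n" and i: "\<And>n. i \<in> {1..N n}"
  shows "\<And>n. integrable (Q (N n)) (\<lambda>\<omega>. (zeta_nn \<omega> (N n) i - eta \<omega> (N n) i)\<^sup>2)"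
    and "(\<lambda>n. \<integral>\<omega>. (zeta_nn \<omega> (N n) i - eta \<omega> (N n) i)\<^sup>2 \<partial>Q (N n)) \<longlonglongrightarrow> 0"
proof -
  show int: "integrable (Q (N n)) (\<lambda>\<omega>. (zeta_nn \<omega> (N n) i - eta \<omega> (N n) i)\<^sup>2)" for n
  proof (rule Bochner_Integration.integrable_bound)
    show "integrable (Q (N n)) (\<lambda>\<omega>. 2 * (zeta_nn \<omega> (N n) i)\<^sup>2 + 2 * (thr (N n))\<^sup>2)"
      using integrable_zeta_sq[OF N(2) i] by (intro Bochner_Integration.integrable_add integrable_mult_right) auto
    have "(z - min z t)\<^sup>2 \<le> 2 * z\<^sup>2 + 2 * t\<^sup>2" for z t :: real
      using sum_squares_ge_zero[of "z + t" 0] by (auto simp: min_def power2_eq_square algebra_simps)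
    then show "AE \<omega> in Q (N n). norm ((zeta_nn \<omega> (N n) i - eta \<omega> (N n) i)\<^sup>2) \<le> norm (2 * (zeta_nn \<omega> (N n) i)\<^sup>2 + 2 * (thr (N n))\<^sup>2)"
      by (intro AE_I2) (simp add: eta_def)
    show "(\<lambda>\<omega>. (zeta_nn \<omega> (N n) i - eta \<omega> (N n) i)\<^sup>2) \<in> borel_measurable (Q (N n))"
      using measurable_zeta[OF i] measurable_eta[OF i] by measurable
  qed
  have "(\<lambda>n. \<integral>\<^sup>+\<omega>. ennreal ((zeta_nn \<omega> (N n) i - eta \<omega> (N n) i)\<^sup>2) \<partial>Q (N n)) \<longlonglongrightarrow> 0"
  proof (rule tendsto_sandwich[OF _ _ tendsto_const filterlim_compose[OF log_excess_tail N(1)]])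
    show "\<forall>\<^sub>F n in sequentially. (\<integral>\<^sup>+\<omega>. ennreal ((zeta_nn \<omega> (N n) i - eta \<omega> (N n) i)\<^sup>2) \<partial>Q (N n))
      \<le> (\<integral>\<^sup>+x. (\<integral>\<^sup>+y. ennreal (log_excess x y) \<partial>P) * ennreal ((1 - measure P (ball x \<rho>)) ^ (N n - 2)) \<partial>P)"
      by (intro always_eventually allI zeta_minus_eta_le[OF N(2) i])
  qed simp
  then have "(\<lambda>n. ennreal (\<integral>\<omega>. (zeta_nn \<omega> (N n) i - eta \<omega> (N n) i)\<^sup>2 \<partial>Q (N n))) \<longlonglongrightarrow> ennreal 0"
    by (simp add: nn_integral_eq_integral[OF int])
  then show "(\<lambda>n. \<integral>\<omega>. (zeta_nn \<omega> (N n) i - eta \<omega> (N n) i)\<^sup>2 \<partial>Q (N n)) \<longlonglongrightarrow> 0"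
    by (subst (asm) tendsto_ennreal_iff) auto
qed

lemma zeta_moments_limit:
  shows "integrable Zspace Z" "integrable Zspace (\<lambda>p. (Z p)\<^sup>2)"
    and "(\<lambda>N. \<integral>\<omega>. (zeta_nn \<omega> N 1)\<^sup>2 \<partial>Q N) \<longlonglongrightarrow> (\<integral>p. (Z p)\<^sup>2 \<partial>Zspace)"
    and "(\<lambda>N. \<integral>\<omega>. zeta_nn \<omega> N 1 * zeta_nn \<omega> N 2 \<partial>Q N) \<longlonglongrightarrow> (\<integral>p. Z p \<partial>Zspace)\<^sup>2"
proof -
  obtain N0 where N0: "\<And>N. N \<ge> N0 \<Longrightarrow> 0 \<le> thr N \<and> 2 \<le> N"
    using eventually_thr[of 0] unfolding eventually_sequentially by blast
  \<comment> \<open>The convergence lemmas require their hypotheses for every index, so the sequence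
    starts where \<open>0 \<le> thr N\<close> and \<open>2 \<le> N\<close> hold for good.\<close>
  define N where "N n = n + N0" for n
  have N2: "2 \<le> N n" and N1: "0 \<le> thr (N n)" for n using N0[of "N n"] by (auto simp: N_def)
  have Nlim: "filterlim N at_top sequentially"
    unfolding N_def by (rule filterlim_add_const_nat_at_top)
  have i: "i \<in> {1..N n}" if "i \<in> {1, 2}" for i n using that N2[of n] by auto
  have i1: "1 \<in> {1..N n}" and i2: "2 \<in> {1..N n}" for n using i by auto
  \<comment> \<open>For fixed \<open>s\<close> the threshold \<open>thr (N n)\<close> eventually
    exceeds \<open>s\<close>, and from then on truncation does not change the event.\<close>
  have marg: "(\<lambda>n. measure (Q (N n)) {\<omega>\<in>space (Q (N n)). s \<le> eta \<omega> (N n) i}) \<longlonglongrightarrow> surv s" if "i \<in> {1, 2}" for i s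
  proof (rule Lim_transform_eventually)
    show "(\<lambda>n. \<integral>x. (1 - measure P (ball x (nn_radius TYPE('a) (N n) s))) ^ (N n - 1) \<partial>P) \<longlonglongrightarrow> surv s"
      by (rule filterlim_compose[OF marginal_limit Nlim])
    show "\<forall>\<^sub>F n in sequentially. (\<integral>x. (1 - measure P (ball x (nn_radius TYPE('a) (N n) s))) ^ (N n - 1) \<partial>P) = measure (Q (N n)) {\<omega>\<in>space (Q (N n)). s \<le> eta \<omega> (N n) i}"
      using eventually_compose_filterlim[OF eventually_thr[of s] Nlim]
    proof eventually_elim
      case (elim n)
      then have "{\<omega>\<in>space (Q (N n)). s \<le> eta \<omega> (N n) i} = {\<omega>\<in>space (Q (N n)). s \<le> zeta_nn \<omega> (N n) i}"
        by (auto simp: eta_def)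
      then show ?case by (simp only: prob_marginal[OF N2 i[OF that]])
    qed
  qed
  have ne12: "(1::nat) \<noteq> 2" by simp
  have joint: "(\<lambda>n. measure (Q (N n)) {\<omega>\<in>space (Q (N n)). s \<le> eta \<omega> (N n) 1 \<and> t \<le> eta \<omega> (N n) 2}) \<longlonglongrightarrow> surv s * surv t" for s t
  proof (rule Lim_transform_eventually[OF filterlim_compose[OF joint_limit[of s t] Nlim]])
    show "\<forall>\<^sub>F n in sequentially. (\<integral>x. \<integral>y. (if nn_radius TYPE('a) (N n) s \<le> dist x y \<and> nn_radius TYPE('a) (N n) t \<le> dist x y then (1 - measure P (ball x (nn_radius TYPE('a) (N n) s) \<union> ball y (nn_radius TYPE('a) (N n) t))) ^ (N n - 2) else 0) \<partial>P \<partial>P)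
      = measure (Q (N n)) {\<omega>\<in>space (Q (N n)). s \<le> eta \<omega> (N n) 1 \<and> t \<le> eta \<omega> (N n) 2}"
      using eventually_compose_filterlim[OF eventually_thr[of s] Nlim] eventually_compose_filterlim[OF eventually_thr[of t] Nlim]
    proof eventually_elim
      case (elim n)
      then have "{\<omega>\<in>space (Q (N n)). s \<le> eta \<omega> (N n) 1 \<and> t \<le> eta \<omega> (N n) 2} = {\<omega>\<in>space (Q (N n)). s \<le> zeta_nn \<omega> (N n) 1 \<and> t \<le> zeta_nn \<omega> (N n) 2}"
        by (auto simp: eta_def)
      then show ?case by (simp only: prob_joint[OF N2 i1 i2 ne12])
    qed
  qed
  \<comment> \<open>For the second moment both factors are the same variable, and the joint survival
    function is the marginal one at \<open>max s t\<close>.\<close>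
  have diag: "(\<lambda>n. measure (Q (N n)) {\<omega>\<in>space (Q (N n)). s \<le> eta \<omega> (N n) i \<and> t \<le> eta \<omega> (N n) i}) \<longlonglongrightarrow> measure Zspace {p\<in>space Zspace. s \<le> Z p \<and> t \<le> Z p}" if "i \<in> {1, 2}" for i s t
    using marg[OF that, of "max s t"] prob_Z[of "max s t"] by simp
  note tail = eta_tail[OF N2 N1]
  have margZ: "(\<lambda>n. measure (Q (N n)) {\<omega>\<in>space (Q (N n)). s \<le> eta \<omega> (N n) i}) \<longlonglongrightarrow> measure Zspace {p\<in>space Zspace. s \<le> Z p}" if "i \<in> {1, 2}" for i s
    unfolding prob_Z by (rule marg[OF that])
  have sq: "integrable Zspace (\<lambda>p. Z p * Z p)"
    "(\<lambda>n. \<integral>\<omega>. eta \<omega> (N n) i * eta \<omega> (N n) i \<partial>Q (N n)) \<longlonglongrightarrow> (\<integral>p. Z p * Z p \<partial>Zspace)" if j: "i \<in> {1, 2}" for i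
  proof -
    note * = expectation_product_LIMSEQ[where M="\<lambda>n. Q (N n)" and U="\<lambda>n \<omega>. eta \<omega> (N n) i" and W="\<lambda>n \<omega>. eta \<omega> (N n) i"
        and M'=Zspace and U'=Z and W'=Z and C=C and c=c,
        OF Q.prob_space_axioms measurable_eta[OF i[OF j]] measurable_eta[OF i[OF j]] Zsp.prob_space_axioms Z_measurable Z_measurable
          tail[OF i[OF j]] tail[OF i[OF j]] c diag[OF j] margZ[OF j] margZ[OF j]]
    show "integrable Zspace (\<lambda>p. Z p * Z p)" by (rule *(1))
    show "(\<lambda>n. \<integral>\<omega>. eta \<omega> (N n) i * eta \<omega> (N n) i \<partial>Q (N n)) \<longlonglongrightarrow> (\<integral>p. Z p * Z p \<partial>Zspace)" by (rule *(2))
  qed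
  have Z2: "integrable Zspace (\<lambda>p. Z p * Z p)" by (rule sq(1)[of 1]) simp
  then show Z2': "integrable Zspace (\<lambda>p. (Z p)\<^sup>2)" by (simp add: power2_eq_square)
  then show Z1: "integrable Zspace Z" by (rule Zsp.square_integrable_imp_integrable[OF Z_measurable])
  have eta2: "(\<lambda>n. \<integral>\<omega>. (eta \<omega> (N n) i)\<^sup>2 \<partial>Q (N n)) \<longlonglongrightarrow> (\<integral>p. (Z p)\<^sup>2 \<partial>Zspace)" if "i \<in> {1, 2}" for i
    unfolding power2_eq_square by (rule sq(2)[OF that])
  have etaint: "integrable (Q (N n)) (\<lambda>\<omega>. (eta \<omega> (N n) i)\<^sup>2)" if "i \<in> {1, 2}" for i n
    unfolding power2_eq_square
    by (rule expectation_product_hstep(1)[OF Q.prob_space_axioms measurable_eta[OF i[OF that]] measurable_eta[OF i[OF that]] tail[OF i[OF that]] tail[OF i[OF that]] c])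
  have "(\<lambda>n. \<integral>\<omega>. eta \<omega> (N n) 1 * eta \<omega> (N n) 2 \<partial>Q (N n)) \<longlonglongrightarrow> (\<integral>p. Z (fst p) * Z (snd p) \<partial>(Zspace \<Otimes>\<^sub>M Zspace))"
  proof (rule expectation_product_LIMSEQ(2)[OF Q.prob_space_axioms measurable_eta[OF i1] measurable_eta[OF i2] Z2.prob_space_axioms _ _ tail[OF i1] tail[OF i2] c])
    show "(\<lambda>p. Z (fst p)) \<in> borel_measurable (Zspace \<Otimes>\<^sub>M Zspace)" "(\<lambda>p. Z (snd p)) \<in> borel_measurable (Zspace \<Otimes>\<^sub>M Zspace)"
      by measurable
    show "(\<lambda>n. measure (Q (N n)) {\<omega>\<in>space (Q (N n)). s \<le> eta \<omega> (N n) 1 \<and> t \<le> eta \<omega> (N n) 2}) \<longlonglongrightarrow> measure (Zspace \<Otimes>\<^sub>M Zspace) {p\<in>space (Zspace \<Otimes>\<^sub>M Zspace). s \<le> Z (fst p) \<and> t \<le> Z (snd p)}" for s t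
      unfolding prob_Z_pair by (rule joint)
    show "(\<lambda>n. measure (Q (N n)) {\<omega>\<in>space (Q (N n)). s \<le> eta \<omega> (N n) 1}) \<longlonglongrightarrow> measure (Zspace \<Otimes>\<^sub>M Zspace) {p\<in>space (Zspace \<Otimes>\<^sub>M Zspace). s \<le> Z (fst p)}" for s
      unfolding prob_Z_fst by (rule marg) simp
    show "(\<lambda>n. measure (Q (N n)) {\<omega>\<in>space (Q (N n)). s \<le> eta \<omega> (N n) 2}) \<longlonglongrightarrow> measure (Zspace \<Otimes>\<^sub>M Zspace) {p\<in>space (Zspace \<Otimes>\<^sub>M Zspace). s \<le> Z (snd p)}" for s
      unfolding prob_Z_snd by (rule marg) simp
  qed
  then have eta12: "(\<lambda>n. \<integral>\<omega>. eta \<omega> (N n) 1 * eta \<omega> (N n) 2 \<partial>Q (N n)) \<longlonglongrightarrow> (\<integral>p. Z p \<partial>Zspace)\<^sup>2"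
    using Z2.product_of_integrable(2)[OF Z1 Z1] by (simp add: power2_eq_square)
  have pert: "(\<lambda>n. \<integral>\<omega>. zeta_nn \<omega> (N n) i * zeta_nn \<omega> (N n) j \<partial>Q (N n)) \<longlonglongrightarrow> l"
    if ij: "i \<in> {1, 2}" "j \<in> {1, 2}" and l: "(\<lambda>n. \<integral>\<omega>. eta \<omega> (N n) i * eta \<omega> (N n) j \<partial>Q (N n)) \<longlonglongrightarrow> l" for i j l
    by (rule expectation_mult_perturb[where M="\<lambda>n. Q (N n)" and U="\<lambda>n \<omega>. zeta_nn \<omega> (N n) i" and V="\<lambda>n \<omega>. zeta_nn \<omega> (N n) j"
          and U'="\<lambda>n \<omega>. eta \<omega> (N n) i" and V'="\<lambda>n \<omega>. eta \<omega> (N n) j",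
          OF Q.prob_space_axioms measurable_zeta[OF i[OF ij(1)]] measurable_zeta[OF i[OF ij(2)]] measurable_eta[OF i[OF ij(1)]] measurable_eta[OF i[OF ij(2)]]
          etaint[OF ij(1)] etaint[OF ij(2)] zeta_minus_eta_tendsto_0(1)[OF Nlim N2 i[OF ij(1)]] zeta_minus_eta_tendsto_0(1)[OF Nlim N2 i[OF ij(2)]]
          zeta_minus_eta_tendsto_0(2)[OF Nlim N2 i[OF ij(1)]] zeta_minus_eta_tendsto_0(2)[OF Nlim N2 i[OF ij(2)]] eta2[OF ij(1)] eta2[OF ij(2)] l])
  have "(\<lambda>n. \<integral>\<omega>. (zeta_nn \<omega> (N n) 1)\<^sup>2 \<partial>Q (N n)) \<longlonglongrightarrow> (\<integral>p. (Z p)\<^sup>2 \<partial>Zspace)"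
    unfolding power2_eq_square by (intro pert sq(2)) auto
  then show "(\<lambda>N. \<integral>\<omega>. (zeta_nn \<omega> N 1)\<^sup>2 \<partial>Q N) \<longlonglongrightarrow> (\<integral>p. (Z p)\<^sup>2 \<partial>Zspace)"
    unfolding N_def by (rule LIMSEQ_offset)
  have "(\<lambda>n. \<integral>\<omega>. zeta_nn \<omega> (N n) 1 * zeta_nn \<omega> (N n) 2 \<partial>Q (N n)) \<longlonglongrightarrow> (\<integral>p. Z p \<partial>Zspace)\<^sup>2"
    by (intro pert eta12) auto
  then show "(\<lambda>N. \<integral>\<omega>. zeta_nn \<omega> N 1 * zeta_nn \<omega> N 2 \<partial>Q N) \<longlonglongrightarrow> (\<integral>p. Z p \<partial>Zspace)\<^sup>2"
    unfolding N_def by (rule LIMSEQ_offset)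
qed

end

subsection \<open>Tail bounds from the functionals of the density\<close>

text \<open>A number in the unit interval that is at most \<open>a * m\<close> is also at most
  \<open>(a * m) powr \<epsilon>\<close> for \<open>\<epsilon> \<le> 1\<close>. The summand 1 then
  pays for raising the exponent of \<open>m\<close> from \<open>\<epsilon>\<close> to
  \<open>\<epsilon>'\<close>, so both tails can share one rate.\<close>

lemma ennreal_le_powr_bound:
  fixes h a \<epsilon> \<epsilon>' :: real
  assumes h: "0 \<le> h" "h \<le> 1" and a: "0 < a" and \<epsilon>: "0 < \<epsilon>" "\<epsilon> \<le> 1" "\<epsilon> \<le> \<epsilon>'"
    and le: "ennreal h \<le> ennreal a * m"
  shows "ennreal h \<le> ennreal (a powr \<epsilon>) * (1 + ennreal_powr m \<epsilon>')"
proof (cases m)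
  case top
  then show ?thesis using \<epsilon> a by (simp add: ennreal_powr_def ennreal_mult_top)
next
  case (real \<mu>)
  show ?thesis
  proof (cases "\<mu> = 0")
    case True
    then show ?thesis using le real h by simp
  next
    case False
    then have \<mu>: "0 < \<mu>" using real by simp
    have "h \<le> a * \<mu>" using le real a by (simp add: ennreal_mult[symmetric])
    then have "h \<le> (a * \<mu>) powr \<epsilon>"
    proof (cases "a * \<mu> \<le> 1")
      case True
      then have "(a * \<mu>) powr 1 \<le> (a * \<mu>) powr \<epsilon>" using a \<mu> \<epsilon> by (intro powr_mono') auto
      then show ?thesis using \<open>h \<le> a * \<mu>\<close> a \<mu> by simp
    next
      case False
      then have "1 \<le> (a * \<mu>) powr \<epsilon>" using \<epsilon> by (intro ge_one_powr_ge_zero) auto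
      then show ?thesis using h by linarith
    qed
    also have "(a * \<mu>) powr \<epsilon> = a powr \<epsilon> * \<mu> powr \<epsilon>" using a \<mu> by (simp add: powr_mult)
    also have "\<mu> powr \<epsilon> \<le> 1 + \<mu> powr \<epsilon>'"
    proof (cases "\<mu> \<le> 1")
      case True
      then have "\<mu> powr \<epsilon> \<le> 1" using \<epsilon> \<mu> by (intro powr_le1) auto
      then show ?thesis by (simp add: add_increasing2)
    next
      case False
      then have "\<mu> powr \<epsilon> \<le> \<mu> powr \<epsilon>'" using \<epsilon> by (intro powr_mono) auto
      then show ?thesis by simp
    qed
    finally have "h \<le> a powr \<epsilon> * (1 + \<mu> powr \<epsilon>')" by (simp add: mult_left_mono)
    moreover have "ennreal_powr m \<epsilon>' = ennreal (\<mu> powr \<epsilon>')"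
      using real \<mu> \<epsilon> by (simp add: ennreal_powr_def)
    ultimately show ?thesis
      by (simp add: ennreal_leI flip: ennreal_plus ennreal_mult ennreal_1)
  qed
qed

lemma exp_minus_le_powr:
  fixes t \<epsilon> :: real
  assumes t: "0 < t" and \<epsilon>: "0 < \<epsilon>" "\<epsilon> \<le> 1"
  shows "exp (- t) \<le> t powr (- \<epsilon>)"
proof (cases "t \<le> 1")
  case True
  then have "t powr \<epsilon> \<le> 1" using \<epsilon> t by (intro powr_le1) auto
  then have "1 \<le> t powr (- \<epsilon>)" using t by (simp add: powr_minus one_le_inverse)
  moreover have "exp (- t) \<le> 1" using t by simp
  ultimately show ?thesis by linarith
next
  case False
  have "t \<le> exp t" using exp_ge_add_one_self[of t] by linarith
  then have "exp (- t) \<le> inverse t" using t by (simp add: exp_minus le_imp_inverse_le)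
  also have "\<dots> = t powr (-1)" using t by (simp add: powr_minus)
  also have "\<dots> \<le> t powr (- \<epsilon>)" using False \<epsilon> by (intro powr_mono) auto
  finally show ?thesis .
qed

text \<open>The counterpart for negative exponents, resting on
  \<open>exp (- t) \<le> t powr (- \<epsilon>)\<close>. For \<open>m = 0\<close> the right side is
  infinite by the convention of \<open>ennreal_powr\<close>, and \<open>m = \<infinity>\<close>
  contradicts the last hypothesis.\<close>

lemma ennreal_exp_le_powr_bound:
  fixes h a y \<epsilon> \<epsilon>' :: real
  assumes h: "h \<le> exp (- y)" and y: "0 \<le> y" and a: "0 < a" and \<epsilon>: "0 < \<epsilon>" "\<epsilon> \<le> 1" "\<epsilon> \<le> \<epsilon>'"
    and le: "ennreal a * m \<le> ennreal y"
  shows "ennreal h \<le> ennreal (a powr (- \<epsilon>)) * (1 + ennreal_powr m (- \<epsilon>'))"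
proof (cases m)
  case top
  then show ?thesis using le a by (simp add: ennreal_mult_top top_unique)
next
  case (real \<mu>)
  show ?thesis
  proof (cases "\<mu> = 0")
    case True
    then show ?thesis using real \<epsilon> a by (simp add: ennreal_powr_def ennreal_mult_top)
  next
    case False
    then have \<mu>: "0 < \<mu>" using real by simp
    have "a * \<mu> \<le> y" using le real a y by (simp add: ennreal_mult[symmetric])
    then have "h \<le> exp (- (a * \<mu>))" using h by (smt (verit) exp_le_cancel_iff)
    also have "\<dots> \<le> (a * \<mu>) powr (- \<epsilon>)" using a \<mu> \<epsilon> by (intro exp_minus_le_powr) auto
    also have "\<dots> = a powr (- \<epsilon>) * \<mu> powr (- \<epsilon>)" using a \<mu> by (simp add: powr_mult)
    also have "\<mu> powr (- \<epsilon>) \<le> 1 + \<mu> powr (- \<epsilon>')"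
    proof (cases "1 \<le> \<mu>")
      case True
      then have "1 \<le> \<mu> powr \<epsilon>" using \<epsilon> by (intro ge_one_powr_ge_zero) auto
      then have "\<mu> powr (- \<epsilon>) \<le> 1" using \<mu> by (simp add: powr_minus inverse_le_1_iff)
      then show ?thesis by (simp add: add_increasing2)
    next
      case False
      then have "\<mu> powr (- \<epsilon>) \<le> \<mu> powr (- \<epsilon>')" using \<epsilon> \<mu> by (intro powr_mono') auto
      then show ?thesis by simp
    qed
    finally have "h \<le> a powr (- \<epsilon>) * (1 + \<mu> powr (- \<epsilon>'))" by (simp add: mult_left_mono)
    moreover have "ennreal_powr m (- \<epsilon>') = ennreal (\<mu> powr (- \<epsilon>'))"
      using real \<mu> \<epsilon> by (simp add: ennreal_powr_def)
    ultimately show ?thesis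
      by (simp add: ennreal_leI flip: ennreal_plus ennreal_mult ennreal_1)
  qed
qed

lemma le_ennreal_powr_plus_1:
  assumes "0 < e" shows "a \<le> 1 + ennreal_powr a (1 + e)"
proof (cases a)
  case top
  then show ?thesis using assms by (simp add: ennreal_powr_def)
next
  case (real r)
  show ?thesis
  proof (cases "r \<le> 1")
    case True
    then show ?thesis using real by (simp add: ennreal_le_1 add_increasing2)
  next
    case False
    have "r powr 1 \<le> r powr (1 + e)" using False assms by (intro powr_mono) auto
    moreover have "ennreal_powr a (1 + e) = ennreal (r powr (1 + e))"
      using real False assms by (simp add: ennreal_powr_def)
    ultimately show ?thesis using real False
      by (intro add_increasing) (auto intro: ennreal_leI)
  qed
qed

context nn_density begin

lemma nn_integral_P: "g \<in> borel_measurable borel \<Longrightarrow> (\<integral>\<^sup>+x. g x \<partial>P) = (\<integral>\<^sup>+x. g x * ennreal (f x) \<partial>lborel)"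
  unfolding P_def by (subst nn_integral_density) (auto simp: mult.commute)

text \<open>The dominating function \<open>g\<close> need not be measurable, so \<open>nn_integral_add\<close> and
  \<open>nn_integral_cmult\<close> are applied to the truncated difference instead.\<close>

lemma nn_integral_P_bound:
  assumes [measurable]: "h \<in> borel_measurable borel" and c: "0 < c"
    and le: "\<And>x. h x \<le> ennreal c * (1 + g x)"
  shows "(\<integral>\<^sup>+x. h x \<partial>P) \<le> ennreal c * (1 + (\<integral>\<^sup>+x. g x * ennreal (f x) \<partial>lborel))"
proof -
  define u where "u x = h x * ennreal (1 / c) - 1" for x
  have [measurable]: "u \<in> borel_measurable borel" unfolding u_def by measurable
  have cc: "ennreal c * ennreal (1 / c) = 1" using c by (simp add: ennreal_mult[symmetric])
  have u: "u x \<le> g x" for x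
  proof -
    have "h x * ennreal (1 / c) \<le> (ennreal c * (1 + g x)) * ennreal (1 / c)" by (intro mult_right_mono le) simp
    also have "\<dots> = 1 + g x" using cc by (simp add: mult.commute mult.left_commute mult.assoc[symmetric])
    finally show ?thesis unfolding u_def by (simp add: ennreal_minus_le_iff)
  qed
  have h: "h x \<le> ennreal c * (1 + u x)" for x
  proof -
    have "h x * ennreal (1 / c) \<le> 1 + u x" using ennreal_minus_le_iff[of "h x * ennreal (1 / c)" 1 "u x"] by (simp add: u_def)
    from mult_left_mono[OF this, of "ennreal c"] show ?thesis
      using cc by (simp add: mult.left_commute[of _ "h x"])
  qed
  have "(\<integral>\<^sup>+x. h x \<partial>P) \<le> (\<integral>\<^sup>+x. ennreal c * (1 + u x) \<partial>P)" by (intro nn_integral_mono h)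
  also have "\<dots> = ennreal c * (1 + (\<integral>\<^sup>+x. u x \<partial>P))"
    by (simp add: nn_integral_cmult nn_integral_add P.emeasure_eq_measure)
  also have "(\<integral>\<^sup>+x. u x \<partial>P) = (\<integral>\<^sup>+x. u x * ennreal (f x) \<partial>lborel)" by (rule nn_integral_P) simp
  also have "ennreal c * (1 + \<dots>) \<le> ennreal c * (1 + (\<integral>\<^sup>+x. g x * ennreal (f x) \<partial>lborel))"
    by (intro mult_left_mono add_left_mono nn_integral_mono mult_right_mono u) auto
  finally show ?thesis .
qed

lemma integral_P_bound:
  assumes m: "h \<in> borel_measurable borel" and h: "\<And>x. 0 \<le> h x" "\<And>x. h x \<le> 1" and c: "0 < c"
    and le: "\<And>x. ennreal (h x) \<le> ennreal c * (1 + g x)"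
    and fin: "(\<integral>\<^sup>+x. g x * ennreal (f x) \<partial>lborel) < \<infinity>"
  shows "(\<integral>x. h x \<partial>P) \<le> c * (1 + enn2real (\<integral>\<^sup>+x. g x * ennreal (f x) \<partial>lborel))"
proof -
  let ?G = "\<integral>\<^sup>+x. g x * ennreal (f x) \<partial>lborel"
  have G: "?G = ennreal (enn2real ?G)" using fin by (simp add: less_top)
  have "ennreal (\<integral>x. h x \<partial>P) = (\<integral>\<^sup>+x. ennreal (h x) \<partial>P)"
    using h m by (intro nn_integral_eq_integral[symmetric] integrable_P_bounded) auto
  also have "\<dots> \<le> ennreal c * (1 + ?G)"
    using m by (intro nn_integral_P_bound c le) auto
  also have "\<dots> = ennreal (c * (1 + enn2real ?G))"
    using c by (subst G) (simp flip: ennreal_plus ennreal_mult ennreal_1)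
  finally show ?thesis using c by (subst (asm) ennreal_le_iff) auto
qed

lemma emeasure_P_ball: "(\<integral>\<^sup>+y\<in>ball x r. ennreal (f y) \<partial>lborel) = ennreal (measure P (ball x r))"
  using P.emeasure_eq_measure[of "ball x r"] by (simp add: P_def emeasure_density)

text \<open>The left side is the mean number of the other points in the ball;
  \<open>exp (s - \<gamma>)\<close> is \<open>N - 1\<close> times the volume of the ball.\<close>

lemma I_fun_eq:
  assumes N: "2 \<le> N"
  shows "ennreal ((real N - 1) * measure P (ball x (nn_radius TYPE('a) N s)))
    = ennreal (exp (s - \<gamma>)) * I_fun f x (nn_radius TYPE('a) N s)"
proof -
  let ?r = "nn_radius TYPE('a) N s"
  let ?V = "?r ^ DIM('a) * unit_ball_vol (real DIM('a))"
  have V: "0 < ?V" using nn_radius_pos[OF N, of s, where 'a='a] by (simp add: unit_ball_vol_pos)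
  have "I_fun f x ?r = ennreal (measure P (ball x ?r) / ?V)"
    unfolding I_fun_def emeasure_P_ball using V by (intro divide_ennreal) auto
  moreover have "exp (s - \<gamma>) * (measure P (ball x ?r) / ?V) = (real N - 1) * measure P (ball x ?r)"
  proof -
    have gen: "v * n * (p / v) = n * p" if "v \<noteq> 0" for v n p :: real using that by simp
    show ?thesis unfolding nn_radius_power[OF N, of s, where 'a='a, symmetric] using V by (intro gen) linarith
  qed
  moreover have "ennreal (exp (s - \<gamma>)) * ennreal (measure P (ball x ?r) / ?V) = ennreal (exp (s - \<gamma>) * (measure P (ball x ?r) / ?V))"
    using less_imp_le[OF V] by (intro ennreal_mult[symmetric] divide_nonneg_nonneg) auto
  ultimately show ?thesis by (simp only:)
qed

text \<open>By Bernoulli's inequality the probability of hitting the ball is at most the mean number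
  of points in it, which is at most \<open>exp (s - \<gamma>)\<close> times \<open>M_fun\<close>.
  Raising to the power \<open>\<epsilon>\<close> produces the exponential in
  \<open>s\<close>.\<close>

lemma lower_tail:
  assumes N: "2 \<le> N" and r: "nn_radius TYPE('a) N s \<le> R1" and \<epsilon>: "0 < \<epsilon>" "\<epsilon> \<le> 1" "\<epsilon> \<le> \<epsilon>1"
    and fin: "Q_fun f \<epsilon>1 R1 < \<infinity>"
  shows "(\<integral>x. 1 - (1 - measure P (ball x (nn_radius TYPE('a) N s))) ^ (N - 1) \<partial>P)
    \<le> exp (\<epsilon> * (s - \<gamma>)) * (1 + enn2real (Q_fun f \<epsilon>1 R1))"
  unfolding Q_fun_def
proof (rule integral_P_bound)
  let ?r = "nn_radius TYPE('a) N s"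
  fix x
  let ?p = "measure P (ball x ?r)"
  show 0: "0 \<le> 1 - (1 - ?p) ^ (N - 1)" "1 - (1 - ?p) ^ (N - 1) \<le> 1" by (simp_all add: power_le_one)
  have "1 + real (N - 1) * (- ?p) \<le> (1 + (- ?p)) ^ (N - 1)" by (rule Bernoulli_inequality) simp
  then have "1 - (1 - ?p) ^ (N - 1) \<le> (real N - 1) * ?p" using N by (simp add: of_nat_diff)
  then have "ennreal (1 - (1 - ?p) ^ (N - 1)) \<le> ennreal (exp (s - \<gamma>)) * I_fun f x ?r"
    unfolding I_fun_eq[OF N, symmetric] by (rule ennreal_leI)
  also have "\<dots> \<le> ennreal (exp (s - \<gamma>)) * M_fun f x R1"
    unfolding M_fun_def using r nn_radius_pos[OF N, of s, where 'a='a] by (intro mult_left_mono SUP_upper) auto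
  finally have "ennreal (1 - (1 - ?p) ^ (N - 1)) \<le> ennreal (exp (s - \<gamma>)) * M_fun f x R1" .
  from ennreal_le_powr_bound[OF 0 _ \<epsilon> this]
  show "ennreal (1 - (1 - ?p) ^ (N - 1)) \<le> ennreal (exp (\<epsilon> * (s - \<gamma>))) * (1 + ennreal_powr (M_fun f x R1) \<epsilon>1)"
    by (simp add: powr_def)
qed (use fin in \<open>auto simp: Q_fun_def\<close>)

text \<open>From \<open>1 - p \<le> exp (- p)\<close>, the probability of missing the ball is at
  most \<open>exp\<close> of minus the mean number of points, and this mean is at least
  \<open>exp (s - \<gamma>)\<close> times \<open>m_fun\<close>.\<close>

lemma upper_tail:
  assumes N: "2 \<le> N" and r: "nn_radius TYPE('a) N s \<le> R2" and \<epsilon>: "0 < \<epsilon>" "\<epsilon> \<le> 1" "\<epsilon> \<le> \<epsilon>2"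
    and fin: "T_fun f \<epsilon>2 R2 < \<infinity>"
  shows "(\<integral>x. (1 - measure P (ball x (nn_radius TYPE('a) N s))) ^ (N - 1) \<partial>P)
    \<le> exp (- \<epsilon> * (s - \<gamma>)) * (1 + enn2real (T_fun f \<epsilon>2 R2))"
  unfolding T_fun_def
proof (rule integral_P_bound)
  let ?r = "nn_radius TYPE('a) N s"
  fix x
  let ?p = "measure P (ball x ?r)"
  show 0: "0 \<le> (1 - ?p) ^ (N - 1)" "(1 - ?p) ^ (N - 1) \<le> 1" by (simp_all add: power_le_one)
  have "(1 - ?p) ^ (N - 1) \<le> exp (- ?p) ^ (N - 1)"
    using exp_ge_add_one_self[of "- ?p"] by (intro power_mono) (auto simp del: exp_ge_add_one_self)
  also have "\<dots> = exp (- ((real N - 1) * ?p))" using N by (simp add: exp_of_nat_mult[symmetric] of_nat_diff)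
  finally have 1: "(1 - ?p) ^ (N - 1) \<le> exp (- ((real N - 1) * ?p))" .
  have "m_fun f x R2 \<le> I_fun f x ?r"
    unfolding m_fun_def using r nn_radius_pos[OF N, of s, where 'a='a] by (intro INF_lower) auto
  then have 2: "ennreal (exp (s - \<gamma>)) * m_fun f x R2 \<le> ennreal ((real N - 1) * ?p)"
    unfolding I_fun_eq[OF N] by (intro mult_left_mono) auto
  have "ennreal ((1 - ?p) ^ (N - 1)) \<le> ennreal (exp (s - \<gamma>) powr (- \<epsilon>)) * (1 + ennreal_powr (m_fun f x R2) (- \<epsilon>2))"
    by (rule ennreal_exp_le_powr_bound[OF 1 _ _ \<epsilon> 2]) (use N in auto)
  then show "ennreal ((1 - ?p) ^ (N - 1)) \<le> ennreal (exp (- \<epsilon> * (s - \<gamma>))) * (1 + ennreal_powr (m_fun f x R2) (- \<epsilon>2))"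
    by (simp add: powr_def)
qed (use fin in \<open>auto simp: T_fun_def\<close>)

text \<open>Up to an additive constant, \<open>G_fun\<close> dominates its argument and the power
  \<open>1 + e\<close> dominates the inner integral. The removed point \<open>x\<close> in
  \<open>K_fun\<close> is a null set.\<close>

lemma log_dist_finite:
  assumes e: "0 < e" and fin: "K_fun f 2 e < \<infinity>"
  shows "(\<integral>\<^sup>+x. \<integral>\<^sup>+y. ennreal ((ln (dist x y))\<^sup>2) \<partial>P \<partial>P) < \<infinity>"
proof -
  define A where "A x = (\<integral>\<^sup>+y. ennreal (G_fun ((ln (dist x y))\<^sup>2)) \<partial>P)" for x
  have Gm [measurable]: "G_fun \<in> borel_measurable borel" unfolding G_fun_def by measurable
  have "(\<lambda>p. ennreal (G_fun ((ln (dist (fst p) (snd p :: 'a)))\<^sup>2))) \<in> borel_measurable (P \<Otimes>\<^sub>M P)" by measurable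
  from P.borel_measurable_nn_integral_fst[OF this] have [measurable]: "A \<in> borel_measurable borel"
    by (simp add: A_def[abs_def] cong: measurable_cong_sets)
  \<comment> \<open>The constant is \<open>exp 1\<close> because \<open>ln t \<ge> 1\<close> beyond
    it.\<close>
  have G: "t \<le> exp 1 + G_fun t" if "0 \<le> t" for t
  proof (cases "t \<le> exp 1")
    case True
    have "0 \<le> G_fun t" using that by (auto simp: G_fun_def)
    then show ?thesis using True by linarith
  next
    case False
    have e1: "1 < exp (1::real)" by simp
    have "0 < t" using False e1 by linarith
    then have "1 \<le> ln t" using False by (subst ln_ge_iff) auto
    then have "t * 1 \<le> t * ln t" using that by (intro mult_left_mono) auto
    moreover have "\<not> t < 1" using False e1 by linarith
    then have "G_fun t = t * ln t" by (simp add: G_fun_def)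
    moreover have "0 < exp (1::real)" by simp
    ultimately show ?thesis by linarith
  qed
  have K: "K_fun f 2 e = (\<integral>\<^sup>+x. ennreal_powr (A x) (1 + e) * ennreal (f x) \<partial>lborel)"
    unfolding K_fun_def
  proof (intro nn_integral_cong arg_cong2[where f="(*)"] arg_cong2[where f=ennreal_powr] refl)
    fix x
    have "A x = (\<integral>\<^sup>+y. ennreal (G_fun ((ln (dist x y))\<^sup>2)) * ennreal (f y) \<partial>lborel)"
      unfolding A_def by (rule nn_integral_P) measurable
    also have "\<dots> = (\<integral>\<^sup>+y\<in>UNIV - {x}. ennreal (G_fun \<bar>(ln (dist x y)) ^ 2\<bar>) * ennreal (f y) \<partial>lborel)"
    proof (rule nn_integral_cong_AE)
      show "AE y in lborel. ennreal (G_fun ((ln (dist x y))\<^sup>2)) * ennreal (f y) = ennreal (G_fun \<bar>(ln (dist x y)) ^ 2\<bar>) * ennreal (f y) * indicator (UNIV - {x}) y"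
        using AE_lborel_singleton[of x] by eventually_elim simp
    qed
    finally show "(\<integral>\<^sup>+y\<in>UNIV - {x}. ennreal (G_fun \<bar>(ln (dist x y)) ^ 2\<bar>) * ennreal (f y) \<partial>lborel) = A x" by simp
  qed
  have "(\<integral>\<^sup>+x. A x \<partial>P) \<le> ennreal 1 * (1 + (\<integral>\<^sup>+x. ennreal_powr (A x) (1 + e) * ennreal (f x) \<partial>lborel))"
    by (rule nn_integral_P_bound) (auto intro: le_ennreal_powr_plus_1 e)
  also have "\<dots> < \<infinity>" using fin unfolding K by (simp add: less_top)
  finally have A: "(\<integral>\<^sup>+x. A x \<partial>P) < \<infinity>" .
  have "(\<integral>\<^sup>+x. \<integral>\<^sup>+y. ennreal ((ln (dist x y))\<^sup>2) \<partial>P \<partial>P) \<le> (\<integral>\<^sup>+x. \<integral>\<^sup>+y. ennreal (exp 1) + ennreal (G_fun ((ln (dist x y))\<^sup>2)) \<partial>P \<partial>P)"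
  proof (intro nn_integral_mono)
    fix x y
    have "ennreal ((ln (dist x y))\<^sup>2) \<le> ennreal (exp 1 + G_fun ((ln (dist x y))\<^sup>2))" by (intro ennreal_leI G) simp
    also have "\<dots> = ennreal (exp 1) + ennreal (G_fun ((ln (dist x y))\<^sup>2))" by (intro ennreal_plus) (auto simp: G_fun_def)
    finally show "ennreal ((ln (dist x y))\<^sup>2) \<le> ennreal (exp 1) + ennreal (G_fun ((ln (dist x y))\<^sup>2))" .
  qed
  also have "\<dots> = (\<integral>\<^sup>+x. ennreal (exp 1) + A x \<partial>P)"
    unfolding A_def by (intro nn_integral_cong, subst nn_integral_add) (auto simp: P.emeasure_eq_measure)
  also have "\<dots> = ennreal (exp 1) + (\<integral>\<^sup>+x. A x \<partial>P)"
    by (subst nn_integral_add) (auto simp: P.emeasure_eq_measure)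
  also have "\<dots> < \<infinity>" using A by simp
  finally show ?thesis .
qed

lemma nn_density_tails_intro:
  assumes pos: "0 < e0" "0 < e1" "0 < e2" "0 < R1" "0 < R2"
    and K: "K_fun f 2 e0 < \<infinity>" and Q: "Q_fun f e1 R1 < \<infinity>" and T: "T_fun f e2 R2 < \<infinity>"
  shows "\<exists>\<rho> C c. nn_density_tails f \<rho> C c"
proof -
  \<comment> \<open>The common rate of both tails: at most 1 for the power bounds, and at most each
    of the two given exponents.\<close>
  define \<epsilon> where "\<epsilon> = min 1 (min e1 e2)"
  have \<epsilon>: "0 < \<epsilon>" "\<epsilon> \<le> 1" "\<epsilon> \<le> e1" "\<epsilon> \<le> e2" using pos by (auto simp: \<epsilon>_def)
  \<comment> \<open>The factors \<open>exp (- \<epsilon> * \<gamma>)\<close> and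
    \<open>exp (\<epsilon> * \<gamma>)\<close> come from replacing \<open>s - \<gamma>\<close> by
    \<open>s\<close> in the two tail bounds.\<close>
  define q t where "q = exp (- \<epsilon> * \<gamma>) * (1 + enn2real (Q_fun f e1 R1))" and "t = exp (\<epsilon> * \<gamma>) * (1 + enn2real (T_fun f e2 R2))"
  have "nn_density_tails f (min R1 R2) (max q t) \<epsilon>"
  proof (unfold_locales)
    show "(\<integral>\<^sup>+x. \<integral>\<^sup>+y. ennreal ((ln (dist x y))\<^sup>2) \<partial>P \<partial>P) < \<infinity>" by (rule log_dist_finite[OF pos(1) K])
    show "0 < min R1 R2" "0 < \<epsilon>" using pos \<epsilon> by auto
    show "0 \<le> max q t" by (simp add: q_def le_max_iff_disj)
    fix N :: nat and s :: real assume N: "2 \<le> N" "nn_radius TYPE('a) N s \<le> min R1 R2"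
    then have r: "nn_radius TYPE('a) N s \<le> R1" "nn_radius TYPE('a) N s \<le> R2" by auto
    have "(\<integral>x. 1 - (1 - measure P (ball x (nn_radius TYPE('a) N s))) ^ (N - 1) \<partial>P) \<le> exp (\<epsilon> * (s - \<gamma>)) * (1 + enn2real (Q_fun f e1 R1))"
      by (rule lower_tail[OF N(1) r(1) \<epsilon>(1-3) Q])
    also have "exp (\<epsilon> * (s - \<gamma>)) = exp (- \<epsilon> * \<gamma>) * exp (\<epsilon> * s)" by (simp add: exp_add[symmetric] algebra_simps)
    also have "exp (- \<epsilon> * \<gamma>) * exp (\<epsilon> * s) * (1 + enn2real (Q_fun f e1 R1)) = q * exp (\<epsilon> * s)" by (simp add: q_def)
    also have "\<dots> \<le> max q t * exp (\<epsilon> * s)" by (intro mult_right_mono) auto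
    finally show "(\<integral>x. 1 - (1 - measure P (ball x (nn_radius TYPE('a) N s))) ^ (N - 1) \<partial>P) \<le> max q t * exp (\<epsilon> * s)" .
    have "(\<integral>x. (1 - measure P (ball x (nn_radius TYPE('a) N s))) ^ (N - 1) \<partial>P) \<le> exp (- \<epsilon> * (s - \<gamma>)) * (1 + enn2real (T_fun f e2 R2))"
      by (rule upper_tail[OF N(1) r(2) \<epsilon>(1,2,4) T])
    also have "exp (- \<epsilon> * (s - \<gamma>)) = exp (\<epsilon> * \<gamma>) * exp (- \<epsilon> * s)" by (simp add: exp_add[symmetric] algebra_simps)
    also have "exp (\<epsilon> * \<gamma>) * exp (- \<epsilon> * s) * (1 + enn2real (T_fun f e2 R2)) = t * exp (- \<epsilon> * s)" by (simp add: t_def)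
    also have "\<dots> \<le> max q t * exp (- \<epsilon> * s)" by (intro mult_right_mono) auto
    finally show "(\<integral>x. (1 - measure P (ball x (nn_radius TYPE('a) N s))) ^ (N - 1) \<partial>P) \<le> max q t * exp (- \<epsilon> * s)" .
  qed
  then show ?thesis by blast
qed

end

subsection \<open>The varentropy of the density\<close>

context nn_density begin

lemma prob_exp1_UNIV [simp]: "measure exp1 UNIV = 1" using E.prob_space by simp

lemma integral_fst_Zspace:
  assumes [measurable]: "g \<in> borel_measurable borel" and i: "integrable Zspace (\<lambda>p. g (fst p) :: real)"
  shows "integrable P g" "(\<integral>p. g (fst p) \<partial>Zspace) = (\<integral>x. g x \<partial>P)"
proof -
  show "integrable P g" using PE.integrable_fst'[OF i[unfolded Zspace_def]] by simp
  show "(\<integral>p. g (fst p) \<partial>Zspace) = (\<integral>x. g x \<partial>P)"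
    unfolding Zspace_def using PE.integral_fst'[OF i[unfolded Zspace_def]] by simp
qed

text \<open>Square-integrability of \<open>ln (f X)\<close> is deduced from that of
  \<open>Z\<close>, since the two differ by the square-integrable \<open>?Y\<close>, up to sign. As
  \<open>?Y\<close> is centered and independent of \<open>X\<close>, the cross term in the second
  moment vanishes.\<close>

lemma ln_density_moments:
  assumes Z2: "integrable Zspace (\<lambda>p. (Z p)\<^sup>2)"
  shows "integrable P (\<lambda>x. ln (f x))" "integrable P (\<lambda>x. (ln (f x))\<^sup>2)"
    and "(\<integral>p. Z p \<partial>Zspace) = - (\<integral>x. ln (f x) \<partial>P)"
    and "(\<integral>p. (Z p)\<^sup>2 \<partial>Zspace) = (\<integral>x. (ln (f x))\<^sup>2 \<partial>P) + pi\<^sup>2 / 6"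
proof -
  let ?Y = "\<lambda>t. \<gamma> + ln t"
  have Y1: "integrable exp1 ?Y" using ln_exponential_moments(1) by simp
  have Y2: "integrable exp1 (\<lambda>t. (?Y t)\<^sup>2)"
    using ln_exponential_moments(1,2) by (simp add: power2_sum)
  have EY: "(\<integral>t. ?Y t \<partial>exp1) = 0"
    using ln_exponential_moments(1,3) by (simp add: E.prob_space)
  have EY2: "(\<integral>t. (?Y t)\<^sup>2 \<partial>exp1) = pi\<^sup>2 / 6"
  proof -
    have "(\<integral>t. (?Y t)\<^sup>2 \<partial>exp1) = (\<integral>t. \<gamma>\<^sup>2 + 2 * \<gamma> * ln t + (ln t)\<^sup>2 \<partial>exp1)"
      by (simp add: power2_sum add_ac)
    also have "\<dots> = \<gamma>\<^sup>2 + 2 * \<gamma> * (- \<gamma>) + (\<gamma>\<^sup>2 + pi\<^sup>2 / 6)"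
      using ln_exponential_moments by simp
    finally show ?thesis by (simp add: power2_eq_square)
  qed
  have one: "integrable P (\<lambda>_. 1::real)" by simp
  have Y2Z: "integrable Zspace (\<lambda>p. (?Y (snd p))\<^sup>2)"
    using PE.product_of_integrable(1)[OF one Y2] by (simp add: Zspace_def)
  have [measurable]: "(\<lambda>p. ln (f (fst p))) \<in> borel_measurable Zspace"
    unfolding Zspace_def by measurable
  have "integrable Zspace (\<lambda>p. (ln (f (fst p)))\<^sup>2)"
  proof (rule Bochner_Integration.integrable_bound)
    show "integrable Zspace (\<lambda>p. 2 * (?Y (snd p))\<^sup>2 + 2 * (Z p)\<^sup>2)"
      using Y2Z Z2 by (intro Bochner_Integration.integrable_add integrable_mult_right)
    have "(l)\<^sup>2 \<le> 2 * y\<^sup>2 + 2 * (y - l)\<^sup>2" for l y :: real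
      using sum_squares_ge_zero[of "2 * y - l" 0] by (simp add: power2_eq_square algebra_simps)
    then show "AE p in Zspace. norm ((ln (f (fst p)))\<^sup>2) \<le> norm (2 * (?Y (snd p))\<^sup>2 + 2 * (Z p)\<^sup>2)"
      by (intro AE_I2) (simp add: Z_def algebra_simps)
  qed measurable
  from integral_fst_Zspace[OF _ this] show l2: "integrable P (\<lambda>x. (ln (f x))\<^sup>2)" by simp
  then show l1: "integrable P (\<lambda>x. ln (f x))" by (rule P.square_integrable_imp_integrable[rotated]) simp
  have iZ: "integrable Zspace (\<lambda>p. ln (f (fst p)))" "integrable Zspace (\<lambda>p. ?Y (snd p))"
    "integrable Zspace (\<lambda>p. ln (f (fst p)) * ?Y (snd p))" "integrable Zspace (\<lambda>p. (ln (f (fst p)))\<^sup>2)"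
    and eZ: "(\<integral>p. ln (f (fst p)) \<partial>Zspace) = (\<integral>x. ln (f x) \<partial>P)" "(\<integral>p. ?Y (snd p) \<partial>Zspace) = 0"
    "(\<integral>p. ln (f (fst p)) * ?Y (snd p) \<partial>Zspace) = 0" "(\<integral>p. (ln (f (fst p)))\<^sup>2 \<partial>Zspace) = (\<integral>x. (ln (f x))\<^sup>2 \<partial>P)"
    "(\<integral>p. (?Y (snd p))\<^sup>2 \<partial>Zspace) = pi\<^sup>2 / 6"
  proof -
    have oneE: "integrable exp1 (\<lambda>_. 1::real)" by simp
    note a = PE.product_of_integrable[OF l1 oneE] and b = PE.product_of_integrable[OF one Y1]
      and c = PE.product_of_integrable[OF l1 Y1] and d = PE.product_of_integrable[OF l2 oneE] and e = PE.product_of_integrable[OF one Y2]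
    show "integrable Zspace (\<lambda>p. ln (f (fst p)))" "(\<integral>p. ln (f (fst p)) \<partial>Zspace) = (\<integral>x. ln (f x) \<partial>P)"
      using a by (simp_all add: Zspace_def E.prob_space)
    show "integrable Zspace (\<lambda>p. ?Y (snd p))" "(\<integral>p. ?Y (snd p) \<partial>Zspace) = 0"
      using b unfolding EY by (simp_all only: Zspace_def mult_1 mult_zero_right)
    show "integrable Zspace (\<lambda>p. ln (f (fst p)) * ?Y (snd p))" "(\<integral>p. ln (f (fst p)) * ?Y (snd p) \<partial>Zspace) = 0"
      using c unfolding EY by (simp_all only: Zspace_def mult_zero_right)
    show "integrable Zspace (\<lambda>p. (ln (f (fst p)))\<^sup>2)" "(\<integral>p. (ln (f (fst p)))\<^sup>2 \<partial>Zspace) = (\<integral>x. (ln (f x))\<^sup>2 \<partial>P)"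
      using d by (simp_all add: Zspace_def E.prob_space)
    show "(\<integral>p. (?Y (snd p))\<^sup>2 \<partial>Zspace) = pi\<^sup>2 / 6"
      using e unfolding EY2 by (simp add: Zspace_def)
  qed
  have "(\<integral>p. Z p \<partial>Zspace) = (\<integral>p. ?Y (snd p) - ln (f (fst p)) \<partial>Zspace)"
    by (intro Bochner_Integration.integral_cong) (auto simp: Z_def)
  also have "\<dots> = - (\<integral>x. ln (f x) \<partial>P)"
    by (simp only: Bochner_Integration.integral_diff[OF iZ(2,1)] eZ)
  finally show "(\<integral>p. Z p \<partial>Zspace) = - (\<integral>x. ln (f x) \<partial>P)" .
  have "(\<integral>p. (Z p)\<^sup>2 \<partial>Zspace) = (\<integral>p. (ln (f (fst p)))\<^sup>2 + (?Y (snd p))\<^sup>2 - 2 * (ln (f (fst p)) * ?Y (snd p)) \<partial>Zspace)"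
    by (intro Bochner_Integration.integral_cong) (auto simp: Z_def power2_eq_square algebra_simps)
  also have "\<dots> = (\<integral>x. (ln (f x))\<^sup>2 \<partial>P) + pi\<^sup>2 / 6 - 2 * 0"
    by (simp only: Bochner_Integration.integral_diff Bochner_Integration.integral_add Bochner_Integration.integrable_add
        integrable_mult_right integral_mult_right_zero iZ Y2Z eZ)
  finally show "(\<integral>p. (Z p)\<^sup>2 \<partial>Zspace) = (\<integral>x. (ln (f x))\<^sup>2 \<partial>P) + pi\<^sup>2 / 6" by simp
qed

lemma integral_P_positivity_set:
  assumes [measurable]: "g \<in> borel_measurable borel" and i: "integrable P (g :: 'a \<Rightarrow> real)"
  shows "set_integrable lborel (positivity_set f) (\<lambda>x. f x * g x)"
    and "(LINT x:positivity_set f|lborel. f x * g x) = (\<integral>x. g x \<partial>P)"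
proof -
  have eq: "indicator (positivity_set f) x *\<^sub>R (f x * g x) = f x *\<^sub>R g x" for x
    using f_nn[of x] by (auto simp: positivity_set_def indicator_def)
  show "set_integrable lborel (positivity_set f) (\<lambda>x. f x * g x)"
    using i f_nn unfolding P_def set_integrable_def eq by (subst (asm) integrable_density) auto
  show "(LINT x:positivity_set f|lborel. f x * g x) = (\<integral>x. g x \<partial>P)"
    using f_nn unfolding P_def set_lebesgue_integral_def eq by (subst integral_density) auto
qed

lemma varentropy_eq:
  assumes "integrable P (\<lambda>x. ln (f x))" "integrable P (\<lambda>x. (ln (f x))\<^sup>2)"
  shows "varentropy f = (\<integral>x. (ln (f x))\<^sup>2 \<partial>P) - (\<integral>x. ln (f x) \<partial>P)\<^sup>2"
  unfolding varentropy_def using integral_P_positivity_set(2)[OF _ assms(1)] integral_P_positivity_set(2)[OF _ assms(2)] by simp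

section \<open>Exchangeability of the sample\<close>

lemma zeta_nn_permute:
  assumes p: "p permutes {1..N}" and i: "i \<in> {1..N}"
  shows "zeta_nn (\<lambda>n\<in>{1..N}. \<omega> (p n)) N i = zeta_nn (\<omega> :: nat \<Rightarrow> 'a) N (p i)"
proof -
  have "p ` ({1..N} - {i}) = {1..N} - {p i}"
    using permutes_image[OF p] permutes_inj[OF p] by (auto simp: inj_image_mem_iff image_set_diff)
  then have "(\<lambda>j. dist (\<omega> (p i)) (\<omega> j)) ` ({1..N} - {p i}) = (\<lambda>j. dist (\<omega> (p i)) (\<omega> (p j))) ` ({1..N} - {i})"
    by (metis image_image)
  also have "\<dots> = (\<lambda>j. dist ((\<lambda>n\<in>{1..N}. \<omega> (p n)) i) ((\<lambda>n\<in>{1..N}. \<omega> (p n)) j)) ` ({1..N} - {i})"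
    using i by (intro image_cong) auto
  finally show ?thesis unfolding zeta_nn_def nn_dist_def by simp
qed

text \<open>Restricting to \<open>{1..N}\<close> keeps the permuted sample in the extensional
  product space.\<close>

lemma distr_Q_permute:
  assumes p: "p permutes {1..N}"
  shows "distr (Q N) (Q N) (\<lambda>\<omega>. \<lambda>n\<in>{1..N}. \<omega> (p n)) = Q N"
  unfolding Q_def using permutes_inj_on[OF p] permutes_in_image[OF p]
  by (intro distr_PiM_reindex P.prob_space_axioms) auto

lemma measurable_Q_permute:
  assumes p: "p permutes {1..N}"
  shows "(\<lambda>\<omega>. \<lambda>n\<in>{1..N}. \<omega> (p n)) \<in> measurable (Q N) (Q N)"
  unfolding Q_def
proof (rule measurable_restrict)
  fix n assume "n \<in> {1..N}"
  then have "p n \<in> {1..N}" using permutes_in_image[OF p] by blast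
  then show "(\<lambda>\<omega>. \<omega> (p n)) \<in> measurable (PiM {1..N} (\<lambda>_. P)) P" by (rule measurable_component_singleton)
qed

lemma expectation_zeta_permute:
  assumes p: "p permutes {1..N}" and i: "i \<in> {1..N}" and j: "j \<in> {1..N}"
  shows "(\<integral>\<omega>. zeta_nn \<omega> N (p i) * zeta_nn \<omega> N (p j) \<partial>Q N) = (\<integral>\<omega>. zeta_nn \<omega> N i * zeta_nn \<omega> N j \<partial>Q N)"
proof -
  have m: "(\<lambda>\<omega>. zeta_nn \<omega> N i * zeta_nn \<omega> N j) \<in> borel_measurable (Q N)"
    by (intro borel_measurable_times measurable_zeta i j)
  have "(\<integral>\<omega>. zeta_nn \<omega> N i * zeta_nn \<omega> N j \<partial>Q N)
      = (\<integral>\<omega>. zeta_nn \<omega> N i * zeta_nn \<omega> N j \<partial>distr (Q N) (Q N) (\<lambda>\<omega>. \<lambda>n\<in>{1..N}. \<omega> (p n)))"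
    by (simp only: distr_Q_permute[OF p])
  also have "\<dots> = (\<integral>\<omega>. zeta_nn \<omega> N (p i) * zeta_nn \<omega> N (p j) \<partial>Q N)"
    by (subst integral_distr[OF measurable_Q_permute[OF p] m]) (simp only: zeta_nn_permute[OF p i] zeta_nn_permute[OF p j])
  finally show ?thesis by simp
qed

lemma expectation_zeta_sq:
  assumes "i \<in> {1..N}"
  shows "(\<integral>\<omega>. (zeta_nn \<omega> N i)\<^sup>2 \<partial>Q N) = (\<integral>\<omega>. (zeta_nn \<omega> N 1)\<^sup>2 \<partial>Q N)"
proof -
  have 1: "1 \<in> {1..N}" using assms by auto
  show ?thesis
    using expectation_zeta_permute[OF permutes_swap_id[OF 1 assms] 1 1] by (simp add: power2_eq_square)
qed

lemma expectation_zeta_mult: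
  assumes i: "i \<in> {1..N}" and j: "j \<in> {1..N}" and ij: "i \<noteq> j"
  shows "(\<integral>\<omega>. zeta_nn \<omega> N i * zeta_nn \<omega> N j \<partial>Q N) = (\<integral>\<omega>. zeta_nn \<omega> N 1 * zeta_nn \<omega> N 2 \<partial>Q N)"
proof -
  have 1: "1 \<in> {1..N}" and 2: "2 \<in> {1..N}" using i j ij by auto
  let ?t = "Transposition.transpose 1 i"
  have t: "?t permutes {1..N}" by (rule permutes_swap_id[OF 1 i])
  have tj: "?t j \<in> {1..N}" using permutes_in_image[OF t] j by blast
  \<comment> \<open>A permutation taking 1 to \<open>i\<close> and 2 to \<open>j\<close>. The inner
    transposition acts first and sends 2 to the preimage of \<open>j\<close> under
    \<open>?t\<close>; it fixes 1, because that preimage is not 1.\<close>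
  let ?p = "?t \<circ> Transposition.transpose 2 (?t j)"
  have p: "?p permutes {1..N}" by (intro permutes_compose permutes_swap_id 2 tj t)
  have "?t j \<noteq> 1" using ij by (auto simp: Transposition.transpose_def split: if_splits)
  then have "?p 1 = i" by (simp add: Transposition.transpose_def)
  moreover have "?p 2 = j" by simp
  ultimately show ?thesis using expectation_zeta_permute[OF p 1 2] by simp
qed

end

section \<open>The expectation of the estimator and its limit\<close>

context nn_density_tails begin

lemma integrable_zeta_mult:
  assumes N: "2 \<le> N" and i: "i \<in> {1..N}" and j: "j \<in> {1..N}"
  shows "integrable (Q N) (\<lambda>\<omega>. zeta_nn \<omega> N i * zeta_nn \<omega> N j)"
  by (rule Q.abs_expectation_mult_le(2)[OF measurable_zeta[OF i] measurable_zeta[OF j] integrable_zeta_sq[OF N i] integrable_zeta_sq[OF N j] zero_less_one])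

lemma varentropy_est_eq:
  "varentropy_est x N = (1 / real N) * (\<Sum>i=1..N. (zeta_nn x N i)\<^sup>2 - pi\<^sup>2 / 6)
    - (1 / (real N)\<^sup>2) * (\<Sum>i=1..N. \<Sum>j=1..N. zeta_nn x N i * zeta_nn x N j)"
  by (simp add: varentropy_est_def second_moment_est_def entropy_est_def power_mult_distrib power_divide sum_product[symmetric] power2_eq_square)

text \<open>In the expanded square of the average, \<open>N\<close> diagonal terms have the
  expectation of the squared statistic, and by exchangeability the \<open>N * (N - 1)\<close> others
  share that of the mixed product.\<close>

lemma expectation_varentropy_est:
  assumes N: "2 \<le> N"
  shows "integrable (Q N) (\<lambda>\<omega>. varentropy_est \<omega> N)"
    and "(\<integral>\<omega>. varentropy_est \<omega> N \<partial>Q N) = (1 - 1 / real N) * ((\<integral>\<omega>. (zeta_nn \<omega> N 1)\<^sup>2 \<partial>Q N) - (\<integral>\<omega>. zeta_nn \<omega> N 1 * zeta_nn \<omega> N 2 \<partial>Q N)) - pi\<^sup>2 / 6"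
proof -
  let ?a = "\<integral>\<omega>. (zeta_nn \<omega> N 1)\<^sup>2 \<partial>Q N" and ?b = "\<integral>\<omega>. zeta_nn \<omega> N 1 * zeta_nn \<omega> N 2 \<partial>Q N"
  have i1: "integrable (Q N) (\<lambda>\<omega>. \<Sum>i=1..N. (zeta_nn \<omega> N i)\<^sup>2 - pi\<^sup>2 / 6)"
    by (intro Bochner_Integration.integrable_sum Bochner_Integration.integrable_diff integrable_zeta_sq[OF N]) auto
  have i2: "integrable (Q N) (\<lambda>\<omega>. \<Sum>i=1..N. \<Sum>j=1..N. zeta_nn \<omega> N i * zeta_nn \<omega> N j)"
    by (intro Bochner_Integration.integrable_sum integrable_zeta_mult[OF N])
  show "integrable (Q N) (\<lambda>\<omega>. varentropy_est \<omega> N)"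
    unfolding varentropy_est_eq by (intro Bochner_Integration.integrable_diff integrable_mult_right i1 i2)
  have e1: "(\<integral>\<omega>. (\<Sum>i=1..N. (zeta_nn \<omega> N i)\<^sup>2 - pi\<^sup>2 / 6) \<partial>Q N) = real N * (?a - pi\<^sup>2 / 6)"
  proof -
    have "(\<integral>\<omega>. (\<Sum>i=1..N. (zeta_nn \<omega> N i)\<^sup>2 - pi\<^sup>2 / 6) \<partial>Q N) = (\<Sum>i=1..N. \<integral>\<omega>. (zeta_nn \<omega> N i)\<^sup>2 - pi\<^sup>2 / 6 \<partial>Q N)"
      by (intro Bochner_Integration.integral_sum Bochner_Integration.integrable_diff integrable_zeta_sq[OF N]) auto
    also have "\<dots> = (\<Sum>i=1..N. ?a - pi\<^sup>2 / 6)"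
    proof (intro sum.cong refl)
      fix i assume i: "i \<in> {1..N}"
      show "(\<integral>\<omega>. (zeta_nn \<omega> N i)\<^sup>2 - pi\<^sup>2 / 6 \<partial>Q N) = ?a - pi\<^sup>2 / 6"
        using integrable_zeta_sq[OF N i] expectation_zeta_sq[OF i] by (simp add: Q.prob_space)
    qed
    finally show ?thesis by simp
  qed
  have e2: "(\<integral>\<omega>. (\<Sum>i=1..N. \<Sum>j=1..N. zeta_nn \<omega> N i * zeta_nn \<omega> N j) \<partial>Q N) = real N * (?a + (real N - 1) * ?b)"
  proof -
    have "(\<integral>\<omega>. (\<Sum>i=1..N. \<Sum>j=1..N. zeta_nn \<omega> N i * zeta_nn \<omega> N j) \<partial>Q N) = (\<Sum>i=1..N. \<integral>\<omega>. (\<Sum>j=1..N. zeta_nn \<omega> N i * zeta_nn \<omega> N j) \<partial>Q N)"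
      by (intro Bochner_Integration.integral_sum Bochner_Integration.integrable_sum integrable_zeta_mult[OF N])
    also have "\<dots> = (\<Sum>i=1..N. ?a + (real N - 1) * ?b)"
    proof (intro sum.cong refl)
      fix i assume i: "i \<in> {1..N}"
      have "(\<integral>\<omega>. (\<Sum>j=1..N. zeta_nn \<omega> N i * zeta_nn \<omega> N j) \<partial>Q N) = (\<Sum>j=1..N. \<integral>\<omega>. zeta_nn \<omega> N i * zeta_nn \<omega> N j \<partial>Q N)"
        by (intro Bochner_Integration.integral_sum integrable_zeta_mult[OF N] i)
      also have "\<dots> = (\<integral>\<omega>. zeta_nn \<omega> N i * zeta_nn \<omega> N i \<partial>Q N) + (\<Sum>j\<in>{1..N} - {i}. \<integral>\<omega>. zeta_nn \<omega> N i * zeta_nn \<omega> N j \<partial>Q N)"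
        by (rule sum.remove[OF _ i]) simp
      also have "(\<integral>\<omega>. zeta_nn \<omega> N i * zeta_nn \<omega> N i \<partial>Q N) = ?a"
        using expectation_zeta_sq[OF i] by (simp only: power2_eq_square)
      also have "(\<Sum>j\<in>{1..N} - {i}. \<integral>\<omega>. zeta_nn \<omega> N i * zeta_nn \<omega> N j \<partial>Q N) = (\<Sum>j\<in>{1..N} - {i}. ?b)"
        by (intro sum.cong refl expectation_zeta_mult i) auto
      also have "\<dots> = (real N - 1) * ?b" using i N by (simp add: of_nat_diff)
      finally show "(\<integral>\<omega>. (\<Sum>j=1..N. zeta_nn \<omega> N i * zeta_nn \<omega> N j) \<partial>Q N) = ?a + (real N - 1) * ?b" .
    qed
    finally show ?thesis by simp
  qed
  have "(\<integral>\<omega>. varentropy_est \<omega> N \<partial>Q N) = (1 / real N) * (real N * (?a - pi\<^sup>2 / 6)) - (1 / (real N)\<^sup>2) * (real N * (?a + (real N - 1) * ?b))"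
    unfolding varentropy_est_eq
    by (subst Bochner_Integration.integral_diff) (use i1 i2 e1 e2 in \<open>auto simp del: sum_subtractf\<close>)
  also have "\<dots> = (1 - 1 / real N) * (?a - ?b) - pi\<^sup>2 / 6"
  proof -
    have "real N \<noteq> 0" using N by simp
    then show ?thesis by (simp add: field_simps power2_eq_square)
  qed
  finally show "(\<integral>\<omega>. varentropy_est \<omega> N \<partial>Q N) = (1 - 1 / real N) * (?a - ?b) - pi\<^sup>2 / 6" .
qed

lemma varentropy_est_limit: "(\<lambda>N. \<integral>\<omega>. varentropy_est \<omega> N \<partial>Q N) \<longlonglongrightarrow> varentropy f"
proof -
  note m = ln_density_moments[OF zeta_moments_limit(2)]
  have "(\<lambda>N. (1 - 1 / real N) * ((\<integral>\<omega>. (zeta_nn \<omega> N 1)\<^sup>2 \<partial>Q N) - (\<integral>\<omega>. zeta_nn \<omega> N 1 * zeta_nn \<omega> N 2 \<partial>Q N)) - pi\<^sup>2 / 6)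
    \<longlonglongrightarrow> (1 - 0) * ((\<integral>p. (Z p)\<^sup>2 \<partial>Zspace) - (\<integral>p. Z p \<partial>Zspace)\<^sup>2) - pi\<^sup>2 / 6"
    by (intro tendsto_intros zeta_moments_limit(3,4) lim_1_over_n)
  \<comment> \<open>The variance of \<open>Z\<close> exceeds the varentropy by
    \<open>pi\<^sup>2 / 6\<close>, the variance of \<open>ln E\<close>, which the estimator
    subtracts.\<close>
  also have "(1 - 0) * ((\<integral>p. (Z p)\<^sup>2 \<partial>Zspace) - (\<integral>p. Z p \<partial>Zspace)\<^sup>2) - pi\<^sup>2 / 6 = varentropy f"
    unfolding m(3,4) varentropy_eq[OF m(1,2)] by simp
  finally show ?thesis
    by (rule Lim_transform_eventually)
      (auto intro!: eventually_mono[OF eventually_ge_at_top[of 2]] simp: expectation_varentropy_est(2))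
qed

end

text \<open>The integrability claims belong to the result: a Bochner integral that does not exist
  has the value 0, so without them the limit would not speak of genuine expectations and of a
  genuine varentropy. They are asserted for \<open>N \<ge> 2\<close>, where a nearest neighbor
  exists.\<close>

theorem theorem1:
  fixes M :: "'b measure"
    and X :: "'b \<Rightarrow> 'a::euclidean_space"
    and Xs :: "nat \<Rightarrow> 'b \<Rightarrow> 'a"
    and f :: "'a \<Rightarrow> real"
    and \<epsilon>0 \<epsilon>1 \<epsilon>2 R1 R2 :: real
  assumes "prob_space M"
    and "\<And>x. 0 \<le> f x"
    and "distributed M lborel X (\<lambda>x. ennreal (f x))"
    and "prob_space.indep_vars M (\<lambda>_. borel) Xs {1..}"
    and "\<And>i. i \<ge> 1 \<Longrightarrow> distr M borel (Xs i) = distr M borel X"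
    and "\<epsilon>0 > 0" "\<epsilon>1 > 0" "\<epsilon>2 > 0" "R1 > 0" "R2 > 0"
    and "\<And>\<alpha>. \<alpha> \<in> {1, 2} \<Longrightarrow> K_fun f \<alpha> \<epsilon>0 < \<infinity>"
    and "Q_fun f \<epsilon>1 R1 < \<infinity>"
    and "T_fun f \<epsilon>2 R2 < \<infinity>"
  shows "set_integrable lborel (positivity_set f) (\<lambda>x. f x * ln (f x))
    \<and> set_integrable lborel (positivity_set f) (\<lambda>x. f x * (ln (f x))\<^sup>2)
    \<and> (\<forall>N\<ge>2. integrable M (\<lambda>\<omega>. varentropy_est (\<lambda>i. Xs i \<omega>) N))
    \<and> (\<lambda>N. \<integral>\<omega>. varentropy_est (\<lambda>i. Xs i \<omega>) N \<partial>M) \<longlonglongrightarrow> varentropy f"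
proof -
  interpret M: prob_space M by fact
  have Xm: "X \<in> measurable M borel" using distributed_measurable[OF assms(3)] by simp
  have dX: "distr M borel X = density lborel (\<lambda>x. ennreal (f x))"
    using distributed_distr_eq_density[OF assms(3)] by (metis distr_cong sets_lborel)
  have fm: "f \<in> borel_measurable borel"
  proof -
    have "(\<lambda>x. enn2real (ennreal (f x))) \<in> borel_measurable lborel"
      using distributed_borel_measurable[OF assms(3)] by measurable
    then show ?thesis using assms(2) by simp
  qed
  interpret nn_density f
    using fm assms(2) M.prob_space_distr[OF Xm] by (intro nn_density.intro) (simp_all add: dX)
  obtain \<rho> C c where tails: "nn_density_tails f \<rho> C c"
    using nn_density_tails_intro[OF assms(6-10) assms(11)[of 2] assms(12,13)] by auto
  interpret nn_density_tails f \<rho> C c by (rule tails)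
  have Xsm: "Xs i \<in> measurable M borel" if "i \<ge> 1" for i
    using assms(4) that unfolding M.indep_vars_def by auto
  \<comment> \<open>Independence and the common law make the joint law of the first \<open>N\<close>
    vectors the product measure, which reduces everything to \<open>Q N\<close>.\<close>
  have law: "distr M (Q N) (\<lambda>\<omega>. \<lambda>i\<in>{1..N}. Xs i \<omega>) = Q N" if N: "2 \<le> N" for N
  proof -
    have ind: "M.indep_vars (\<lambda>_. borel) Xs {1..N}"
      by (rule M.indep_vars_subset[OF assms(4)]) auto
    have "distr M (PiM {1..N} (\<lambda>_. borel)) (\<lambda>\<omega>. \<lambda>i\<in>{1..N}. Xs i \<omega>) = PiM {1..N} (\<lambda>i. distr M borel (Xs i))"
      using M.indep_vars_iff_distr_eq_PiM'[of "{1..N}" Xs "\<lambda>_. borel"] ind Xsm N by auto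
    also have "\<dots> = Q N"
      unfolding Q_def using assms(5) by (intro PiM_cong) (auto simp: dX P_def)
    finally have "distr M (PiM {1..N} (\<lambda>_. borel)) (\<lambda>\<omega>. \<lambda>i\<in>{1..N}. Xs i \<omega>) = Q N" .
    moreover have "sets (PiM {1..N} (\<lambda>_. borel)) = sets (Q N)"
      unfolding Q_def by (intro sets_PiM_cong) auto
    ultimately show ?thesis by (metis distr_cong)
  qed
  have meas: "(\<lambda>\<omega>. \<lambda>i\<in>{1..N}. Xs i \<omega>) \<in> measurable M (Q N)" for N
    unfolding Q_def by (rule measurable_restrict) (use Xsm in \<open>auto cong: measurable_cong_sets\<close>)
  \<comment> \<open>The estimator reads only the coordinates \<open>1..N\<close>, so the restriction
    required by the product space does not affect it.\<close>
  have est: "varentropy_est (\<lambda>i\<in>{1..N}. Xs i \<omega>) N = varentropy_est (\<lambda>i. Xs i \<omega>) N" for N \<omega>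
  proof -
    have "zeta_nn (\<lambda>i\<in>{1..N}. Xs i \<omega>) N i = zeta_nn (\<lambda>i. Xs i \<omega>) N i" if "i \<in> {1..N}" for i
    proof -
      have "(\<lambda>j. dist ((\<lambda>i\<in>{1..N}. Xs i \<omega>) i) ((\<lambda>i\<in>{1..N}. Xs i \<omega>) j)) ` ({1..N} - {i}) = (\<lambda>j. dist (Xs i \<omega>) (Xs j \<omega>)) ` ({1..N} - {i})"
        using that by (intro image_cong) auto
      then show ?thesis by (simp only: zeta_nn_def nn_dist_def)
    qed
    then show ?thesis by (simp add: varentropy_est_def second_moment_est_def entropy_est_def)
  qed
  have transfer: "integrable M (\<lambda>\<omega>. varentropy_est (\<lambda>i. Xs i \<omega>) N)"
    "(\<integral>\<omega>. varentropy_est (\<lambda>i. Xs i \<omega>) N \<partial>M) = (\<integral>\<omega>. varentropy_est \<omega> N \<partial>Q N)" if N: "2 \<le> N" for N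
  proof -
    have i: "integrable (distr M (Q N) (\<lambda>\<omega>. \<lambda>i\<in>{1..N}. Xs i \<omega>)) (\<lambda>\<omega>. varentropy_est \<omega> N)"
      unfolding law[OF N] by (rule expectation_varentropy_est(1)[OF N])
    from integrable_distr[OF meas this] show "integrable M (\<lambda>\<omega>. varentropy_est (\<lambda>i. Xs i \<omega>) N)"
      by (simp only: est)
    have m: "(\<lambda>\<omega>. varentropy_est \<omega> N) \<in> borel_measurable (Q N)"
      using expectation_varentropy_est(1)[OF N] by simp
    show "(\<integral>\<omega>. varentropy_est (\<lambda>i. Xs i \<omega>) N \<partial>M) = (\<integral>\<omega>. varentropy_est \<omega> N \<partial>Q N)"
      using integral_distr[OF meas m] unfolding law[OF N] est by simp
  qed
  note l = ln_density_moments(1,2)[OF zeta_moments_limit(2)]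
  have "set_integrable lborel (positivity_set f) (\<lambda>x. f x * ln (f x))"
    by (rule integral_P_positivity_set(1)[OF _ l(1)]) simp
  moreover have "set_integrable lborel (positivity_set f) (\<lambda>x. f x * (ln (f x))\<^sup>2)"
    by (rule integral_P_positivity_set(1)[OF _ l(2)]) simp
  moreover have "(\<lambda>N. \<integral>\<omega>. varentropy_est (\<lambda>i. Xs i \<omega>) N \<partial>M) \<longlonglongrightarrow> varentropy f"
    by (rule Lim_transform_eventually[OF varentropy_est_limit])
      (auto intro!: eventually_mono[OF eventually_ge_at_top[of 2]] simp: transfer(2))
  ultimately show ?thesis using transfer(1) by blast
qed

end
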